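(* Let $n\ge3$. (a) There exist a tropical line $L_n\subseteq\mathbb{R}^n$ and a rational projection $\pi:\mathbb{R}^n\to\mathbb{R}^2$ such that $\pi(L_n)$ has $\sum_{i=1}^{n-2}i=\binom{n-1}{2}$ self-intersection points. (b) For any positive integers $d_1,\ldots,d_{n-1}$ there exist a tropical curve $\mathcal{C}\subseteq\mathbb{R}^n$ which is a transversal intersection $\mathcal{C}=\bigcap_{i=1}^{n-1}\mathcal{T}(g_i)$ of tropical hypersurfaces with $\deg g_i=d_i$, and a rational projection $\pi:\mathbb{R}^n\to\mathbb{R}^2$ such that $\pi(\mathcal{C})$ has at least $(d_1\cdots d_{n-1})^2\binom{n-1}{2}$ self-intersection points.
   Context: $K$ is a field with a nontrivial real valuation (e.g. Puiseux series $\mathbb{C}\{\{t\}\}$). $\mathcal{T}(f)=\{w:\min_\alpha(\mathrm{val}(c_\alpha)+\alpha\cdot w)$ attained at least twice$\}$ for $f=\sum c_\alpha x^\alpha$; $\mathcal{T}(I)=\bigcap_{f\in I}\mathcal{T}(f)$. A tropical line in $\mathbb{R}^n$ is the tropical variety of an ideal generated by linear polynomials defining a line; it is a one-dimensional polyhedral complex (a tree) with bounded edges and $n+1$ unbounded rays in the directions $e^{(1)},\ldots,e^{(n)},-\sum_{i=1}^ne^{(i)}$. A rational projection $\pi:\mathbb{R}^n\to\mathbb{R}^2$ is $x\mapsto Ax$ with a rational $2\times n$ matrix of rank 2. Transversality of an intersection $\bigcap_i\mathcal{T}(g_i)$: for every subfamily of at least two hypersurfaces the intersection has the expected dimension and,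 for every cell $C=\bigcap_i C_i$ ($C_i$ minimal cells of $\mathcal{T}(g_i)$ containing $C$), the dual cell $C^\vee=\sum C_i^\vee$ in the regular subdivision of $\mathrm{New}(\prod g_i)$ satisfies $\dim C^\vee=\sum\dim C_i^\vee$. Self-intersection point: if the images $\pi(F_1),\pi(F_2)$ of two non-adjacent (disjoint) cells $F_1,F_2$ of the curve intersect in a point $a$, then $a$ is a self-intersection point of the curve under $\pi$; the count is the number of such distinct points. *)

theory Defs
  imports "HOL-Analysis.Analysis" "HOL-Library.Poly_Mapping"
begin

type_synonym ('n, 'k) mpoly = "('n \<Rightarrow>\<^sub>0 nat) \<Rightarrow>\<^sub>0 'k"

definition mpoly_eval :: "('n::finite, 'k::comm_ring_1) mpoly \<Rightarrow> ('n \<Rightarrow> 'k) \<Rightarrow> 'k" where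
  "mpoly_eval f x = (\<Sum>a\<in>Poly_Mapping.keys f. Poly_Mapping.lookup f a * (\<Prod>i\<in>UNIV. x i ^ Poly_Mapping.lookup (a::'n \<Rightarrow>\<^sub>0 nat) i))"

definition mon_deg :: "('n::finite \<Rightarrow>\<^sub>0 nat) \<Rightarrow> nat" where
  "mon_deg a = (\<Sum>i\<in>UNIV. Poly_Mapping.lookup a i)"

definition total_deg :: "('n::finite, 'k::zero) mpoly \<Rightarrow> nat" where
  "total_deg f = Max (insert 0 (mon_deg ` Poly_Mapping.keys f))"

definition gen_ideal :: "('n::finite, 'k::comm_ring_1) mpoly set \<Rightarrow> ('n, 'k) mpoly set" where
  "gen_ideal G = {f. \<exists>r. f = (\<Sum>g\<in>G. r g * g)}"

definition zero_set :: "('n::finite, 'k::comm_ring_1) mpoly set \<Rightarrow> ('n \<Rightarrow> 'k) set" where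
  "zero_set I = {x. \<forall>f\<in>I. mpoly_eval f x = 0}"

definition is_line :: "('n \<Rightarrow> 'k::field) set \<Rightarrow> bool" where
  "is_line S \<longleftrightarrow> (\<exists>p (v::'n \<Rightarrow> 'k). v \<noteq> (\<lambda>_. 0) \<and> S = {(\<lambda>i. p i + t * v i) | t. True})"

text \<open>a nontrivial real valuation on K (val is only used on nonzero elements; val 0 = infinity)\<close>
definition is_valuation :: "('k::field \<Rightarrow> real) \<Rightarrow> bool" where
  "is_valuation val \<longleftrightarrow>
     (\<forall>x y. x \<noteq> 0 \<longrightarrow> y \<noteq> 0 \<longrightarrow> val (x * y) = val x + val y) \<and>
     (\<forall>x y. x \<noteq> 0 \<longrightarrow> y \<noteq> 0 \<longrightarrow> x + y \<noteq> 0 \<longrightarrow> min (val x) (val y) \<le> val (x + y)) \<and>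
     (\<exists>x. x \<noteq> 0 \<and> val x \<noteq> 0)"

definition exp_vec :: "('n::finite \<Rightarrow>\<^sub>0 nat) \<Rightarrow> real^'n" where
  "exp_vec a = (\<chi> i. real (Poly_Mapping.lookup a i))"

definition init_exps :: "('k::field \<Rightarrow> real) \<Rightarrow> ('n::finite, 'k) mpoly \<Rightarrow> real^'n \<Rightarrow> ('n \<Rightarrow>\<^sub>0 nat) set" where
  "init_exps val f w = {a\<in>Poly_Mapping.keys f. \<forall>c\<in>Poly_Mapping.keys f.
       val (Poly_Mapping.lookup f a) + exp_vec a \<bullet> w \<le> val (Poly_Mapping.lookup f c) + exp_vec c \<bullet> w}"

definition trop_hyp :: "('k::field \<Rightarrow> real) \<Rightarrow> ('n::finite, 'k) mpoly \<Rightarrow> (real^'n) set" where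
  "trop_hyp val f = (if f = 0 then UNIV else {w. 2 \<le> card (init_exps val f w)})"

definition trop_var :: "('k::field \<Rightarrow> real) \<Rightarrow> ('n::finite, 'k) mpoly set \<Rightarrow> (real^'n) set" where
  "trop_var val I = (\<Inter>f\<in>I. trop_hyp val f)"

definition is_tropical_line :: "('k::field \<Rightarrow> real) \<Rightarrow> (real^'n::finite) set \<Rightarrow> bool" where
  "is_tropical_line val L \<longleftrightarrow>
     (\<exists>G::('n, 'k) mpoly set. finite G \<and> (\<forall>g\<in>G. total_deg g \<le> 1) \<and>
        is_line (zero_set (gen_ideal G)) \<and> L = trop_var val (gen_ideal G))"

definition has_dim :: "(real^'n::finite) set \<Rightarrow> int \<Rightarrow> bool" where
  "has_dim X k \<longleftrightarrow> (\<exists>P. polytope P \<and> P \<subseteq> X \<and> aff_dim P = k) \<and>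
                    (\<forall>P. polytope P \<and> P \<subseteq> X \<longrightarrow> aff_dim P \<le> k)"

text \<open>For a point w of the intersection, the minimal cell of T(g_i) containing w is dual to
  conv(init_exps g_i w); the dual cell of the intersection cell is the Minkowski sum.\<close>
definition transversal :: "('k::field \<Rightarrow> real) \<Rightarrow> nat \<Rightarrow> (nat \<Rightarrow> ('n::finite, 'k) mpoly) \<Rightarrow> bool" where
  "transversal val m g \<longleftrightarrow>
     (\<forall>S. S \<subseteq> {1..m} \<and> 2 \<le> card S \<longrightarrow>
        has_dim (\<Inter>i\<in>S. trop_hyp val (g i)) (int CARD('n) - int (card S)) \<and>
        (\<forall>w\<in>(\<Inter>i\<in>S. trop_hyp val (g i)).
           aff_dim {\<Sum>i\<in>S. a i | a. \<forall>i\<in>S. a i \<in> exp_vec ` init_exps val (g i) w}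
           = (\<Sum>i\<in>S. aff_dim (exp_vec ` init_exps val (g i) w))))"

definition regular_pt :: "(real^'n::finite) set \<Rightarrow> real^'n \<Rightarrow> bool" where
  "regular_pt C p \<longleftrightarrow> p \<in> C \<and> (\<exists>e>0. \<exists>u. u \<noteq> 0 \<and>
      C \<inter> ball p e = {p + t *\<^sub>R u | t. True} \<inter> ball p e)"

definition curve_vertices :: "(real^'n::finite) set \<Rightarrow> (real^'n) set" where
  "curve_vertices C = {p\<in>C. \<not> regular_pt C p}"

text \<open>cells of the (coarsest) polyhedral structure: vertices and closed edges\<close>
definition curve_cells :: "(real^'n::finite) set \<Rightarrow> (real^'n) set set" where
  "curve_cells C = {{v} | v. v \<in> curve_vertices C} \<union>
                   {closure E | E. E \<in> components (C - curve_vertices C)}"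

definition rational_projection :: "real^'n^2 \<Rightarrow> bool" where
  "rational_projection A \<longleftrightarrow> (\<forall>i j. A $ i $ j \<in> \<rat>) \<and> rank A = 2"

definition self_intersection_pts :: "real^'n^2 \<Rightarrow> (real^'n::finite) set \<Rightarrow> (real^2) set" where
  "self_intersection_pts A C = {a. \<exists>F1 F2. F1 \<in> curve_cells C \<and> F2 \<in> curve_cells C \<and>
      F1 \<inter> F2 = {} \<and> (\<lambda>x. A *v x) ` F1 \<inter> (\<lambda>x. A *v x) ` F2 = {a}}"

end

theory Submission
  imports Defs "HOL-Computational_Algebra.Polynomial"
begin

text \<open>
  Number the coordinates \<open>0, \<dots>, n - 1\<close>. The curve is the intersection of \<open>n - 1\<close> hypersurfaces, the \<open>j\<close>-th one
  being given by \<open>g\<^sub>j = p\<^sub>j(x\<^sub>0) + q\<^sub>j(x\<^sub>j)\<close> of degree \<open>d\<^sub>j\<close> and hence a cylinder over a plane tropical curve. The plane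
  curve has \<open>d\<^sub>j\<close> vertical rays, and exactly \<open>d\<^sub>j\<close> sheets over each point of a half-line of the \<open>w\<^sub>0\<close>-axis.
  The abscissae where the \<open>j\<close>-th cylinder is vertical or branches lie in \<open>val(\<pi>) (j + n\<int>)\<close>, so two cylinders
  are never special over the same \<open>w\<^sub>0\<close>; this gives transversality. Over a vertical ray of the \<open>i\<close>-th
  cylinder the curve contains one leg in direction \<open>e\<^sub>i\<close> for each choice of sheets of the others, that is
  \<open>d\<^sub>1 \<cdots> d\<^sub>n\<^sub>-\<^sub>1\<close> legs for each \<open>i\<close>. The projection sends \<open>e\<^sub>0\<close> to \<open>(1, 0)\<close> and \<open>e\<^sub>m\<close> to \<open>(T\<^sup>m, 1)\<close>; for small
  \<open>T > 0\<close> any two legs with different directions cross, and all these crossings are distinct. For degree one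
  the curve is a tropical line, a caterpillar tree, and there are no other double points.

  A self-intersection point needs control of cells. The component of a regular point in the complement of
  the vertices stays in the line through that point, so regular points \<open>x \<noteq> y\<close> with the same image and independent
  image directions lie in cells that are disjoint and whose images meet in one point.
\<close>

section \<open>Cells of a curve through regular points\<close>

text \<open>Since every hypersurface involves only \<open>x\<^sub>0\<close> and one further
  variable, the curve is a fibre product over the \<open>w\<^sub>0\<close>-axis: each equation is
  solved separately over a common \<open>w\<^sub>0\<close>. A dual cell can lose dimension only if
  two summands are degenerate over the same \<open>w\<^sub>0\<close>. The field is arbitrary, so the
  only coefficients at hand are powers of one element of positive valuation; generic coefficients
  are replaced by integer exponents with controlled residues. The walls must also be ordered by
  \<open>i\<close>. A leg of smaller index starts further left and, its image having direction
  \<open>(T ^ i, 1)\<close>, leans further to the right. Hence it meets every leg of larger index,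
  at a height that grows without bound as \<open>T\<close> tends to 0, while the heights where the
  legs begin to be straight rays do not depend on \<open>T\<close>. The same limit gives general
  position: each coincidence to be avoided is excluded for all small positive \<open>T\<close>, and
  there are finitely many of them.\<close>

lemma range_line_cong:
  fixes p q u :: "'a::real_vector"
  assumes "q \<in> range (\<lambda>t. p + t *\<^sub>R u)" "c \<noteq> 0" "v = c *\<^sub>R u"
  shows "range (\<lambda>t. q + t *\<^sub>R v) = range (\<lambda>t. p + t *\<^sub>R u)"
proof -
  obtain a where a: "q = p + a *\<^sub>R u" using assms(1) by blast
  have "q + t *\<^sub>R v = p + (a + t * c) *\<^sub>R u" for t
    using a assms(3) by (simp add: algebra_simps)
  moreover have "p + t *\<^sub>R u = q + ((t - a) / c) *\<^sub>R v" for t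
    using a assms(2,3) by (simp add: scaleR_add_left[symmetric] add.assoc)
  ultimately show ?thesis by blast
qed

text \<open>The points of the component near which \<open>C\<close> coincides with the line form an
  open and closed subset. No description of the edge, in particular of its end points, is
  needed.\<close>

lemma component_of_regular_pt_subset_line:
  fixes C :: "(real^'n::finite) set"
  assumes "p \<in> C" "u \<noteq> 0" "\<epsilon> > 0"
    and germ: "C \<inter> ball p \<epsilon> = {p + t *\<^sub>R u | t. True} \<inter> ball p \<epsilon>"
  shows "connected_component_set (C - curve_vertices C) p \<subseteq> range (\<lambda>t. p + t *\<^sub>R u)"
proof -
  define l where "l = range (\<lambda>t. p + t *\<^sub>R u)"
  define E where "E = connected_component_set (C - curve_vertices C) p"
  define H where "H = {q\<in>E. q \<in> l \<and> (\<exists>e>0. C \<inter> ball q e = l \<inter> ball q e)}"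
  have germ': "C \<inter> ball p \<epsilon> = l \<inter> ball p \<epsilon>" using germ by (auto simp: l_def)
  have "regular_pt C p" using assms unfolding regular_pt_def by blast
  hence pC: "p \<in> C - curve_vertices C" using assms(1) by (simp add: curve_vertices_def)
  hence pE: "p \<in> E" by (simp add: E_def)
  have Ereg: "regular_pt C q" if "q \<in> E" for q
    using that connected_component_subset[of "C - curve_vertices C" p]
    by (auto simp: E_def curve_vertices_def)
  have pl: "p \<in> l" unfolding l_def by (rule range_eqI[of _ _ 0]) simp
  have pH: "p \<in> H" using pE pl germ' assms(3) by (auto simp: H_def)
  have op: "\<exists>e>0. \<forall>y\<in>E. dist y q < e \<longrightarrow> y \<in> H" if q: "q \<in> H" for q
  proof -
    obtain e where e: "e > 0" "C \<inter> ball q e = l \<inter> ball q e" using q by (auto simp: H_def)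
    have "y \<in> H" if y: "y \<in> E" "dist y q < e" for y
    proof -
      have sub: "ball y (e - dist y q) \<subseteq> ball q e"
        by (simp add: ball_subset_ball_iff dist_commute)
      have "y \<in> C" using Ereg[OF y(1)] by (simp add: regular_pt_def)
      moreover have "y \<in> ball q e" using y(2) by (simp add: dist_commute)
      ultimately have "y \<in> l" using e(2) by blast
      moreover have "C \<inter> ball y (e - dist y q) = l \<inter> ball y (e - dist y q)" using sub e(2) by blast
      moreover have "e - dist y q > 0" using y by simp
      ultimately show ?thesis using y unfolding H_def by blast
    qed
    thus ?thesis using e(1) by blast
  qed
  have cl: "\<exists>e>0. \<forall>y\<in>E. dist y q < e \<longrightarrow> y \<in> E - H" if q: "q \<in> E - H" for q
  proof -
    obtain e v where e: "e > 0" "v \<noteq> 0" and ev: "C \<inter> ball q e = {q + t *\<^sub>R v | t. True} \<inter> ball q e"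
      using Ereg q unfolding regular_pt_def by blast
    have "y \<notin> H" if y: "dist y q < e" for y
    proof
      assume yH: "y \<in> H"
      obtain \<delta> where \<delta>: "\<delta> > 0" "C \<inter> ball y \<delta> = l \<inter> ball y \<delta>" using yH by (auto simp: H_def)
      define r where "r = min \<delta> (e - dist y q)"
      have r: "r > 0" using \<delta> y by (simp add: r_def)
      have sub: "ball y r \<subseteq> ball q e" "ball y r \<subseteq> ball y \<delta>"
        by (auto simp: ball_subset_ball_iff r_def dist_commute)
      \<comment> \<open>A second point of the line close to \<open>y\<close>. Both \<open>y\<close>
        and \<open>z\<close> lie on the germ of \<open>C\<close> at \<open>q\<close>, and two points
        determine the line, so the two germs belong to the same line.\<close>
      define z where "z = y + (r / (2 * norm u)) *\<^sub>R u"
      have zb: "z \<in> ball y r" using r assms(2) by (simp add: z_def dist_norm)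
      have ll: "range (\<lambda>t. y + t *\<^sub>R u) = l" unfolding l_def
        by (rule range_line_cong[where c=1]) (use yH in \<open>auto simp: H_def l_def\<close>)
      have zl: "z \<in> l" unfolding ll[symmetric] z_def by blast
      have yl: "y \<in> l" using yH by (simp add: H_def)
      have yb: "y \<in> ball y r" using r by simp
      have "z \<in> {q + t *\<^sub>R v | t. True}" "y \<in> {q + t *\<^sub>R v | t. True}"
        using zb zl yl yb sub ev \<delta>(2) by blast+
      then obtain s t where st: "z = q + s *\<^sub>R v" "y = q + t *\<^sub>R v" by blast
      define k where "k = r / (2 * norm u)"
      have k: "k \<noteq> 0" using r assms(2) by (simp add: k_def)
      have "u = (1 / k) *\<^sub>R (k *\<^sub>R u)" using k by simp
      also have "k *\<^sub>R u = (s - t) *\<^sub>R v" using st by (simp add: z_def k_def algebra_simps)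
      finally have "u = ((s - t) / k) *\<^sub>R v" by simp
      then obtain c where c: "u = c *\<^sub>R v" by blast
      have c0: "c \<noteq> 0" using c assms(2) by auto
      have "range (\<lambda>t. y + t *\<^sub>R u) = range (\<lambda>t. q + t *\<^sub>R v)"
        by (rule range_line_cong[OF _ c0 c]) (use st in auto)
      hence "l = {q + t *\<^sub>R v | t. True}" using ll by auto
      moreover have "q \<in> {q + t *\<^sub>R v | t. True}" by (auto intro: exI[of _ 0])
      ultimately have "q \<in> H" using q e(1) ev unfolding H_def by blast
      thus False using q by blast
    qed
    thus ?thesis using e(1) by (meson DiffI)
  qed
  have "openin (top_of_set E) H"
    unfolding openin_euclidean_subtopology_iff using op by (auto simp: H_def)
  moreover have "closedin (top_of_set E) H"
    unfolding closedin_def openin_euclidean_subtopology_iff using cl by (auto simp: H_def)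
  moreover have "connected E" by (simp add: E_def)
  ultimately have "H = E" using pH unfolding connected_clopen by blast
  thus ?thesis by (auto simp: H_def E_def l_def)
qed

lemma regular_pt_cell:
  fixes C :: "(real^'n::finite) set"
  assumes "p \<in> C" "u \<noteq> 0" "\<epsilon> > 0"
    and "C \<inter> ball p \<epsilon> = {p + t *\<^sub>R u | t. True} \<inter> ball p \<epsilon>"
  obtains F where "F \<in> curve_cells C" "p \<in> F" "F \<subseteq> range (\<lambda>t. p + t *\<^sub>R u)"
proof
  let ?E = "connected_component_set (C - curve_vertices C) p"
  have "regular_pt C p" using assms unfolding regular_pt_def by blast
  hence p: "p \<in> C - curve_vertices C" using assms(1) by (simp add: curve_vertices_def)
  show "closure ?E \<in> curve_cells C"
    using p unfolding curve_cells_def components_def by blast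
  show "p \<in> closure ?E" using p closure_subset by (metis connected_component_refl_eq mem_Collect_eq subsetD)
  have "closed (range (\<lambda>t. p + t *\<^sub>R u))"
  proof -
    have "range (\<lambda>t. p + t *\<^sub>R u) = (+) p ` span {u}" by (auto simp: span_singleton)
    thus ?thesis by (simp add: closed_translation)
  qed
  thus "closure ?E \<subseteq> range (\<lambda>t. p + t *\<^sub>R u)"
    using component_of_regular_pt_subset_line[OF assms] by (simp add: closure_minimal)
qed

text \<open>The two cells lie on lines whose images have independent directions, so points of the
  two cells with equal image can only be \<open>x\<close> and \<open>y\<close>. As \<open>x\<close>
  and \<open>y\<close> differ, the cells are disjoint, which is how non-adjacency is obtained from
  local data alone.\<close>

lemma self_intersection_ptsI:
  fixes C :: "(real^'n::finite) set" and A :: "real^'n^2"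
  assumes x: "x \<in> C" "u \<noteq> 0" "\<epsilon> > 0" "C \<inter> ball x \<epsilon> = {x + t *\<^sub>R u | t. True} \<inter> ball x \<epsilon>"
    and y: "y \<in> C" "v \<noteq> 0" "\<delta> > 0" "C \<inter> ball y \<delta> = {y + t *\<^sub>R v | t. True} \<inter> ball y \<delta>"
    and A: "A *v x = a" "A *v y = a" and "x \<noteq> y"
    and indep: "\<And>s t. s *\<^sub>R (A *v u) = t *\<^sub>R (A *v v) \<Longrightarrow> s = 0 \<and> t = 0"
  shows "a \<in> self_intersection_pts A C"
proof -
  obtain F where F: "F \<in> curve_cells C" "x \<in> F" "F \<subseteq> range (\<lambda>t. x + t *\<^sub>R u)"
    using regular_pt_cell[OF x] .
  obtain G where G: "G \<in> curve_cells C" "y \<in> G" "G \<subseteq> range (\<lambda>t. y + t *\<^sub>R v)"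
    using regular_pt_cell[OF y] .
  have key: "p = x \<and> q = y" if "p \<in> F" "q \<in> G" "A *v p = A *v q" for p q
  proof -
    have "p \<in> range (\<lambda>t. x + t *\<^sub>R u)" "q \<in> range (\<lambda>t. y + t *\<^sub>R v)" using F(3) G(3) that by auto
    then obtain s t where st: "p = x + s *\<^sub>R u" "q = y + t *\<^sub>R v" by blast
    have "s *\<^sub>R (A *v u) = t *\<^sub>R (A *v v)"
      using that(3) A by (simp add: st matrix_vector_right_distrib matrix_vector_mult_scaleR)
    hence "s = 0 \<and> t = 0" by (rule indep)
    thus ?thesis using st by simp
  qed
  have "F \<inter> G = {}" using key \<open>x \<noteq> y\<close> by blast
  moreover have "(\<lambda>x. A *v x) ` F \<inter> (\<lambda>x. A *v x) ` G = {a}"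
  proof (intro equalityI subsetI)
    fix b assume "b \<in> (\<lambda>x. A *v x) ` F \<inter> (\<lambda>x. A *v x) ` G"
    then obtain p q where "p \<in> F" "q \<in> G" "b = A *v p" "b = A *v q" by blast
    thus "b \<in> {a}" using key[of p q] A by simp
  next
    fix b assume "b \<in> {a}"
    hence "b = A *v x" "b = A *v y" using A by simp_all
    thus "b \<in> (\<lambda>x. A *v x) ` F \<inter> (\<lambda>x. A *v x) ` G" using F(2) G(2) by blast
  qed
  ultimately show ?thesis using F(1) G(1) unfolding self_intersection_pts_def by blast
qed

section \<open>Affine dimension\<close>

lemma aff_dim_Minkowski_sum:
  fixes A B :: "'a::euclidean_space set"
  assumes a: "a \<in> A" and b: "b \<in> B"
    and disj: "span ((\<lambda>x. x - a) ` A) \<inter> span ((\<lambda>x. x - b) ` B) \<subseteq> {0}"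
  shows "aff_dim {x + y | x y. x \<in> A \<and> y \<in> B} = aff_dim A + aff_dim B"
proof -
  let ?U = "span ((\<lambda>x. x - a) ` A)" and ?V = "span ((\<lambda>x. x - b) ` B)"
  let ?M = "{x + y | x y. x \<in> A \<and> y \<in> B}"
  let ?D = "(\<lambda>x. x - (a + b)) ` ?M"
  have span_D: "span ?D = {x + y | x y. x \<in> ?U \<and> y \<in> ?V}"
  proof (intro equalityI span_minimal subsetI)
    show "subspace {x + y | x y. x \<in> ?U \<and> y \<in> ?V}" by (intro subspace_sums subspace_span)
  next
    fix w assume "w \<in> ?D"
    then obtain x y where "x \<in> A" "y \<in> B" "w = (x - a) + (y - b)" by auto
    thus "w \<in> {x + y | x y. x \<in> ?U \<and> y \<in> ?V}" by (blast intro: span_base)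
  next
    fix w assume "w \<in> {x + y | x y. x \<in> ?U \<and> y \<in> ?V}"
    then obtain x y where w: "w = x + y" "x \<in> ?U" "y \<in> ?V" by blast
    have "(\<lambda>x. x - a) ` A \<subseteq> ?D"
    proof
      fix t assume "t \<in> (\<lambda>x. x - a) ` A"
      then obtain x where "x \<in> A" "t = (x + b) - (a + b)" by auto
      thus "t \<in> ?D" using b by blast
    qed
    moreover have "(\<lambda>x. x - b) ` B \<subseteq> ?D"
    proof
      fix t assume "t \<in> (\<lambda>x. x - b) ` B"
      then obtain x where "x \<in> B" "t = (a + x) - (a + b)" by auto
      thus "t \<in> ?D" using a by blast
    qed
    ultimately have "x \<in> span ?D" "y \<in> span ?D" using w span_mono by blast+
    thus "w \<in> span ?D" using w by (simp add: span_add)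
  qed
  have "dim ?D = dim (span ?D)" by (rule dim_span[symmetric])
  also have "\<dots> = dim {x + y | x y. x \<in> ?U \<and> y \<in> ?V}" unfolding span_D ..
  also have "\<dots> = dim ?U + dim ?V"
  proof -
    have "?U \<inter> ?V = {0}" using disj by (auto simp: span_zero)
    thus ?thesis using dim_sums_Int[of ?U ?V] by simp
  qed
  finally have "int (dim ?D) = int (dim ((\<lambda>x. x - a) ` A)) + int (dim ((\<lambda>x. x - b) ` B))" by simp
  moreover have "a + b \<in> affine hull ?M" using a b by (blast intro: hull_inc)
  ultimately show ?thesis
    using a b by (simp add: aff_dim_eq_dim_subtract[of "a + b" ?M] aff_dim_eq_dim_subtract[of a A]
        aff_dim_eq_dim_subtract[of b B] hull_inc)
qed

text \<open>Each pair moves in a coordinate \<open>e i\<close> in which all other summands are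
  constant, so adding it raises the dimension by exactly one. Only the coordinate \<open>z\<close>
  is shared. The set with index \<open>j\<close> need not be a pair: it will be the one dual cell
  that may have dimension two.\<close>

lemma aff_dim_Minkowski_sum_family:
  fixes E :: "'i \<Rightarrow> (real^'n::finite) set" and e :: "'i \<Rightarrow> 'n"
  assumes "finite S" "j \<notin> S" "E j \<noteq> {}" "inj_on e (insert j S)" "z \<notin> e ` insert j S"
    and supp: "\<And>i x y k. i \<in> insert j S \<Longrightarrow> x \<in> E i \<Longrightarrow> y \<in> E i \<Longrightarrow> k \<noteq> z \<Longrightarrow> k \<noteq> e i \<Longrightarrow> x $ k = y $ k"
    and two: "\<And>i. i \<in> S \<Longrightarrow> \<exists>p q. E i = {p, q} \<and> p $ e i \<noteq> q $ e i"
  shows "aff_dim {\<Sum>i\<in>insert j S. a i | a. \<forall>i\<in>insert j S. a i \<in> E i} = (\<Sum>i\<in>insert j S. aff_dim (E i))"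
  using assms
proof (induction S rule: finite_induct)
  case empty
  have "{\<Sum>i\<in>{j}. a i | a. \<forall>i\<in>{j}. a i \<in> E i} = E j" by (auto intro: exI[of _ "\<lambda>_. _"])
  thus ?case by simp
next
  case (insert m S)
  let ?I = "insert j S"
  let ?M = "{\<Sum>i\<in>?I. a i | a. \<forall>i\<in>?I. a i \<in> E i}"
  have mI: "m \<notin> ?I" using insert.hyps insert.prems by auto
  have fI: "finite ?I" using insert.hyps by simp
  have IH: "aff_dim ?M = (\<Sum>i\<in>?I. aff_dim (E i))"
    by (rule insert.IH) (use insert.prems in \<open>auto intro: inj_on_subset\<close>)
  obtain p q where pq: "E m = {p, q}" "p $ e m \<noteq> q $ e m" using insert.prems(6)[of m] by blast
  have ne: "\<exists>a. \<forall>i\<in>?I. a i \<in> E i"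
  proof -
    have "\<forall>i\<in>?I. \<exists>x. x \<in> E i" using insert.prems(2,6) by blast
    thus ?thesis by (rule bchoice)
  qed
  then obtain a where a: "\<forall>i\<in>?I. a i \<in> E i" by blast
  have eq: "{\<Sum>i\<in>insert j (insert m S). a i | a. \<forall>i\<in>insert j (insert m S). a i \<in> E i}
      = {x + y | x y. x \<in> ?M \<and> y \<in> E m}" (is "?L = ?R")
  proof (intro equalityI subsetI)
    fix w assume "w \<in> ?L"
    then obtain b where b: "w = (\<Sum>i\<in>insert m ?I. b i)" "\<forall>i\<in>insert m ?I. b i \<in> E i"
      by (auto simp: insert_commute)
    hence "w = (\<Sum>i\<in>?I. b i) + b m" by (simp only: sum.insert[OF fI mI] add.commute)
    thus "w \<in> ?R" using b(2) by blast
  next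
    fix w assume "w \<in> ?R"
    then obtain b y where b: "w = (\<Sum>i\<in>?I. b i) + y" "\<forall>i\<in>?I. b i \<in> E i" "y \<in> E m" by blast
    have "(\<Sum>i\<in>?I. b i) = (\<Sum>i\<in>?I. (b(m := y)) i)" using mI by (intro sum.cong) auto
    hence "w = (\<Sum>i\<in>insert m ?I. (b(m := y)) i)" using b(1)
      by (simp only: sum.insert[OF fI mI] add.commute fun_upd_same)
    moreover have "\<forall>i\<in>insert m ?I. (b(m := y)) i \<in> E i" using b by auto
    ultimately show "w \<in> ?L" unfolding insert_commute[of j m] by blast
  qed
  have coord: "x $ e m = 0" if "x \<in> span ((\<lambda>x. x - (\<Sum>i\<in>?I. a i)) ` ?M)" for x
  proof -
    have "span ((\<lambda>x. x - (\<Sum>i\<in>?I. a i)) ` ?M) \<subseteq> {x. x $ e m = 0}"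
    proof (rule span_minimal)
      show "subspace {x::real^'n. x $ e m = 0}" by (auto simp: subspace_def)
      have "(\<Sum>i\<in>?I. b i) $ e m = (\<Sum>i\<in>?I. a i) $ e m" if b: "\<forall>i\<in>?I. b i \<in> E i" for b
      proof -
        have "b i $ e m = a i $ e m" if i: "i \<in> ?I" for i
        proof (rule insert.prems(5)[of i])
          show "e m \<noteq> e i" using insert.prems(3) i mI by (metis inj_on_eq_iff insertCI insertE)
          show "e m \<noteq> z" using insert.prems(4) by auto
        qed (use i a b in auto)
        thus ?thesis by simp
      qed
      thus "(\<lambda>x. x - (\<Sum>i\<in>?I. a i)) ` ?M \<subseteq> {x. x $ e m = 0}" by auto
    qed
    thus ?thesis using that by blast
  qed
  have "aff_dim {x + y | x y. x \<in> ?M \<and> y \<in> E m} = aff_dim ?M + aff_dim (E m)"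
  proof (rule aff_dim_Minkowski_sum)
    show "(\<Sum>i\<in>?I. a i) \<in> ?M" using a by blast
    show "p \<in> E m" using pq by simp
    have "(\<lambda>x. x - p) ` E m \<subseteq> span {q - p}" using pq by (auto simp: span_zero span_base)
    hence sp: "span ((\<lambda>x. x - p) ` E m) \<subseteq> span {q - p}" by (simp add: span_minimal)
    show "span ((\<lambda>x. x - (\<Sum>i\<in>?I. a i)) ` ?M) \<inter> span ((\<lambda>x. x - p) ` E m) \<subseteq> {0}"
    proof
      fix x assume x: "x \<in> span ((\<lambda>x. x - (\<Sum>i\<in>?I. a i)) ` ?M) \<inter> span ((\<lambda>x. x - p) ` E m)"
      then obtain c where c: "x = c *\<^sub>R (q - p)" using sp by (auto simp: span_singleton)
      have "x $ e m = 0" using coord x by blast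
      hence "c = 0" using pq c by simp
      thus "x \<in> {0}" using c by simp
    qed
  qed
  thus ?case using IH eq fI mI by (simp add: insert_commute[of j m] del: insert_iff)
qed

text \<open>A segment from a point covered only by \<open>A\<close> to a point outside
  \<open>A\<close> leaves \<open>A\<close> at once. One of the finitely many other spaces contains
  two of its later points, hence the whole line, hence the starting point as well.\<close>

lemma convex_subset_Union_affine:
  fixes P :: "'a::real_vector set"
  assumes "finite F" "convex P" "P \<noteq> {}" "\<And>A. A \<in> F \<Longrightarrow> affine A" "P \<subseteq> \<Union>F"
  shows "\<exists>A\<in>F. P \<subseteq> A"
  using assms(1,4,5)
proof (induction F rule: finite_induct)
  case empty
  thus ?case using assms(3) by simp
next
  case (insert A F)
  show ?case
  proof (rule ccontr)
    assume neg: "\<not> ?thesis"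
    hence "\<not> P \<subseteq> \<Union>F" using insert.IH insert.prems by blast
    then obtain p where p: "p \<in> P" "p \<notin> \<Union>F" by blast
    hence pA: "p \<in> A" using insert.prems by auto
    obtain q where q: "q \<in> P" "q \<notin> A" using neg by blast
    define l where "l t = p + t *\<^sub>R (q - p)" for t
    have l: "l t = (1 - t) *\<^sub>R p + t *\<^sub>R q" for t by (simp add: l_def algebra_simps)
    have aff: "l t \<in> B" if "affine B" "l r \<in> B" "l s \<in> B" "r \<noteq> s" for B r s t
    proof -
      define c where "c = (t - r) / (s - r)"
      have "c * (s - r) = t - r" using that(4) by (simp add: c_def)
      hence t: "t = (1 - c) * r + c * s" by (simp add: algebra_simps)
      have "(1 - c) *\<^sub>R l r + c *\<^sub>R l s = l t"
        unfolding l_def by (subst t) (simp add: algebra_simps)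
      thus ?thesis using that(1-3) unfolding affine_alt by metis
    qed
    have affs: "affine A" "\<And>B. B \<in> F \<Longrightarrow> affine B" using insert.prems by auto
    have "l t \<in> \<Union>F" if t: "t \<in> {0<..1}" for t
    proof -
      have "l t \<in> P" using t p(1) q(1) assms(2) unfolding l convex_alt by simp
      moreover have "l t \<notin> A"
      proof
        assume "l t \<in> A"
        moreover have "l 0 \<in> A" using pA by (simp add: l_def)
        ultimately have "l 1 \<in> A" using aff[OF affs(1), of t 0 1] t by auto
        thus False using q by (simp add: l_def)
      qed
      ultimately show ?thesis using insert.prems by auto
    qed
    hence "\<forall>t\<in>{0<..1}. \<exists>B\<in>F. l t \<in> B" by blast
    then obtain B where B: "B \<in> F" "infinite {t. t \<in> {0<..1} \<and> l t \<in> B}"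
      using pigeonhole_infinite_rel[of "{0<..1::real}" F "\<lambda>t B. l t \<in> B"] insert.hyps(1) infinite_Ioc by force
    obtain r where r: "r \<in> {t\<in>{0<..1}. l t \<in> B}" using infinite_imp_nonempty[OF B(2)] by blast
    have "infinite ({t\<in>{0<..1}. l t \<in> B} - {r})" using B(2) by simp
    then obtain s where s: "s \<in> {t\<in>{0<..1}. l t \<in> B} - {r}" using infinite_imp_nonempty by blast
    have "l 0 \<in> B" using aff[OF affs(2)[OF B(1)], of r s 0] r s by auto
    thus False using p B(1) by (auto simp: l_def)
  qed
qed

text \<open>Turns the dimension of a dual cell into a bound on the codimension of the cell.\<close>

lemma aff_dim_add_le_if_orthogonal:
  fixes P Q :: "'a::euclidean_space set"
  assumes "P \<noteq> {}" "Q \<noteq> {}"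
    and orth: "\<And>x y a b. x \<in> P \<Longrightarrow> y \<in> P \<Longrightarrow> a \<in> Q \<Longrightarrow> b \<in> Q \<Longrightarrow> (x - y) \<bullet> (a - b) = 0"
  shows "aff_dim P + aff_dim Q \<le> int DIM('a)"
proof -
  obtain p q where p: "p \<in> P" and q: "q \<in> Q" using assms by blast
  have "dim ((\<lambda>x. x - p) ` P \<union> (\<lambda>x. x - q) ` Q) = dim ((\<lambda>x. x - p) ` P) + dim ((\<lambda>x. x - q) ` Q)"
    by (rule dim_orthogonal_sum) (use p q orth in auto)
  moreover have "dim ((\<lambda>x. x - p) ` P \<union> (\<lambda>x. x - q) ` Q) \<le> DIM('a)" by (rule dim_subset_UNIV)
  ultimately show ?thesis
    using p q by (simp add: aff_dim_eq_dim_subtract[of p P] aff_dim_eq_dim_subtract[of q Q] hull_inc)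
qed

lemma aff_dim_coordinate_simplex:
  fixes p :: "real^'n::finite"
  shows "polytope (convex hull (insert p ((\<lambda>k. p + axis k 1) ` N)))"
    and "aff_dim (convex hull (insert p ((\<lambda>k. p + axis k 1) ` N))) = int (card N)"
proof -
  let ?S = "insert p ((\<lambda>k. p + axis k 1) ` N)"
  show "polytope (convex hull ?S)" unfolding polytope_def by (rule exI[of _ ?S]) simp
  have im: "(\<lambda>x. x - p) ` ?S = insert 0 ((\<lambda>k. axis k (1::real)) ` N)" by (simp add: image_image)
  have "dim (insert 0 ((\<lambda>k. axis k (1::real)) ` N)) = dim ((\<lambda>k. axis k (1::real)) ` N)"
    by (simp add: dim_insert span_zero)
  also have "\<dots> = card ((\<lambda>k. axis k (1::real)) ` N)"
  proof (rule dim_eq_card_independent)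
    have "(\<lambda>k. axis k (1::real)) ` N \<subseteq> Basis" by (auto simp: Basis_vec_def)
    thus "independent ((\<lambda>k. axis k (1::real)) ` N)" using independent_Basis independent_mono by blast
  qed
  also have "\<dots> = card N" by (rule card_image) (auto simp: inj_on_def axis_eq_axis)
  finally show "aff_dim (convex hull ?S) = int (card N)"
    unfolding aff_dim_convex_hull by (simp only: aff_dim_eq_dim_subtract[of p ?S, OF hull_inc[OF insertI1]] im)
qed

section \<open>Valuations and tropical hypersurfaces\<close>

text \<open>Coefficients are pushed along \<open>\<phi>\<close>, so that the same lemmas serve for
  evaluation in the field and for substitution of elements of K[t].\<close>

definition eval_hom :: "('k::comm_ring_1 \<Rightarrow> 'r::comm_ring_1) \<Rightarrow> ('n::finite, 'k) mpoly \<Rightarrow> ('n \<Rightarrow> 'r) \<Rightarrow> 'r" where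
  "eval_hom \<phi> f X = (\<Sum>a\<in>Poly_Mapping.keys f. \<phi> (Poly_Mapping.lookup f a) * (\<Prod>i\<in>UNIV. X i ^ Poly_Mapping.lookup a i))"

lemma mpoly_eval_eq_eval_hom: "mpoly_eval f x = eval_hom (\<lambda>c. c) f x"
  by (simp add: mpoly_eval_def eval_hom_def)

lemma poly_mapping_eq_sum_single:
  "f = (\<Sum>a\<in>Poly_Mapping.keys f. Poly_Mapping.single a (Poly_Mapping.lookup f a))"
  by (intro poly_mapping_eqI)
    (auto simp: lookup_sum lookup_single when_def sum.delta' in_keys_iff intro!: sym[OF sum.neutral])

context
  fixes \<phi> :: "'k::comm_ring_1 \<Rightarrow> 'r::comm_ring_1"
  assumes add: "\<And>x y. \<phi> (x + y) = \<phi> x + \<phi> y" and mult: "\<And>x y. \<phi> (x * y) = \<phi> x * \<phi> y"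
begin

lemma hom_zero: "\<phi> 0 = 0"
  using add[of 0 0] by simp

lemma eval_hom_superset:
  assumes "finite S" "Poly_Mapping.keys f \<subseteq> S"
  shows "eval_hom \<phi> f X = (\<Sum>a\<in>S. \<phi> (Poly_Mapping.lookup f a) * (\<Prod>i\<in>UNIV. X i ^ Poly_Mapping.lookup a i))"
  unfolding eval_hom_def
  by (rule sum.mono_neutral_left) (use assms in \<open>auto simp: in_keys_iff hom_zero\<close>)

lemma eval_hom_add: "eval_hom \<phi> (f + g) X = eval_hom \<phi> f X + eval_hom \<phi> g X"
proof -
  let ?S = "Poly_Mapping.keys f \<union> Poly_Mapping.keys g"
  have "Poly_Mapping.keys (f + g) \<subseteq> ?S" by (rule keys_add)
  thus ?thesis
    by (simp add: eval_hom_superset[of ?S] lookup_add add distrib_right sum.distrib)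
qed

lemma eval_hom_zero: "eval_hom \<phi> 0 X = 0"
  by (simp add: eval_hom_def)

lemma eval_hom_sum: "eval_hom \<phi> (\<Sum>i\<in>I. F i) X = (\<Sum>i\<in>I. eval_hom \<phi> (F i) X)"
  by (induction I rule: infinite_finite_induct) (simp_all add: eval_hom_add eval_hom_zero)

lemma eval_hom_single:
  "eval_hom \<phi> (Poly_Mapping.single a c) X = \<phi> c * (\<Prod>i\<in>UNIV. X i ^ Poly_Mapping.lookup a i)"
  by (simp add: eval_hom_superset[of "{a}"])

lemma eval_hom_mult: "eval_hom \<phi> (f * g) X = eval_hom \<phi> f X * eval_hom \<phi> g X"
proof -
  let ?c = "Poly_Mapping.lookup" and ?s = "Poly_Mapping.single"
  have s: "eval_hom \<phi> (?s (a + b) (c * c')) X = eval_hom \<phi> (?s a c) X * eval_hom \<phi> (?s b c') X" for a b c c'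
    by (simp add: eval_hom_single mult lookup_add power_add prod.distrib mult_ac)
  have "f * g = (\<Sum>a\<in>Poly_Mapping.keys f. ?s a (?c f a)) * (\<Sum>b\<in>Poly_Mapping.keys g. ?s b (?c g b))"
    by (simp only: poly_mapping_eq_sum_single[symmetric])
  also have "\<dots> = (\<Sum>a\<in>Poly_Mapping.keys f. \<Sum>b\<in>Poly_Mapping.keys g. ?s (a + b) (?c f a * ?c g b))"
    by (simp add: sum_product mult_single)
  finally have "eval_hom \<phi> (f * g) X
      = (\<Sum>a\<in>Poly_Mapping.keys f. eval_hom \<phi> (?s a (?c f a)) X) * (\<Sum>b\<in>Poly_Mapping.keys g. eval_hom \<phi> (?s b (?c g b)) X)"
    by (simp add: eval_hom_sum sum_product s)
  thus ?thesis
    by (simp only: eval_hom_sum[symmetric] poly_mapping_eq_sum_single[symmetric])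
qed

lemma eval_hom_gen_ideal:
  assumes "f \<in> gen_ideal G" "\<And>g. g \<in> G \<Longrightarrow> eval_hom \<phi> g X = 0"
  shows "eval_hom \<phi> f X = 0"
  using assms by (auto simp: gen_ideal_def eval_hom_sum eval_hom_mult)

end

lemma gen_ideal_superset:
  assumes "finite G" "g \<in> G"
  shows "g \<in> gen_ideal G"
proof -
  have "g = (\<Sum>h\<in>G. (if h = g then 1 else 0) * h)"
    using assms by (simp add: if_distrib[of "\<lambda>x. x * _"] sum.delta cong: if_cong)
  thus ?thesis unfolding gen_ideal_def by (intro CollectI exI[of _ "\<lambda>h. if h = g then 1 else 0"])
qed

section \<open>Ultrametric estimates and Gauss valuations on K[t]\<close>

locale valued_field =
  fixes val :: "'k::field \<Rightarrow> real"
  assumes is_val: "is_valuation val"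
begin

lemma val_mult: "x \<noteq> 0 \<Longrightarrow> y \<noteq> 0 \<Longrightarrow> val (x * y) = val x + val y"
  using is_val by (simp add: is_valuation_def)

lemma val_add: "x \<noteq> 0 \<Longrightarrow> y \<noteq> 0 \<Longrightarrow> x + y \<noteq> 0 \<Longrightarrow> min (val x) (val y) \<le> val (x + y)"
  using is_val by (simp add: is_valuation_def)

lemma val_one [simp]: "val 1 = 0"
  using val_mult[of 1 1] by simp

lemma val_uminus [simp]: "val (- x) = val x"
proof (cases "x = 0")
  case False
  have "val ((-1) * (-1)) = val (-1) + val (-1)" by (rule val_mult) auto
  hence "val (-1) = 0" by simp
  thus ?thesis using val_mult[of "-1" x] False by simp
qed simp

lemma val_inverse: "x \<noteq> 0 \<Longrightarrow> val (inverse x) = - val x"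
  using val_mult[of x "inverse x"] by simp

lemma val_power: "x \<noteq> 0 \<Longrightarrow> val (x ^ n) = real n * val x"
  by (induction n) (simp_all add: val_mult algebra_simps)

lemma val_power_int: "x \<noteq> 0 \<Longrightarrow> val (x powi m) = real_of_int m * val x"
  by (cases "m \<ge> 0") (simp_all add: power_int_def val_power val_inverse)

text \<open>\<open>val 0\<close> is an arbitrary real number; the alternative \<open>f i = 0\<close>
  stands for infinite valuation, here and below.\<close>

lemma val_sum_gt:
  assumes "\<And>i. i \<in> I \<Longrightarrow> f i = 0 \<or> c < val (f i)"
  shows "sum f I = 0 \<or> c < val (sum f I)"
  using assms
proof (induction I rule: infinite_finite_induct)
  case (insert i I)
  hence "f i = 0 \<or> c < val (f i)" "sum f I = 0 \<or> c < val (sum f I)" by auto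
  thus ?case using val_add[of "f i" "sum f I"] insert.hyps by (cases "f i = 0"; cases "sum f I = 0"; cases "f i + sum f I = 0") auto
qed simp_all

lemma val_sum_ge:
  assumes "\<And>i. i \<in> I \<Longrightarrow> f i = 0 \<or> c \<le> val (f i)"
  shows "sum f I = 0 \<or> c \<le> val (sum f I)"
  using assms
proof (induction I rule: infinite_finite_induct)
  case (insert i I)
  hence "f i = 0 \<or> c \<le> val (f i)" "sum f I = 0 \<or> c \<le> val (sum f I)" by auto
  thus ?case using val_add[of "f i" "sum f I"] insert.hyps by (cases "f i = 0"; cases "sum f I = 0"; cases "f i + sum f I = 0") auto
qed simp_all

text \<open>A unique least term cannot be cancelled. The reverse inequality comes from writing
  \<open>x\<close> as \<open>(x + y) + - y\<close> and applying the ultrametric inequality once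
  more.\<close>

lemma val_add_eq:
  assumes "x \<noteq> 0" "y = 0 \<or> val x < val y"
  shows "x + y \<noteq> 0" "val (x + y) = val x"
proof -
  show 1: "x + y \<noteq> 0"
  proof
    assume "x + y = 0"
    hence "y = - x" by (simp add: eq_neg_iff_add_eq_0 add.commute)
    thus False using assms by auto
  qed
  show "val (x + y) = val x"
  proof (cases "y = 0")
    case False
    hence "min (val x) (val y) \<le> val (x + y)" using assms 1 val_add by blast
    moreover have "min (val (x + y)) (val (- y)) \<le> val ((x + y) + - y)"
      using 1 False assms by (intro val_add) auto
    ultimately show ?thesis using assms False by (auto simp: min_def split: if_splits)
  qed simp
qed

text \<open>The Gauss valuation on K[t] in which t has valuation \<open>r\<close>. As a relation it
  simply assigns no value to the zero polynomial.\<close>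

definition gauss_val :: "real \<Rightarrow> 'k poly \<Rightarrow> real \<Rightarrow> bool" where
  "gauss_val r p m \<longleftrightarrow>
     (\<forall>k. coeff p k \<noteq> 0 \<longrightarrow> m \<le> val (coeff p k) + real k * r) \<and>
     (\<exists>k. coeff p k \<noteq> 0 \<and> val (coeff p k) + real k * r = m)"

text \<open>Gauss's lemma: at the sum of the least exponents where the two minima are attained, exactly one
  product of coefficients has the least value, so nothing cancels.\<close>
lemma gauss_val_mult:
  assumes "gauss_val r p m" "gauss_val r q m'"
  shows "gauss_val r (p * q) (m + m')"
proof -
  have le: "coeff p k \<noteq> 0 \<Longrightarrow> m \<le> val (coeff p k) + real k * r"
    and le': "coeff q k \<noteq> 0 \<Longrightarrow> m' \<le> val (coeff q k) + real k * r" for k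
    using assms by (auto simp: gauss_val_def)
  define P where "P k \<longleftrightarrow> coeff p k \<noteq> 0 \<and> val (coeff p k) + real k * r = m" for k
  define Q where "Q k \<longleftrightarrow> coeff q k \<noteq> 0 \<and> val (coeff q k) + real k * r = m'" for k
  define k where "k = (LEAST k. P k)"
  define l where "l = (LEAST k. Q k)"
  have "\<exists>k. P k" "\<exists>k. Q k" using assms by (simp_all add: gauss_val_def P_def Q_def)
  hence k: "P k" and l: "Q l" unfolding k_def l_def by (auto intro: LeastI_ex)
  have k': "\<not> P i" if "i < k" for i using that unfolding k_def by (rule not_less_Least)
  have l': "\<not> Q i" if "i < l" for i using that unfolding l_def by (rule not_less_Least)
  have "m + m' \<le> val (coeff (p * q) i) + real i * r" if "coeff (p * q) i \<noteq> 0" for i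
  proof -
    have "coeff (p * q) i = 0 \<or> m + m' - real i * r \<le> val (coeff (p * q) i)"
      unfolding coeff_mult
    proof (rule val_sum_ge)
      fix t assume t: "t \<in> {..i}"
      show "coeff p t * coeff q (i - t) = 0 \<or> m + m' - real i * r \<le> val (coeff p t * coeff q (i - t))"
      proof (cases "coeff p t * coeff q (i - t) = 0")
        case False
        thus ?thesis using le[of t] le'[of "i - t"] t by (simp add: val_mult of_nat_diff algebra_simps)
      qed simp
    qed
    thus ?thesis using that by simp
  qed
  moreover have "coeff (p * q) (k + l) \<noteq> 0 \<and> val (coeff (p * q) (k + l)) + real (k + l) * r = m + m'"
  proof -
    let ?t = "\<lambda>t. coeff p t * coeff q (k + l - t)"
    have t0: "?t k \<noteq> 0" "val (?t k) = m + m' - real (k + l) * r"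
      using k l by (auto simp: P_def Q_def val_mult algebra_simps)
    have "(\<Sum>t\<in>{..k+l} - {k}. ?t t) = 0 \<or> val (?t k) < val (\<Sum>t\<in>{..k+l} - {k}. ?t t)"
    proof (rule val_sum_gt)
      fix t assume t: "t \<in> {..k+l} - {k}"
      show "?t t = 0 \<or> val (?t k) < val (?t t)"
      proof (cases "?t t = 0")
        case False
        hence nz: "coeff p t \<noteq> 0" "coeff q (k + l - t) \<noteq> 0" by auto
        have "m + m' < (val (coeff p t) + real t * r) + (val (coeff q (k + l - t)) + real (k + l - t) * r)"
        proof (cases "t < k")
          case True
          hence "val (coeff p t) + real t * r \<noteq> m" using k' nz by (auto simp: P_def)
          thus ?thesis using le[OF nz(1)] le'[OF nz(2)] by linarith
        next
          case False
          hence "k + l - t < l" using t by auto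
          hence "val (coeff q (k + l - t)) + real (k + l - t) * r \<noteq> m'" using l' nz by (auto simp: Q_def)
          thus ?thesis using le[OF nz(1)] le'[OF nz(2)] by linarith
        qed
        thus ?thesis using t0 nz t by (simp add: val_mult of_nat_diff algebra_simps)
      qed simp
    qed
    from val_add_eq[OF t0(1) this] show ?thesis
      using t0(2) by (simp add: coeff_mult sum.remove[of "{..k+l}" k])
  qed
  ultimately show ?thesis unfolding gauss_val_def by blast
qed

lemma gauss_val_const: "c \<noteq> 0 \<Longrightarrow> gauss_val r [:c:] (val c)"
  by (auto simp: gauss_val_def coeff_pCons split: nat.splits)

lemma gauss_val_linear:
  assumes "b \<noteq> 0"
  shows "gauss_val r [:a, b:] (if a = 0 then val b + r else min (val a) (val b + r))"
proof -
  have "coeff [:a, b:] k = (if k = 0 then a else if k = 1 then b else 0)" for k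
    by (auto simp: coeff_pCons split: nat.splits)
  thus ?thesis using assms by (auto simp: gauss_val_def min_def intro: exI[of _ 0] exI[of _ 1])
qed

lemma gauss_val_power: "gauss_val r p m \<Longrightarrow> gauss_val r (p ^ k) (real k * m)"
proof (induction k)
  case 0
  show ?case using gauss_val_const[of 1 r] by (simp add: one_pCons)
next
  case (Suc k)
  thus ?case using gauss_val_mult[of r p m "p ^ k" "real k * m"] by (simp add: algebra_simps)
qed

lemma gauss_val_prod:
  "(\<And>i. i \<in> I \<Longrightarrow> gauss_val r (p i) (m i)) \<Longrightarrow> gauss_val r (prod p I) (sum m I)"
proof (induction I rule: infinite_finite_induct)
  case (insert i I)
  thus ?case by (simp add: gauss_val_mult)
qed (use gauss_val_const[of 1 r] in \<open>simp_all add: one_pCons\<close>)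

text \<open>The easy inclusion of the fundamental theorem for \<open>w = val (X)\<close>, where \<open>X\<close> is a zero over \<open>K[t]\<close>
  with a Gauss valuation; this avoids passing to a field extension of \<open>K\<close> whose value group
  contains the coordinates of \<open>w\<close>.\<close>
lemma trop_hyp_if_gauss_val_zero:
  fixes f :: "('n::finite, 'k) mpoly"
  assumes zero: "eval_hom (\<lambda>c. [:c:]) f X = 0" and X: "\<And>i. gauss_val r (X i) (w $ i)"
  shows "w \<in> trop_hyp val f"
proof (cases "f = 0")
  case False
  let ?K = "Poly_Mapping.keys f" and ?c = "Poly_Mapping.lookup f"
  define h where "h a = val (?c a) + exp_vec a \<bullet> w" for a
  define T where "T a = [:?c a:] * (\<Prod>i\<in>UNIV. X i ^ Poly_Mapping.lookup a i)" for a
  have T: "gauss_val r (T a) (h a)" if "a \<in> ?K" for a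
  proof -
    have "gauss_val r (T a) (val (?c a) + (\<Sum>i\<in>UNIV. real (Poly_Mapping.lookup a i) * w $ i))"
      unfolding T_def using that
      by (intro gauss_val_mult gauss_val_const gauss_val_prod gauss_val_power X) (simp add: in_keys_iff)
    thus ?thesis by (simp add: h_def exp_vec_def inner_vec_def)
  qed
  have "?K \<noteq> {}" using False by simp
  define a where "a = arg_min_on h ?K"
  have a: "a \<in> ?K" "\<And>b. b \<in> ?K \<Longrightarrow> h a \<le> h b"
    using arg_min_if_finite[OF finite_keys \<open>?K \<noteq> {}\<close>, of h] unfolding a_def by (auto simp: not_less)
  have init: "init_exps val f w = {b\<in>?K. h b = h a}"
    using a unfolding init_exps_def h_def[symmetric] by (auto intro: antisym)
  have "\<exists>b\<in>?K. b \<noteq> a \<and> h b = h a"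
  proof (rule ccontr)
    assume "\<not> ?thesis"
    hence gt: "h a < h b" if "b \<in> ?K - {a}" for b using a(2)[of b] that by force
    \<comment> \<open>A coefficient of the least term that realizes its Gauss valuation. In every
      other term the coefficient with the same index \<open>k\<close> vanishes or has larger
      valuation, so the \<open>k\<close>-th coefficient of the sum cannot be zero.\<close>
    obtain k where k: "coeff (T a) k \<noteq> 0" "val (coeff (T a) k) + real k * r = h a"
      using T[OF a(1)] by (auto simp: gauss_val_def)
    have "(\<Sum>b\<in>?K - {a}. coeff (T b) k) = 0 \<or> val (coeff (T a) k) < val (\<Sum>b\<in>?K - {a}. coeff (T b) k)"
    proof (rule val_sum_gt)
      fix b assume b: "b \<in> ?K - {a}"
      show "coeff (T b) k = 0 \<or> val (coeff (T a) k) < val (coeff (T b) k)"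
        using T[of b] gt[OF b] b k(2) by (force simp: gauss_val_def)
    qed
    from val_add_eq(1)[OF k(1) this] have "(\<Sum>b\<in>?K. coeff (T b) k) \<noteq> 0"
      using a(1) by (simp add: sum.remove[of ?K a])
    moreover have "(\<Sum>b\<in>?K. T b) = 0" using zero by (simp add: eval_hom_def T_def)
    ultimately show False by (metis coeff_sum coeff_0)
  qed
  then obtain b where b: "b \<in> ?K" "b \<noteq> a" "h b = h a" by blast
  have "card {a, b} \<le> card (init_exps val f w)"
    by (rule card_mono) (use a b init in auto)
  thus ?thesis using b False by (simp add: trop_hyp_def)
qed (simp add: trop_hyp_def)

end

text \<open>By continuity the other monomials stay strictly above \<open>a\<close> and
  \<open>b\<close> near \<open>w\<close>, so only a tie between these two can put a nearby point on
  the hypersurface.\<close>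

lemma trop_hyp_germ:
  fixes f :: "('n::finite, 'k::field) mpoly"
  assumes init: "init_exps val f w = {a, b}" and "a \<noteq> b"
  shows "\<exists>\<epsilon>>0. \<forall>w'\<in>ball w \<epsilon>. w' \<in> trop_hyp val f \<longleftrightarrow> (exp_vec a - exp_vec b) \<bullet> (w' - w) = 0"
proof -
  let ?K = "Poly_Mapping.keys f" and ?c = "Poly_Mapping.lookup f"
  define h where "h c v = val (?c c) + exp_vec c \<bullet> v" for c v
  have ab: "a \<in> ?K" "b \<in> ?K" "h a w = h b w" and f0: "f \<noteq> 0"
    using init unfolding init_exps_def h_def by (auto intro: antisym)
  have gt: "h a w < h c w \<and> h b w < h c w" if c: "c \<in> ?K - {a, b}" for c
  proof (rule ccontr)
    assume "\<not> ?thesis"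
    hence "h c w \<le> h a w" using ab by auto
    moreover have "\<forall>d\<in>?K. h a w \<le> h d w" using init unfolding init_exps_def h_def by auto
    ultimately have "c \<in> init_exps val f w" using c unfolding init_exps_def h_def by force
    thus False using init c by auto
  qed
  have "eventually (\<lambda>v. \<forall>c\<in>?K - {a, b}. h a v < h c v \<and> h b v < h c v) (nhds w)"
  proof (rule eventually_ball_finite, simp, rule ballI)
    fix c assume "c \<in> ?K - {a, b}"
    hence g: "h c w - h a w > 0" "h c w - h b w > 0" using gt by auto
    have "((\<lambda>v. h c v - h d v) \<longlongrightarrow> h c w - h d w) (nhds w)" for d
      unfolding h_def by (intro tendsto_intros filterlim_ident)
    hence "eventually (\<lambda>v. 0 < h c v - h a v) (nhds w)" "eventually (\<lambda>v. 0 < h c v - h b v) (nhds w)"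
      using g order_tendstoD(1) by blast+
    thus "eventually (\<lambda>v. h a v < h c v \<and> h b v < h c v) (nhds w)" by eventually_elim simp
  qed
  then obtain \<epsilon> where \<epsilon>: "\<epsilon> > 0"
      "\<And>v c. dist v w < \<epsilon> \<Longrightarrow> c \<in> ?K - {a, b} \<Longrightarrow> h a v < h c v \<and> h b v < h c v"
    unfolding eventually_nhds_metric by blast
  have "v \<in> trop_hyp val f \<longleftrightarrow> (exp_vec a - exp_vec b) \<bullet> (v - w) = 0" if v: "v \<in> ball w \<epsilon>" for v
  proof -
    have g: "h a v < h c v \<and> h b v < h c v" if "c \<in> ?K - {a, b}" for c
      using \<epsilon>(2)[of v c] v that by (simp add: dist_commute)
    have eq: "(exp_vec a - exp_vec b) \<bullet> (v - w) = 0 \<longleftrightarrow> h a v = h b v"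
      using ab(3) by (simp add: h_def inner_diff_left inner_diff_right) linarith
    have i: "init_exps val f v = {c\<in>?K. \<forall>d\<in>?K. h c v \<le> h d v}"
      by (simp add: init_exps_def h_def)
    have sub: "init_exps val f v \<subseteq> {a, b}" using g ab unfolding i by force
    show ?thesis
    proof (cases "h a v = h b v")
      case True
      have "h a v \<le> h d v" "h b v \<le> h d v" if "d \<in> ?K" for d
        using g[of d] True that by (cases "d \<in> {a, b}"; force)+
      hence "init_exps val f v = {a, b}" using sub ab unfolding i by auto
      thus ?thesis using eq True \<open>a \<noteq> b\<close> f0 by (simp add: trop_hyp_def)
    next
      case False
      have "\<not> {a, b} \<subseteq> init_exps val f v" using False ab unfolding i by force
      hence "init_exps val f v \<subset> {a, b}" using sub by blast
      hence "card (init_exps val f v) < card {a, b}" by (intro psubset_card_mono) auto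
      thus ?thesis using eq False \<open>a \<noteq> b\<close> f0 by (simp add: trop_hyp_def)
    qed
  qed
  thus ?thesis using \<epsilon>(1) by blast
qed

section \<open>The hypersurfaces\<close>

locale caterpillar = valued_field val for val :: "'k::field \<Rightarrow> real" +
  fixes \<pi> :: 'k and e :: "nat \<Rightarrow> 'n::finite" and d :: "nat \<Rightarrow> nat" and n :: nat
  assumes n_eq: "n = CARD('n)" and pi_nz: "\<pi> \<noteq> 0" and val_pi: "val \<pi> > 0"
    and bij_e: "bij_betw e {..<n} UNIV" and n3: "n \<ge> 3"
    and d_pos: "\<And>i. i \<in> {1..n - 1} \<Longrightarrow> d i > 0"
begin

abbreviation I :: "nat set" where "I \<equiv> {1..n - 1}"
abbreviation \<nu> :: real where "\<nu> \<equiv> val \<pi>"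

text \<open>Larger than every \<open>d j\<close>: the walls of one hypersurface spread over less
  than \<open>2 * n * B\<close> units of \<open>\<nu>\<close>, so different hypersurfaces have their
  walls in disjoint blocks.\<close>

definition B :: nat where "B = Suc (\<Sum>i\<in>I. d i)"
text \<open>Divisible by every exponent \<open>a\<close> with \<open>1 \<le> a \<le> d j\<close>.
  Where \<open>x\<^sub>0 ^ a\<close> ties with two powers of \<open>x\<^sub>j\<close>, the abscissa
  is found by dividing by \<open>a\<close>, and this divisibility preserves its residue modulo
  \<open>n\<close>.\<close>

definition M :: "nat \<Rightarrow> nat" where "M j = fact (d j)"
text \<open>Chosen so that \<open>n * K j\<close> bounds \<open>a * (2 * n * B + 1) * j\<close> for
  all \<open>a \<le> d j\<close>. The powers of \<open>x\<^sub>j\<close> are thereby lowered enough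
  for the horizontal sheets to run over the whole half-line
  \<open>w\<^sub>0 \<ge> 0\<close>.\<close>

definition K :: "nat \<Rightarrow> nat" where "K j = (2 * n * B + 1) * d j"

definition E :: "nat \<Rightarrow> ('n \<Rightarrow>\<^sub>0 nat) set" where
  "E j = Poly_Mapping.single (e 0) ` {..d j} \<union> Poly_Mapping.single (e j) ` {1..d j}"

text \<open>Quadratic, hence strictly convex, in each exponent: any two consecutive powers of one
  variable tie on a wall of their own. The constant monomial counts as a power of
  \<open>x\<^sub>0\<close>, hence the test \<open>b > 0\<close>.\<close>

definition ht :: "nat \<Rightarrow> ('n \<Rightarrow>\<^sub>0 nat) \<Rightarrow> int" where
  "ht j \<alpha> = (let a = int (Poly_Mapping.lookup \<alpha> (e 0)); b = int (Poly_Mapping.lookup \<alpha> (e j)) in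
     int n * a\<^sup>2 + a * (int n - (2 * int n * int B + 1) * int j)
       + (if b > 0 then int n * int (M j) * (b\<^sup>2 - int (K j)) else 0))"

definition g :: "nat \<Rightarrow> ('n, 'k) mpoly" where
  "g j = (\<Sum>\<alpha>\<in>E j. Poly_Mapping.single \<alpha> (\<pi> powi ht j \<alpha>))"

text \<open>Tropical values of the monomials \<open>x\<^sub>0\<^sup>a\<close> and \<open>x\<^sub>j\<^sup>b\<close> of \<open>g j\<close> where \<open>w\<^sub>0 = s\<close> and \<open>w\<^sub>j = r\<close>.\<close>
definition tp :: "nat \<Rightarrow> real \<Rightarrow> nat \<Rightarrow> real" where
  "tp j s a = \<nu> * (n * real a ^ 2 + a * (n - (2 * n * real B + 1) * j)) + a * s"
definition tq :: "nat \<Rightarrow> real \<Rightarrow> nat \<Rightarrow> real" where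
  "tq j r b = \<nu> * (n * real (M j) * (real b ^ 2 - K j)) + b * r"

text \<open>The abscissa where \<open>x\<^sub>0 ^ k\<close> and \<open>x\<^sub>0 ^ (k - 1)\<close>
  tie, that is, the position of the \<open>k\<close>-th vertical ray.\<close>

definition \<sigma> :: "nat \<Rightarrow> nat \<Rightarrow> real" where
  "\<sigma> j k = \<nu> * ((2 * n * real B + 1) * j - 2 * n * real k)"

text \<open>Every ramification of \<open>trop_hyp val (g j)\<close> over the \<open>w\<^sub>0\<close>-axis lies at such an \<open>s\<close>;
  since the residues modulo \<open>n\<close> differ, different \<open>j\<close> never ramify together.\<close>
definition special :: "nat \<Rightarrow> real \<Rightarrow> bool" where
  "special j s \<longleftrightarrow> (\<exists>z::int. s = \<nu> * (real j + real n * z))"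

lemma e_inj: "i < n \<Longrightarrow> j < n \<Longrightarrow> e i = e j \<longleftrightarrow> i = j"
  using bij_e by (auto simp: bij_betw_def inj_on_eq_iff)

lemma e_surj: obtains i where "i < n" "k = e i"
  using bij_e by (metis UNIV_I bij_betw_imp_surj_on imageE lessThan_iff)

lemma I_lt: "j \<in> I \<Longrightarrow> j < n"
  using n3 by auto

lemma e0_ne: "j \<in> I \<Longrightarrow> e 0 \<noteq> e j" "j \<in> I \<Longrightarrow> e j \<noteq> e 0"
  using e_inj[of 0 j] I_lt[of j] by auto

lemma e_ne: "i \<in> I \<Longrightarrow> j \<in> I \<Longrightarrow> i \<noteq> j \<Longrightarrow> e i \<noteq> e j"
  using e_inj[of i j] I_lt[of i] I_lt[of j] by auto

lemma finite_E: "finite (E j)"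
  by (simp add: E_def)

lemma lookup_g: "Poly_Mapping.lookup (g j) \<alpha> = (if \<alpha> \<in> E j then \<pi> powi ht j \<alpha> else 0)"
proof -
  have "Poly_Mapping.lookup (g j) \<alpha> = (\<Sum>\<beta>\<in>E j. if \<beta> = \<alpha> then \<pi> powi ht j \<beta> else 0)"
    by (simp add: g_def lookup_sum lookup_single when_def)
  thus ?thesis using finite_E by simp
qed

lemma keys_g: "Poly_Mapping.keys (g j) = E j"
  using pi_nz by (auto simp: in_keys_iff lookup_g split: if_splits)

lemma E_cases:
  assumes "\<alpha> \<in> E j"
  obtains (P) a where "a \<le> d j" "\<alpha> = Poly_Mapping.single (e 0) a"
  | (Q) b where "1 \<le> b" "b \<le> d j" "\<alpha> = Poly_Mapping.single (e j) b"
  using assms by (auto simp: E_def)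

lemma zero_in_E: "0 \<in> E j"
  by (auto simp: E_def intro: image_eqI[of _ _ 0])

lemma g_nz: "g j \<noteq> 0"
  using keys_g[of j] zero_in_E[of j] by auto

lemma exp_vec_inner:
  assumes "j \<in> I" "\<alpha> \<in> E j"
  shows "exp_vec \<alpha> \<bullet> u = Poly_Mapping.lookup \<alpha> (e 0) * u $ e 0 + Poly_Mapping.lookup \<alpha> (e j) * u $ e j"
proof -
  have z: "Poly_Mapping.lookup \<alpha> k = 0" if "k \<noteq> e 0" "k \<noteq> e j" for k
    using assms(2) that by (auto simp: E_def lookup_single when_def)
  have "exp_vec \<alpha> \<bullet> u = (\<Sum>k\<in>UNIV. Poly_Mapping.lookup \<alpha> k * u $ k)"
    by (simp add: exp_vec_def inner_vec_def)
  also have "\<dots> = (\<Sum>k\<in>{e 0, e j}. Poly_Mapping.lookup \<alpha> k * u $ k)"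
    by (rule sum.mono_neutral_right) (use z in auto)
  finally show ?thesis using e0_ne[OF assms(1)] by simp
qed

definition tv :: "nat \<Rightarrow> real^'n \<Rightarrow> ('n \<Rightarrow>\<^sub>0 nat) \<Rightarrow> real" where
  "tv j w \<alpha> = val (Poly_Mapping.lookup (g j) \<alpha>) + exp_vec \<alpha> \<bullet> w"

lemma init_g: "init_exps val (g j) w = {\<alpha>\<in>E j. \<forall>\<beta>\<in>E j. tv j w \<alpha> \<le> tv j w \<beta>}"
  by (simp add: init_exps_def keys_g tv_def)

lemma tv_P:
  assumes "j \<in> I" "a \<le> d j"
  shows "tv j w (Poly_Mapping.single (e 0) a) = tp j (w $ e 0) a"
  using assms e0_ne[OF assms(1)] pi_nz
  by (auto simp: tv_def lookup_g exp_vec_inner E_def val_power_int ht_def tp_def lookup_single when_def Let_def)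

lemma tv_Q:
  assumes "j \<in> I" "1 \<le> b" "b \<le> d j"
  shows "tv j w (Poly_Mapping.single (e j) b) = tq j (w $ e j) b"
  using assms e0_ne[OF assms(1)] pi_nz
  by (auto simp: tv_def lookup_g exp_vec_inner E_def val_power_int ht_def tq_def lookup_single when_def Let_def)

lemma E_tv_cases [consumes 2]:
  assumes "j \<in> I" "\<alpha> \<in> E j"
  obtains (P) a where "a \<le> d j" "\<alpha> = Poly_Mapping.single (e 0) a" "tv j w \<alpha> = tp j (w $ e 0) a"
  | (Q) b where "1 \<le> b" "b \<le> d j" "\<alpha> = Poly_Mapping.single (e j) b" "tv j w \<alpha> = tq j (w $ e j) b"
  using assms(2) by (cases rule: E_cases) (simp_all add: tv_P[OF assms(1)] tv_Q[OF assms(1)] that)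

section \<open>Ramification over the first axis\<close>

lemma tp_diff:
  "tp j s a - tp j s a' = (real a - a') * (\<nu> * (n * (real a + a' + 1) - (2 * n * real B + 1) * j) + s)"
  by (simp add: tp_def algebra_simps power2_eq_square)

lemma tq_diff: "tq j r b - tq j r b' = (real b - b') * (\<nu> * (n * real (M j) * (real b + b')) + r)"
  by (simp add: tq_def algebra_simps power2_eq_square)

lemma special_tp:
  assumes "a \<noteq> a'" "tp j s a = tp j s a'"
  shows "special j s"
proof -
  have "\<nu> * (n * (real a + a' + 1) - (2 * n * real B + 1) * j) + s = 0"
    using tp_diff[of j s a a'] assms by simp
  hence "s = \<nu> * (real j + real n * of_int (2 * int B * int j - int a - int a' - 1))"
    by (simp add: algebra_simps)
  thus ?thesis unfolding special_def by blast
qed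

lemma tq_root:
  assumes "b \<noteq> b'" "tq j r b = tq j r b'"
  shows "r = - \<nu> * (n * real (M j) * (real b + b'))"
  using tq_diff[of j r b b'] assms by simp

text \<open>The tie of the two powers of \<open>x\<^sub>j\<close> fixes \<open>r\<close> and makes
  their common value \<open>- \<nu> * n * M j * (K j + b * b')\<close>. Equating it with the value
  of \<open>x\<^sub>0 ^ a\<close> and dividing by \<open>a\<close>, which divides
  \<open>M j\<close>, leaves an integer congruent to \<open>j\<close> modulo
  \<open>n\<close>.\<close>

lemma special_tp_tq:
  assumes "b \<noteq> b'" "tq j r b = tq j r b'" "a \<le> d j" "tp j s a = tq j r b" "1 \<le> b" "1 \<le> b'"
  shows "special j s"
proof -
  have M: "M j > 0" by (simp add: M_def)
  have eq: "tp j s a = - \<nu> * (n * real (M j) * (K j + real b * b'))"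
    unfolding assms(4) tq_def tq_root[OF assms(1,2)] by (simp add: algebra_simps power2_eq_square)
  show ?thesis
  proof (cases "a = 0")
    \<comment> \<open>The constant monomial has value 0, whereas the common value is
      negative.\<close>
    case True
    have "0 < \<nu> * (n * real (M j) * (K j + real b * b'))"
      using assms M n3 val_pi by (intro mult_pos_pos add_nonneg_pos) auto
    moreover have "tp j s a = 0" using True by (simp add: tp_def)
    ultimately show ?thesis using eq by linarith
  next
    case False
    hence "a dvd M j" unfolding M_def using assms(3) by (simp add: dvd_fact)
    then obtain m where m: "M j = a * m" by blast
    have "a * (\<nu> * (n * real a + (n - (2 * n * real B + 1) * j)) + s) = a * (- \<nu> * (n * real m * (K j + real b * b')))"
      using eq by (simp add: tp_def m algebra_simps power2_eq_square)
    hence "\<nu> * (n * real a + (n - (2 * n * real B + 1) * j)) + s = - \<nu> * (n * real m * (K j + real b * b'))"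
      using False by (subst (asm) mult_cancel_left) simp
    hence "s = \<nu> * (real j + real n * of_int (2 * int B * int j - int a - 1 - int m * (int (K j) + int b * int b')))"
      by (simp add: algebra_simps)
    thus ?thesis unfolding special_def by blast
  qed
qed

lemma special_unique:
  assumes "special i s" "special j s" "i < n" "j < n"
  shows "i = j"
proof -
  obtain y z :: int where "s = \<nu> * (real i + real n * y)" "s = \<nu> * (real j + real n * z)"
    using assms(1,2) unfolding special_def by blast
  hence "real i + real n * y = real j + real n * z" using val_pi by simp
  hence "real_of_int (int i + int n * y) = real_of_int (int j + int n * z)" by simp
  hence "(int i + int n * y) mod int n = (int j + int n * z) mod int n" by (simp only: of_int_eq_iff)
  thus ?thesis using assms(3,4) by simp
qed

lemma special_sigma: "special j (\<sigma> j k)"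
proof -
  have "\<sigma> j k = \<nu> * (real j + real n * of_int (2 * int B * int j - 2 * int k))"
    by (simp add: \<sigma>_def algebra_simps)
  thus ?thesis unfolding special_def by blast
qed

text \<open>Among the three there are two powers of \<open>x\<^sub>0\<close>, or two powers of
  \<open>x\<^sub>j\<close> together with one of \<open>x\<^sub>0\<close>, or three powers of
  \<open>x\<^sub>j\<close>. The first two situations are special; the third is impossible, since a
  tie at height \<open>r\<close> determines the sum of the two exponents.\<close>

lemma special_if_triple:
  assumes j: "j \<in> I" and abc: "\<alpha> \<in> E j" "\<beta> \<in> E j" "\<gamma> \<in> E j" and ne: "\<alpha> \<noteq> \<beta>" "\<alpha> \<noteq> \<gamma>" "\<beta> \<noteq> \<gamma>"
    and tv: "tv j w \<alpha> = tv j w \<beta>" "tv j w \<alpha> = tv j w \<gamma>"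
  shows "special j (w $ e 0)"
proof (rule ccontr)
  assume ns: "\<not> special j (w $ e 0)"
  have pp: False if "a \<le> d j" "a' \<le> d j" "a \<noteq> a'" "tp j (w $ e 0) a = tp j (w $ e 0) a'" for a a'
    using special_tp that ns by blast
  have pqq: False if "tq j (w $ e j) b = tq j (w $ e j) b'" "b \<noteq> b'" "1 \<le> b" "1 \<le> b'" "a \<le> d j"
      "tp j (w $ e 0) a = tq j (w $ e j) b" for a b b'
    using special_tp_tq that ns by blast
  have qqq: False if "tq j (w $ e j) b = tq j (w $ e j) b'" "tq j (w $ e j) b = tq j (w $ e j) b''" 
    "b \<noteq> b'" "b \<noteq> b''" "b' \<noteq> b''" for b b' b''
  proof -
    have "M j > 0" by (simp add: M_def)
    thus False using tq_root[OF that(3,1)] tq_root[OF that(4,2)] that(5) val_pi n3 by auto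
  qed
  from j abc(1) show False
  proof (cases rule: E_tv_cases[where w = w])
    case P1: (P a)
    from j abc(2) show False
    proof (cases rule: E_tv_cases[where w = w])
      case (P a')
      thus False using P1 pp[of a a'] tv ne by metis
    next
      case Q2: (Q b)
      from j abc(3) show False
      proof (cases rule: E_tv_cases[where w = w])
        case (P a')
        thus False using P1 pp[of a a'] tv ne by metis
      next
        case (Q b')
        thus False using P1 Q2 pqq[of b b' a] tv ne by metis
      qed
    qed
  next
    case Q1: (Q b)
    from j abc(2) show False
    proof (cases rule: E_tv_cases[where w = w])
      case P2: (P a)
      from j abc(3) show False
      proof (cases rule: E_tv_cases[where w = w])
        case (P a')
        thus False using P2 pp[of a a'] tv ne by metis
      next
        case (Q b')
        thus False using P2 Q1 pqq[of b b' a] tv ne by metis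
      qed
    next
      case Q2: (Q b')
      from j abc(3) show False
      proof (cases rule: E_tv_cases[where w = w])
        case (P a')
        thus False using Q2 Q1 pqq[of b b' a'] tv ne by metis
      next
        case (Q b'')
        thus False using Q1 Q2 qqq[of b b' b''] tv ne by metis
      qed
    qed
  qed
qed

text \<open>Equal exponents of \<open>x\<^sub>j\<close> would mean two different powers of
  \<open>x\<^sub>0\<close>, whose tie is special. The dual edge thus moves in the coordinate that
  belongs to \<open>g j\<close> alone.\<close>

lemma lookup_ne_if_not_special:
  assumes j: "j \<in> I" and ns: "\<not> special j (w $ e 0)"
    and ab: "\<alpha> \<in> init_exps val (g j) w" "\<beta> \<in> init_exps val (g j) w" "\<alpha> \<noteq> \<beta>"
  shows "Poly_Mapping.lookup \<alpha> (e j) \<noteq> Poly_Mapping.lookup \<beta> (e j)"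
proof -
  have in_E: "\<alpha> \<in> E j" "\<beta> \<in> E j" and tv: "tv j w \<alpha> = tv j w \<beta>"
    using ab unfolding init_g by (auto intro: antisym)
  note t = tv_P[OF j] tv_Q[OF j] lookup_single when_def e0_ne[OF j]
  from in_E(1) show ?thesis
  proof (cases rule: E_cases)
    case P1: (P a)
    from in_E(2) show ?thesis
    proof (cases rule: E_cases)
      case (P a')
      thus ?thesis using P1 special_tp[of a a' j "w $ e 0"] tv ab(3) ns by (auto simp: t)
    qed (use P1 in \<open>auto simp: t\<close>)
  next
    case (Q b)
    from in_E(2) show ?thesis
      by (cases rule: E_cases) (use Q ab(3) in \<open>auto simp: t\<close>)
  qed
qed

lemma init_if_not_special:
  assumes j: "j \<in> I" and ns: "\<not> special j (w $ e 0)" and w: "w \<in> trop_hyp val (g j)"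
  obtains \<alpha> \<beta> where "init_exps val (g j) w = {\<alpha>, \<beta>}" "Poly_Mapping.lookup \<alpha> (e j) \<noteq> Poly_Mapping.lookup \<beta> (e j)"
    "\<alpha> \<in> E j" "\<beta> \<in> E j"
proof -
  let ?i = "init_exps val (g j) w"
  have "2 \<le> card ?i" using w g_nz by (simp add: trop_hyp_def)
  then obtain S where "S \<subseteq> ?i" "card S = 2" by (meson obtain_subset_with_card_n)
  then obtain \<alpha> \<beta> where ab: "\<alpha> \<in> ?i" "\<beta> \<in> ?i" "\<alpha> \<noteq> \<beta>" by (auto simp: card_2_iff)
  have "\<gamma> \<in> {\<alpha>, \<beta>}" if c: "\<gamma> \<in> ?i" for \<gamma>
  proof (rule ccontr)
    assume "\<gamma> \<notin> {\<alpha>, \<beta>}"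
    moreover have "tv j w \<alpha> = tv j w \<beta>" "tv j w \<alpha> = tv j w \<gamma>" "\<alpha> \<in> E j" "\<beta> \<in> E j" "\<gamma> \<in> E j"
      using ab c unfolding init_g by (auto intro: antisym)
    ultimately show False using special_if_triple[OF j, of \<alpha> \<beta> \<gamma> w] ab(3) ns by auto
  qed
  hence "?i = {\<alpha>, \<beta>}" using ab by blast
  moreover have "\<alpha> \<in> E j" "\<beta> \<in> E j" using ab unfolding init_g by auto
  ultimately show thesis using that lookup_ne_if_not_special[OF j ns ab] by blast
qed

section \<open>Walls and sheets of one hypersurface\<close>

lemma M_pos: "M j > 0"
  by (simp add: M_def)

lemma mem_trop_g_if_min_twice:
  assumes "\<alpha> \<in> E j" "\<beta> \<in> E j" "\<alpha> \<noteq> \<beta>" "tv j w \<alpha> = tv j w \<beta>"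
    and "\<And>\<gamma>. \<gamma> \<in> E j \<Longrightarrow> tv j w \<alpha> \<le> tv j w \<gamma>"
  shows "w \<in> trop_hyp val (g j)"
proof -
  have "{\<alpha>, \<beta>} \<subseteq> init_exps val (g j) w" using assms unfolding init_g by auto
  moreover have "finite (init_exps val (g j) w)" using finite_E unfolding init_g by auto
  ultimately have "card {\<alpha>, \<beta>} \<le> card (init_exps val (g j) w)" by (intro card_mono)
  thus ?thesis using assms(3) g_nz by (simp add: trop_hyp_def)
qed

lemma wall:
  assumes i: "i \<in> I" and k: "k \<in> {1..d i}"
  shows "\<exists>R\<ge>0. \<forall>w. w $ e 0 = \<sigma> i k \<longrightarrow> w $ e i > R \<longrightarrow>
    init_exps val (g i) w = {Poly_Mapping.single (e 0) k, Poly_Mapping.single (e 0) (k - 1)}"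
proof (intro exI conjI allI impI)
  \<comment> \<open>Above this height every power of \<open>x\<^sub>j\<close> exceeds the value of
    \<open>x\<^sub>0 ^ k\<close>: the first summand dominates that value and the second compensates
    the lowering by \<open>K i\<close> (here \<open>j\<close> is \<open>i\<close>).\<close>
  let ?R = "\<bar>tp i (\<sigma> i k) k\<bar> + \<nu> * (n * real (M i) * K i)"
  show R0: "0 \<le> ?R" using val_pi by simp
  fix w assume w: "w $ e 0 = \<sigma> i k" "w $ e i > ?R"
  \<comment> \<open>The product of \<open>a - k\<close> and \<open>a - k + 1\<close> has no integer
    strictly between its roots \<open>k - 1\<close> and \<open>k\<close>, so it is nonnegative on
    integers and vanishes only at these two.\<close>
  have tp: "tp i (\<sigma> i k) a - tp i (\<sigma> i k) k = \<nu> * (n * ((real a - k) * (real a - k + 1)))" for a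
    by (simp add: tp_diff \<sigma>_def algebra_simps)
  have nn: "\<nu> * real n > 0" using val_pi n3 by simp
  have tp_le: "tp i (\<sigma> i k) k \<le> tp i (\<sigma> i k) a" for a
  proof -
    have "(real a - k) * (real a - k + 1) \<ge> 0"
    proof (cases "a \<ge> k")
      case False
      hence "a + 1 \<le> k" by simp
      hence "real a + 1 \<le> k" by linarith
      thus ?thesis by (intro mult_nonpos_nonpos) auto
    qed simp
    hence "0 \<le> (\<nu> * n) * ((real a - k) * (real a - k + 1))" by (rule mult_nonneg_nonneg[OF less_imp_le[OF nn]])
    thus ?thesis using tp[of a] by (simp add: mult_ac)
  qed
  have tp_eq: "tp i (\<sigma> i k) a = tp i (\<sigma> i k) k \<longleftrightarrow> a = k \<or> a = k - 1" for a
  proof -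
    have "tp i (\<sigma> i k) a = tp i (\<sigma> i k) k \<longleftrightarrow> \<nu> * (n * ((real a - k) * (real a - k + 1))) = 0"
      using tp[of a] by auto
    also have "\<dots> \<longleftrightarrow> real a = k \<or> real a + 1 = k" using nn by auto
    also have "\<dots> \<longleftrightarrow> a = k \<or> a = k - 1" using k by auto
    finally show ?thesis .
  qed
  have tq: "tp i (\<sigma> i k) k < tq i (w $ e i) b" if "b \<ge> 1" for b
  proof -
    have "real b \<ge> 1" using that by simp
    hence "?R < real b * w $ e i" using w(2) R0 mult_right_mono[of 1 "real b" "w $ e i"] by linarith
    moreover have "0 \<le> \<nu> * (n * real (M i) * real b ^ 2)" using val_pi by simp
    moreover have "tq i (w $ e i) b = \<nu> * (n * real (M i) * real b ^ 2) - \<nu> * (n * real (M i) * K i) + b * w $ e i"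
      by (simp add: tq_def algebra_simps)
    ultimately show ?thesis by linarith
  qed
  have tv_k: "tv i w (Poly_Mapping.single (e 0) k) = tp i (\<sigma> i k) k" using i k w(1) by (simp add: tv_P)
  have k': "k - 1 \<le> d i" using k by auto
  have tv_k': "tv i w (Poly_Mapping.single (e 0) (k - 1)) = tp i (\<sigma> i k) k"
    using i k' w(1) tp_eq[of "k - 1"] by (simp add: tv_P)
  have kE: "Poly_Mapping.single (e 0) k \<in> E i" "Poly_Mapping.single (e 0) (k - 1) \<in> E i"
    using k by (auto simp: E_def)
  have le: "tp i (\<sigma> i k) k \<le> tv i w \<gamma>" "tp i (\<sigma> i k) k = tv i w \<gamma> \<Longrightarrow>
      \<gamma> \<in> {Poly_Mapping.single (e 0) k, Poly_Mapping.single (e 0) (k - 1)}" if "\<gamma> \<in> E i" for \<gamma>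
    using i that
  proof (atomize(full), cases rule: E_tv_cases[where w = w])
    case (P a)
    show "tp i (\<sigma> i k) k \<le> tv i w \<gamma> \<and> (tp i (\<sigma> i k) k = tv i w \<gamma> \<longrightarrow>
      \<gamma> \<in> {Poly_Mapping.single (e 0) k, Poly_Mapping.single (e 0) (k - 1)})"
      using P w(1) tp_le[of a] tp_eq[of a] by auto
  next
    case (Q b)
    show "tp i (\<sigma> i k) k \<le> tv i w \<gamma> \<and> (tp i (\<sigma> i k) k = tv i w \<gamma> \<longrightarrow>
      \<gamma> \<in> {Poly_Mapping.single (e 0) k, Poly_Mapping.single (e 0) (k - 1)})"
      using Q tq[of b] by auto
  qed
  show "init_exps val (g i) w = {Poly_Mapping.single (e 0) k, Poly_Mapping.single (e 0) (k - 1)}"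
  proof (intro equalityI subsetI)
    fix \<gamma> assume "\<gamma> \<in> init_exps val (g i) w"
    hence "\<gamma> \<in> E i" "tv i w \<gamma> \<le> tv i w (Poly_Mapping.single (e 0) k)" using kE unfolding init_g by auto
    thus "\<gamma> \<in> {Poly_Mapping.single (e 0) k, Poly_Mapping.single (e 0) (k - 1)}"
      using le[of \<gamma>] tv_k by linarith
  next
    fix \<gamma> assume "\<gamma> \<in> {Poly_Mapping.single (e 0) k, Poly_Mapping.single (e 0) (k - 1)}"
    thus "\<gamma> \<in> init_exps val (g i) w" using kE le(1) tv_k tv_k' unfolding init_g by auto
  qed
qed

lemma tp_lower:
  assumes "j \<in> I" "s \<ge> 0" "a \<le> d j"
  shows "- \<nu> * (n * real (K j)) \<le> tp j s a"
proof -
  have "real a * ((2 * n * real B + 1) * j) \<le> real (d j) * ((2 * n * real B + 1) * n)"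
    using assms(3) I_lt[OF assms(1)] by (intro mult_mono) auto
  hence "- (n * real (K j)) \<le> - (real a * ((2 * n * real B + 1) * j))" by (simp add: K_def algebra_simps)
  also have "\<dots> \<le> n * real a ^ 2 + a * (n - (2 * n * real B + 1) * j)" by (simp add: algebra_simps)
  finally have "\<nu> * (- (n * real (K j))) \<le> \<nu> * (n * real a ^ 2 + a * (n - (2 * n * real B + 1) * j))"
    using val_pi by (intro mult_left_mono) auto
  moreover have "0 \<le> a * s" using assms(2) by simp
  ultimately show ?thesis unfolding tp_def by simp
qed

text \<open>On the highest sheet the first power of \<open>x\<^sub>j\<close> ties with the least
  power of \<open>x\<^sub>0\<close>. It would tie with a power \<open>b > 1\<close> only at height
  \<open>- \<nu> * n * M j * (b + 1)\<close>, below the bound of the second claim, so higher powers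
  do not interfere.\<close>

lemma top_sheet:
  assumes j: "j \<in> I" and w: "tq j (w $ e j) 1 = tp j (w $ e 0) a" "a \<le> d j" "w $ e 0 \<ge> 0"
    and min: "\<And>a'. a' \<le> d j \<Longrightarrow> tp j (w $ e 0) a \<le> tp j (w $ e 0) a'"
  shows "w \<in> trop_hyp val (g j)" "w $ e j \<ge> - \<nu> * (n * real (M j))"
proof -
  have "real (M j) \<ge> 1" using M_pos[of j] by linarith
  hence "\<nu> * (n * real (K j)) * 1 \<le> \<nu> * (n * real (K j)) * real (M j)" using val_pi by (intro mult_left_mono) auto
  moreover have "tq j (w $ e j) 1 \<ge> - \<nu> * (n * real (K j))" using tp_lower[OF j w(3,2)] w(1) by simp
  ultimately show r: "w $ e j \<ge> - \<nu> * (n * real (M j))"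
    by (simp add: tq_def algebra_simps)
  have tq: "tq j (w $ e j) 1 \<le> tq j (w $ e j) b" if "b \<ge> 1" for b
  proof -
    have "\<nu> * (n * real (M j)) * 1 \<le> \<nu> * (n * real (M j)) * (real b + 1)"
      using val_pi by (intro mult_left_mono) auto
    hence "0 \<le> (real b - 1) * (\<nu> * (n * real (M j) * (real b + 1)) + w $ e j)"
      using that r by (intro mult_nonneg_nonneg) (auto simp: algebra_simps)
    thus ?thesis using tq_diff[of j "w $ e j" b 1] by simp
  qed
  have dj: "1 \<le> d j" using d_pos[OF j] by simp
  show "w \<in> trop_hyp val (g j)"
  proof (rule mem_trop_g_if_min_twice[of "Poly_Mapping.single (e 0) a" _ "Poly_Mapping.single (e j) 1"])
    show "Poly_Mapping.single (e 0) a \<in> E j" "Poly_Mapping.single (e j) 1 \<in> E j"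
      using w(2) dj by (auto simp: E_def)
    have "Poly_Mapping.lookup (Poly_Mapping.single (e 0) a) (e j) \<noteq> Poly_Mapping.lookup (Poly_Mapping.single (e j) 1) (e j)"
      using e0_ne[OF j] by (simp add: lookup_single when_def)
    thus "Poly_Mapping.single (e 0) a \<noteq> Poly_Mapping.single (e j) 1" by metis
    show "tv j w (Poly_Mapping.single (e 0) a) = tv j w (Poly_Mapping.single (e j) 1)"
      using w dj j by (simp add: tv_P tv_Q)
    fix \<gamma> assume g: "\<gamma> \<in> E j"
    have P': "tv j w (Poly_Mapping.single (e 0) a) = tp j (w $ e 0) a" using j w by (simp add: tv_P)
    from j g show "tv j w (Poly_Mapping.single (e 0) a) \<le> tv j w \<gamma>"
    proof (cases rule: E_tv_cases[where w = w])
      case (P a') thus ?thesis using min[of a'] P' by simp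
    next
      case (Q b) thus ?thesis using tq[of b] w(1) P' by simp
    qed
  qed
qed

text \<open>The height at which two consecutive powers of \<open>x\<^sub>j\<close> tie does not
  involve \<open>w\<^sub>0\<close>. Their common value is at most \<open>- \<nu> * n * K j\<close>,
  which by \<open>tp_lower\<close> lies below all powers of \<open>x\<^sub>0\<close> while
  \<open>w\<^sub>0 \<ge> 0\<close>.\<close>

lemma horizontal_sheet:
  assumes j: "j \<in> I" and k: "k \<in> {1..<d j}" and w: "w $ e j = - \<nu> * (n * real (M j) * (2 * real k + 1))" "w $ e 0 \<ge> 0"
  shows "w \<in> trop_hyp val (g j)"
proof -
  let ?r = "w $ e j"
  have tq: "tq j ?r b - tq j ?r k = \<nu> * (n * real (M j)) * ((real b - k) * (real b - k - 1))" for b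
    by (simp add: tq_diff w algebra_simps)
  have nn: "\<nu> * (n * real (M j)) > 0" using val_pi n3 M_pos by simp
  have tq_le: "tq j ?r k \<le> tq j ?r b" for b
  proof -
    have "(real b - k) * (real b - k - 1) \<ge> 0"
    proof (cases "b > k")
      case True
      hence "real b \<ge> real k + 1" by linarith
      thus ?thesis by (intro mult_nonneg_nonneg) auto
    next
      case False
      thus ?thesis by (intro mult_nonpos_nonpos) auto
    qed
    hence "0 \<le> \<nu> * (n * real (M j)) * ((real b - k) * (real b - k - 1))" by (rule mult_nonneg_nonneg[OF less_imp_le[OF nn]])
    thus ?thesis using tq[of b] by simp
  qed
  have tp_le: "tq j ?r k \<le> tp j (w $ e 0) a" if "a \<le> d j" for a
  proof -
    have "tq j ?r k = - (\<nu> * (n * real (M j))) * (K j + real k ^ 2 + real k)"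
      by (simp add: tq_def w algebra_simps power2_eq_square)
    also have "\<dots> \<le> - (\<nu> * (n * real (M j))) * K j" using nn by (intro mult_left_mono_neg) auto
    also have "\<dots> \<le> - \<nu> * (n * real (K j))"
    proof -
      have "real (M j) \<ge> 1" using M_pos[of j] by linarith
      hence "\<nu> * (n * real (K j)) * 1 \<le> \<nu> * (n * real (K j)) * real (M j)" using val_pi by (intro mult_left_mono) auto
      thus ?thesis by (simp add: mult_ac)
    qed
    finally show ?thesis using tp_lower[OF j w(2) that] by simp
  qed
  show ?thesis
  proof (rule mem_trop_g_if_min_twice[of "Poly_Mapping.single (e j) k" _ "Poly_Mapping.single (e j) (k + 1)"])
    show "Poly_Mapping.single (e j) k \<in> E j" "Poly_Mapping.single (e j) (k + 1) \<in> E j"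
      using k by (auto simp: E_def)
    show "Poly_Mapping.single (e j) k \<noteq> Poly_Mapping.single (e j) (k + 1)"
      by (metis lookup_single_eq add_cancel_right_right zero_neq_one)
    show "tv j w (Poly_Mapping.single (e j) k) = tv j w (Poly_Mapping.single (e j) (k + 1))"
      using j k tq[of "k + 1"] by (simp add: tv_Q)
    fix \<gamma> assume g: "\<gamma> \<in> E j"
    have Q': "tv j w (Poly_Mapping.single (e j) k) = tq j ?r k" using j k by (simp add: tv_Q)
    from j g show "tv j w (Poly_Mapping.single (e j) k) \<le> tv j w \<gamma>"
    proof (cases rule: E_tv_cases[where w = w])
      case (P a) thus ?thesis using tp_le[of a] Q' by simp
    next
      case (Q b) thus ?thesis using tq_le[of b] Q' by simp
    qed
  qed
qed

lemma sheets:
  assumes j: "j \<in> I" and s: "s \<ge> 0"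
  shows "\<exists>\<tau>. inj_on \<tau> {1..d j} \<and>
    (\<forall>k\<in>{1..d j}. \<forall>w. w $ e 0 = s \<longrightarrow> w $ e j = \<tau> k \<longrightarrow> w \<in> trop_hyp val (g j))"
proof -
  define a where "a = arg_min_on (tp j s) {..d j}"
  have a: "a \<le> d j" "\<And>a'. a' \<le> d j \<Longrightarrow> tp j s a \<le> tp j s a'"
    using arg_min_if_finite[of "{..d j}" "tp j s"] unfolding a_def by (auto simp: not_less)
  \<comment> \<open>The solution of \<open>tq j t 1 = tp j s a\<close>.\<close>
  define t where "t = tp j s a - \<nu> * (n * real (M j) * (1 - real (K j)))"
  \<comment> \<open>There are \<open>d j - 1\<close> horizontal sheets, one for each pair of
    consecutive powers; the remaining index \<open>d j\<close> denotes the top sheet, which lies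
    above all of them.\<close>
  define \<tau> where "\<tau> k = (if k = d j then t else - \<nu> * (n * real (M j) * (2 * real k + 1)))" for k
  have nn: "\<nu> * (n * real (M j)) > 0" using val_pi n3 M_pos by simp
  have top: "w \<in> trop_hyp val (g j)" "t \<ge> - \<nu> * (n * real (M j))" if "w $ e 0 = s" "w $ e j = t" for w
    using top_sheet[OF j, of w a] that a s by (simp_all add: t_def tq_def)
  \<comment> \<open>A statement about the number \<open>t\<close> only; it is read off at some point
    having these two coordinates.\<close>
  have t: "t \<ge> - \<nu> * (n * real (M j))"
    by (rule top(2)[of "\<chi> k. if k = e 0 then s else t"]) (simp_all add: e0_ne[OF j])
  have lt: "- \<nu> * (n * real (M j) * (2 * real k + 1)) < t" if "k \<ge> 1" for k
  proof -
    have "\<nu> * (n * real (M j)) * 1 < \<nu> * (n * real (M j)) * (2 * real k + 1)"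
      using nn that by (intro mult_strict_left_mono) auto
    thus ?thesis using t by (simp add: mult_ac)
  qed
  have "inj_on \<tau> {1..d j}"
  proof (rule inj_onI)
    fix k k' assume "k \<in> {1..d j}" "k' \<in> {1..d j}" "\<tau> k = \<tau> k'"
    thus "k = k'" using lt[of k] lt[of k'] nn by (auto simp: \<tau>_def split: if_splits)
  qed
  moreover have "w \<in> trop_hyp val (g j)" if "k \<in> {1..d j}" "w $ e 0 = s" "w $ e j = \<tau> k" for k w
    using that top(1)[of w] horizontal_sheet[OF j, of k w] s by (auto simp: \<tau>_def split: if_splits)
  ultimately show ?thesis by blast
qed

text \<open>To the right of this abscissa the constant monomial is the least power of
  \<open>x\<^sub>0\<close> for every \<open>j\<close>, so the top sheets have constant height there.
  This yields a full-dimensional piece of each intersection.\<close>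

definition s_big :: real where "s_big = \<nu> * ((2 * n * real B + 1) * n)"

lemma stable_sheet:
  assumes j: "j \<in> I" and w: "w $ e 0 \<ge> s_big" "w $ e j = \<nu> * (n * real (M j) * (real (K j) - 1))"
  shows "w \<in> trop_hyp val (g j)"
proof (rule top_sheet(1)[OF j, of w 0])
  show "tq j (w $ e j) 1 = tp j (w $ e 0) 0" by (simp add: tq_def tp_def w algebra_simps)
  have "0 \<le> s_big" using val_pi by (simp add: s_big_def)
  thus "0 \<le> w $ e 0" using w by simp
  fix a
  have "\<nu> * ((2 * n * real B + 1) * j) \<le> s_big"
    unfolding s_big_def using I_lt[OF j] val_pi by (intro mult_left_mono) auto
  hence "0 \<le> \<nu> * (n * real a + n) + (w $ e 0 - \<nu> * ((2 * n * real B + 1) * j))"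
    using w val_pi by (intro add_nonneg_nonneg) auto
  hence "0 \<le> real a * (\<nu> * (n * real a + n) + (w $ e 0 - \<nu> * ((2 * n * real B + 1) * j)))"
    by (intro mult_nonneg_nonneg) auto
  also have "\<dots> = tp j (w $ e 0) a" by (simp add: tp_def algebra_simps power2_eq_square)
  finally show "tp j (w $ e 0) 0 \<le> tp j (w $ e 0) a" by (simp add: tp_def)
qed simp

end

section \<open>Transversality\<close>

context caterpillar
begin

definition curve :: "(real^'n) set" where "curve = (\<Inter>i\<in>I. trop_hyp val (g i))"

text \<open>Because \<open>k' + 1 \<le> B\<close>, the term \<open>2 * n * k'\<close> takes away
  less than one block of length \<open>2 * n * B + 1\<close>. The index \<open>i\<close> may be 0,
  and \<open>\<sigma> 0 0 = 0\<close> then gives positivity.\<close>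

lemma sigma_less:
  assumes "i < j" "j \<in> I" "k' \<in> {1..d j}"
  shows "\<sigma> i k < \<sigma> j k'"
proof -
  have "d j \<le> (\<Sum>i\<in>I. d i)" using assms(2) by (intro member_le_sum) auto
  hence "k' + 1 \<le> B" using assms(3) by (auto simp: B_def)
  hence "2 * n * (real k' + 1) \<le> 2 * n * real B" by (intro mult_left_mono) linarith+
  moreover have "(2 * n * real B + 1) * (real i + 1) \<le> (2 * n * real B + 1) * real j"
    using assms(1) by (intro mult_left_mono) auto
  ultimately have "(2 * n * real B + 1) * i < (2 * n * real B + 1) * j - 2 * n * real k'"
    using n3 by (simp add: algebra_simps)
  moreover have "(2 * n * real B + 1) * i - 2 * n * real k \<le> (2 * n * real B + 1) * i" by simp
  ultimately have "(2 * n * real B + 1) * i - 2 * n * real k < (2 * n * real B + 1) * j - 2 * n * real k'"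
    by linarith
  thus ?thesis unfolding \<sigma>_def using val_pi by (intro mult_strict_left_mono) auto
qed

lemma sigma_pos: "j \<in> I \<Longrightarrow> k \<in> {1..d j} \<Longrightarrow> \<sigma> j k > 0"
  using sigma_less[of 0 j k 0] by (simp add: \<sigma>_def)

lemma not_special_sigma: "i \<in> I \<Longrightarrow> j \<in> I \<Longrightarrow> i \<noteq> j \<Longrightarrow> \<not> special j (\<sigma> i k)"
  using special_unique[of i "\<sigma> i k" j] special_sigma[of i k] I_lt by blast

lemma exp_vec_diff_inner:
  assumes "j \<in> I" "\<alpha> \<in> E j" "\<beta> \<in> E j"
  shows "(exp_vec \<alpha> - exp_vec \<beta>) \<bullet> u =
    (real (Poly_Mapping.lookup \<alpha> (e 0)) - Poly_Mapping.lookup \<beta> (e 0)) * u $ e 0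
    + (real (Poly_Mapping.lookup \<alpha> (e j)) - Poly_Mapping.lookup \<beta> (e j)) * u $ e j"
  using assms by (simp add: inner_diff_left exp_vec_inner algebra_simps)

text \<open>On the wall, \<open>g i\<close> freezes \<open>w\<^sub>0\<close>. The germ of every
  other hypersurface is a hyperplane in the coordinates 0 and \<open>j\<close> with nonzero
  coefficient at \<open>j\<close>, since the abscissa is not special for \<open>j\<close>; so
  \<open>w\<^sub>j\<close> is frozen too, and only the coordinate \<open>e i\<close> remains
  free.\<close>

lemma leg_germ:
  assumes i: "i \<in> I" and k: "k \<in> {1..d i}" and w0: "w $ e 0 = \<sigma> i k"
    and init: "init_exps val (g i) w = {Poly_Mapping.single (e 0) k, Poly_Mapping.single (e 0) (k - 1)}"
    and w: "\<And>j. j \<in> I - {i} \<Longrightarrow> w \<in> trop_hyp val (g j)"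
  shows "w \<in> curve"
    and "\<exists>\<epsilon>>0. curve \<inter> ball w \<epsilon> = {w + t *\<^sub>R axis (e i) 1 | t. True} \<inter> ball w \<epsilon>"
proof -
  have ne: "Poly_Mapping.single (e 0) k \<noteq> Poly_Mapping.single (e 0) (k - 1)"
    using k by (metis lookup_single_eq atLeastAtMost_iff diff_less less_irrefl less_le_trans zero_less_one)
  have "w \<in> trop_hyp val (g i)" using init ne g_nz by (simp add: trop_hyp_def)
  thus wC: "w \<in> curve" using w unfolding curve_def by blast
  have kE: "Poly_Mapping.single (e 0) k \<in> E i" "Poly_Mapping.single (e 0) (k - 1) \<in> E i"
    using k by (auto simp: E_def)
  have gi: "\<exists>\<epsilon>>0. \<forall>v\<in>ball w \<epsilon>. v \<in> trop_hyp val (g i) \<longleftrightarrow> (v - w) $ e 0 = 0"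
    using trop_hyp_germ[OF init ne] exp_vec_diff_inner[OF i kE] k e0_ne[OF i]
    by (simp add: lookup_single when_def of_nat_diff)
  obtain \<epsilon>0 where \<epsilon>0: "\<epsilon>0 > 0" "\<And>v. v \<in> ball w \<epsilon>0 \<Longrightarrow> v \<in> trop_hyp val (g i) \<longleftrightarrow> (v - w) $ e 0 = 0"
    using gi by blast
  have "\<forall>j\<in>I - {i}. \<exists>\<epsilon>>0. \<forall>v\<in>ball w \<epsilon>. (v - w) $ e 0 = 0 \<longrightarrow> (v \<in> trop_hyp val (g j) \<longleftrightarrow> (v - w) $ e j = 0)"
  proof
    fix j assume j: "j \<in> I - {i}"
    have jI: "j \<in> I" and ns: "\<not> special j (w $ e 0)" using j not_special_sigma[OF i, of j k] w0 by auto
    obtain \<alpha> \<beta> where ab: "init_exps val (g j) w = {\<alpha>, \<beta>}"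
        "Poly_Mapping.lookup \<alpha> (e j) \<noteq> Poly_Mapping.lookup \<beta> (e j)" "\<alpha> \<in> E j" "\<beta> \<in> E j"
      using init_if_not_special[OF jI ns w[OF j]] .
    have "\<alpha> \<noteq> \<beta>" using ab(2) by auto
    from trop_hyp_germ[OF ab(1) this] obtain \<epsilon> where eps: "\<epsilon> > 0"
        "\<forall>v\<in>ball w \<epsilon>. v \<in> trop_hyp val (g j) \<longleftrightarrow> (exp_vec \<alpha> - exp_vec \<beta>) \<bullet> (v - w) = 0" by blast
    have "v \<in> trop_hyp val (g j) \<longleftrightarrow> (v - w) $ e j = 0" if v: "v \<in> ball w \<epsilon>" and z: "(v - w) $ e 0 = 0" for v
    proof -
      have "v \<in> trop_hyp val (g j) \<longleftrightarrow> (exp_vec \<alpha> - exp_vec \<beta>) \<bullet> (v - w) = 0" using eps(2) v by blast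
      thus ?thesis unfolding exp_vec_diff_inner[OF jI ab(3,4)] z using ab(2) by simp
    qed
    thus "\<exists>\<epsilon>>0. \<forall>v\<in>ball w \<epsilon>. (v - w) $ e 0 = 0 \<longrightarrow> (v \<in> trop_hyp val (g j) \<longleftrightarrow> (v - w) $ e j = 0)"
      using eps(1) by blast
  qed
  from bchoice[OF this] obtain \<epsilon>1 where \<epsilon>1: "\<And>j. j \<in> I - {i} \<Longrightarrow> \<epsilon>1 j > 0"
      "\<And>j v. j \<in> I - {i} \<Longrightarrow> v \<in> ball w (\<epsilon>1 j) \<Longrightarrow> (v - w) $ e 0 = 0 \<Longrightarrow> v \<in> trop_hyp val (g j) \<longleftrightarrow> (v - w) $ e j = 0"
    by blast
  define \<epsilon> where "\<epsilon> = Min (insert \<epsilon>0 (\<epsilon>1 ` (I - {i})))"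
  have fin: "finite (insert \<epsilon>0 (\<epsilon>1 ` (I - {i})))" by simp
  have \<epsilon>: "\<epsilon> > 0" using \<epsilon>0(1) \<epsilon>1(1) unfolding \<epsilon>_def by (subst Min_gr_iff[OF fin]) auto
  have \<epsilon>_le: "\<epsilon> \<le> \<epsilon>0" "\<And>j. j \<in> I - {i} \<Longrightarrow> \<epsilon> \<le> \<epsilon>1 j"
    unfolding \<epsilon>_def using fin by (auto intro!: Min_le)
  have iff: "v \<in> curve \<longleftrightarrow> (\<exists>t. v = w + t *\<^sub>R axis (e i) 1)" if v: "v \<in> ball w \<epsilon>" for v
  proof -
    have b: "v \<in> ball w \<epsilon>0" "\<And>j. j \<in> I - {i} \<Longrightarrow> v \<in> ball w (\<epsilon>1 j)" using v \<epsilon>_le by force+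
    have "v \<in> curve \<longleftrightarrow> (\<forall>j\<in>I. v \<in> trop_hyp val (g j))" by (simp add: curve_def)
    also have "\<dots> \<longleftrightarrow> (\<forall>j<n. j \<noteq> i \<longrightarrow> (v - w) $ e j = 0)"
    proof
      assume L: "\<forall>j\<in>I. v \<in> trop_hyp val (g j)"
      have z: "(v - w) $ e 0 = 0" using L i \<epsilon>0(2) b(1) by blast
      show "\<forall>j<n. j \<noteq> i \<longrightarrow> (v - w) $ e j = 0"
      proof (intro allI impI)
        fix j assume j: "j < n" "j \<noteq> i"
        show "(v - w) $ e j = 0"
        proof (cases "j = 0")
          case False
          hence "j \<in> I - {i}" using j by auto
          thus ?thesis using \<epsilon>1(2)[of j v] b(2) z L by blast
        qed (use z in simp)
      qed
    next
      assume R: "\<forall>j<n. j \<noteq> i \<longrightarrow> (v - w) $ e j = 0"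
      have z: "(v - w) $ e 0 = 0" using R i n3 by auto
      show "\<forall>j\<in>I. v \<in> trop_hyp val (g j)"
      proof
        fix j assume j: "j \<in> I"
        show "v \<in> trop_hyp val (g j)"
        proof (cases "j = i")
          case True thus ?thesis using z \<epsilon>0(2) b(1) by blast
        next
          case False
          hence "j \<in> I - {i}" "(v - w) $ e j = 0" using j R I_lt by auto
          thus ?thesis using \<epsilon>1(2) b(2) z by blast
        qed
      qed
    qed
    also have "\<dots> \<longleftrightarrow> (\<exists>t. v = w + t *\<^sub>R axis (e i) 1)"
    proof
      assume R: "\<forall>j<n. j \<noteq> i \<longrightarrow> (v - w) $ e j = 0"
      have "v $ k = (w + (v $ e i - w $ e i) *\<^sub>R axis (e i) 1) $ k" for k
      proof -
        obtain m where m: "m < n" "k = e m" by (rule e_surj)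
        show ?thesis
        proof (cases "m = i")
          case False
          hence "e m \<noteq> e i" using e_inj[OF m(1) I_lt[OF i]] by simp
          thus ?thesis using R m False by (auto simp: axis_def)
        qed (use m in \<open>auto simp: axis_def\<close>)
      qed
      thus "\<exists>t. v = w + t *\<^sub>R axis (e i) 1" unfolding vec_eq_iff by blast
    next
      assume "\<exists>t. v = w + t *\<^sub>R axis (e i) 1"
      then obtain t where t: "v = w + t *\<^sub>R axis (e i) 1" by blast
      show "\<forall>j<n. j \<noteq> i \<longrightarrow> (v - w) $ e j = 0"
        using e_inj[OF _ I_lt[OF i]] by (auto simp: t axis_def)
    qed
    finally show ?thesis .
  qed
  show "\<exists>\<epsilon>>0. curve \<inter> ball w \<epsilon> = {w + t *\<^sub>R axis (e i) 1 | t. True} \<inter> ball w \<epsilon>"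
    using iff \<epsilon> by (intro exI[of _ \<epsilon>]) blast
qed

lemma special_at_most_once:
  assumes "S \<subseteq> I" "S \<noteq> {}"
  obtains j where "j \<in> S" "\<And>i. i \<in> S - {j} \<Longrightarrow> \<not> special i s"
proof (cases "\<exists>j\<in>S. special j s")
  case True
  then obtain j where j: "j \<in> S" "special j s" by blast
  show thesis
  proof (rule that[OF j(1)])
    fix i assume "i \<in> S - {j}"
    thus "\<not> special i s" using special_unique[of i s j] j I_lt assms(1) by blast
  qed
next
  case False
  thus thesis using that assms(2) by blast
qed

lemma exp_vec_support: "\<alpha> \<in> E j \<Longrightarrow> k \<noteq> e 0 \<Longrightarrow> k \<noteq> e j \<Longrightarrow> exp_vec \<alpha> $ k = 0"
  by (auto simp: E_def exp_vec_def lookup_single when_def)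

text \<open>The one index that may be special over \<open>s\<close> becomes the unrestricted
  summand; all others are edges with a coordinate of their own. Stated for subsets
  \<open>X i\<close>, because the dimension bound applies it to chosen pairs of tied monomials
  instead of all minimal ones.\<close>

lemma aff_dim_dual_cell:
  assumes S: "S \<subseteq> I" "S \<noteq> {}"
    and X: "\<And>i. i \<in> S \<Longrightarrow> X i \<noteq> {} \<and> X i \<subseteq> E i"
    and two: "\<And>i. i \<in> S \<Longrightarrow> \<not> special i s \<Longrightarrow> \<exists>\<alpha> \<beta>. X i = {\<alpha>, \<beta>} \<and> Poly_Mapping.lookup \<alpha> (e i) \<noteq> Poly_Mapping.lookup \<beta> (e i)"
  shows "aff_dim {\<Sum>i\<in>S. a i | a. \<forall>i\<in>S. a i \<in> exp_vec ` X i} = (\<Sum>i\<in>S. aff_dim (exp_vec ` X i))"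
proof -
  obtain j where j: "j \<in> S" "\<And>i. i \<in> S - {j} \<Longrightarrow> \<not> special i s" using special_at_most_once[OF S] by blast
  have Sj: "insert j (S - {j}) = S" using j by blast
  have "aff_dim {\<Sum>i\<in>insert j (S - {j}). a i | a. \<forall>i\<in>insert j (S - {j}). a i \<in> exp_vec ` X i}
      = (\<Sum>i\<in>insert j (S - {j}). aff_dim (exp_vec ` X i))"
  proof (rule aff_dim_Minkowski_sum_family[where e = e and z = "e 0"])
    show "finite (S - {j})" using S(1) finite_subset by auto
    show "exp_vec ` X j \<noteq> {}" using X j by auto
    have "S \<subseteq> {..<n}" using S(1) I_lt by auto
    thus "inj_on e (insert j (S - {j}))" unfolding Sj using bij_e by (meson bij_betw_imp_inj_on inj_on_subset)
    show "e 0 \<notin> e ` insert j (S - {j})" unfolding Sj using S(1) e0_ne by blast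
  next
    fix i x y k assume *: "i \<in> insert j (S - {j})" "x \<in> exp_vec ` X i" "y \<in> exp_vec ` X i" "k \<noteq> e 0" "k \<noteq> e i"
    hence "X i \<subseteq> E i" using X Sj by blast
    thus "x $ k = y $ k" using * exp_vec_support[of _ i k] by (auto simp: subset_iff)
  next
    fix i assume i: "i \<in> S - {j}"
    then obtain \<alpha> \<beta> where "X i = {\<alpha>, \<beta>}" "Poly_Mapping.lookup \<alpha> (e i) \<noteq> Poly_Mapping.lookup \<beta> (e i)"
      using two[of i] j(2)[OF i] by blast
    thus "\<exists>p q. exp_vec ` X i = {p, q} \<and> p $ e i \<noteq> q $ e i"
      by (intro exI[of _ "exp_vec \<alpha>"] exI[of _ "exp_vec \<beta>"]) (simp add: exp_vec_def)
  qed simp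
  thus ?thesis unfolding Sj .
qed

lemma inj_exp_vec: "inj exp_vec"
  by (rule injI, rule poly_mapping_eqI) (simp add: exp_vec_def vec_eq_iff)

text \<open>Choosing two tied monomials per hypersurface covers the intersection by finitely many
  affine spaces. A convex subset lies in one of them, and each is orthogonal to a Minkowski sum of
  edges of dimension \<open>card S\<close>.\<close>

lemma aff_dim_upper:
  assumes S: "S \<subseteq> I" "S \<noteq> {}" and P: "convex P" "P \<noteq> {}" "P \<subseteq> (\<Inter>i\<in>S. trop_hyp val (g i))"
  shows "aff_dim P \<le> int n - int (card S)"
proof -
  have finS: "finite S" using S(1) finite_subset by auto
  define Q :: "(nat \<Rightarrow> 'n \<Rightarrow>\<^sub>0 nat) \<times> (nat \<Rightarrow> 'n \<Rightarrow>\<^sub>0 nat) \<Rightarrow> (real^'n) set"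
    where "Q ab = {\<Sum>i\<in>S. a i | a. \<forall>i\<in>S. a i \<in> exp_vec ` {fst ab i, snd ab i}}" for ab
  define A where "A ab = {w. \<forall>i\<in>S. tv i w (fst ab i) = tv i w (snd ab i)}" for ab
  \<comment> \<open>Only choices with edges in independent directions are kept. The others need not
    have the right codimension, but \<open>cover\<close> shows that the kept ones already reach
    every point of the intersection.\<close>
  define G where "G = {ab \<in> Pi\<^sub>E S E \<times> Pi\<^sub>E S E. aff_dim (Q ab) = card S}"
  have "finite (Pi\<^sub>E S E)" using finS finite_E by (intro finite_PiE) auto
  hence finG: "finite G" unfolding G_def by simp
  have A_eq: "A ab = (\<Inter>i\<in>S. {w. (exp_vec (fst ab i) - exp_vec (snd ab i)) \<bullet> w =
      val (Poly_Mapping.lookup (g i) (snd ab i)) - val (Poly_Mapping.lookup (g i) (fst ab i))})" for ab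
    unfolding A_def tv_def inner_diff_left by (auto simp: algebra_simps) 
  have aff: "affine (A ab)" for ab
    unfolding A_eq by (intro affine_Inter) (auto simp: affine_hyperplane)
  have cover: "\<exists>ab\<in>G. w \<in> A ab" if w: "w \<in> (\<Inter>i\<in>S. trop_hyp val (g i))" for w
  proof -
    have "\<forall>i\<in>S. \<exists>ab. fst ab \<in> init_exps val (g i) w \<and> snd ab \<in> init_exps val (g i) w \<and> fst ab \<noteq> snd ab"
    proof
      fix i assume "i \<in> S"
      hence "2 \<le> card (init_exps val (g i) w)" using w g_nz[of i] by (auto simp: trop_hyp_def)
      then obtain T where "T \<subseteq> init_exps val (g i) w" "card T = 2" by (meson obtain_subset_with_card_n)
      then obtain \<alpha> \<beta> where "\<alpha> \<in> init_exps val (g i) w" "\<beta> \<in> init_exps val (g i) w" "\<alpha> \<noteq> \<beta>" by (auto simp: card_2_iff)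
      thus "\<exists>ab. fst ab \<in> init_exps val (g i) w \<and> snd ab \<in> init_exps val (g i) w \<and> fst ab \<noteq> snd ab"
        by (intro exI[of _ "(\<alpha>, \<beta>)"]) simp
    qed
    from bchoice[OF this] obtain f where f: "\<And>i. i \<in> S \<Longrightarrow> fst (f i) \<in> init_exps val (g i) w"
      "\<And>i. i \<in> S \<Longrightarrow> snd (f i) \<in> init_exps val (g i) w" "\<And>i. i \<in> S \<Longrightarrow> fst (f i) \<noteq> snd (f i)" by blast
    define ab where "ab = (restrict (\<lambda>i. fst (f i)) S, restrict (\<lambda>i. snd (f i)) S)"
    have ab: "fst ab i = fst (f i)" "snd ab i = snd (f i)" if "i \<in> S" for i using that by (simp_all add: ab_def)
    have fE: "fst (f i) \<in> E i" "snd (f i) \<in> E i" "tv i w (fst (f i)) = tv i w (snd (f i))" if "i \<in> S" for i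
      using f(1,2)[OF that] unfolding init_g by (auto intro: antisym)
    have "aff_dim (Q ab) = (\<Sum>i\<in>S. aff_dim (exp_vec ` {fst ab i, snd ab i}))"
      unfolding Q_def
    proof (rule aff_dim_dual_cell[OF S, where s = "w $ e 0"])
      fix i assume i: "i \<in> S"
      show "{fst ab i, snd ab i} \<noteq> {} \<and> {fst ab i, snd ab i} \<subseteq> E i" using fE i ab by simp
      assume "\<not> special i (w $ e 0)"
      hence "Poly_Mapping.lookup (fst (f i)) (e i) \<noteq> Poly_Mapping.lookup (snd (f i)) (e i)"
        using lookup_ne_if_not_special f i S(1) by blast
      thus "\<exists>\<alpha> \<beta>. {fst ab i, snd ab i} = {\<alpha>, \<beta>} \<and> Poly_Mapping.lookup \<alpha> (e i) \<noteq> Poly_Mapping.lookup \<beta> (e i)"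
        using ab[OF i] by auto
    qed
    also have "\<dots> = (\<Sum>i\<in>S. 1)"
    proof (rule sum.cong[OF refl])
      fix i assume i: "i \<in> S"
      have "exp_vec (fst (f i)) \<noteq> exp_vec (snd (f i))" using f(3)[OF i] by (simp add: inj_eq[OF inj_exp_vec])
      thus "aff_dim (exp_vec ` {fst ab i, snd ab i}) = 1" using ab[OF i] by simp
    qed
    finally have "aff_dim (Q ab) = card S" by simp
    moreover have "ab \<in> Pi\<^sub>E S E \<times> Pi\<^sub>E S E" using fE by (auto simp: ab_def)
    moreover have "w \<in> A ab" using fE ab by (simp add: A_def)
    ultimately show ?thesis unfolding G_def by blast
  qed
  have "\<exists>B\<in>A ` G. P \<subseteq> B"
  proof (rule convex_subset_Union_affine)
    show "P \<subseteq> \<Union> (A ` G)" using cover P(3) by blast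
  qed (use finG P aff in auto)
  then obtain ab where ab: "ab \<in> G" "P \<subseteq> A ab" by blast
  have Q: "aff_dim (Q ab) = card S" using ab by (simp add: G_def)
  have "Q ab \<noteq> {}"
  proof
    assume "Q ab = {}"
    thus False using Q by simp
  qed
  have "aff_dim P + aff_dim (Q ab) \<le> int DIM(real^'n)"
  proof (rule aff_dim_add_le_if_orthogonal[OF P(2) \<open>Q ab \<noteq> {}\<close>])
    fix x y u v assume xy: "x \<in> P" "y \<in> P" and uv: "u \<in> Q ab" "v \<in> Q ab"
    obtain u' v' where u': "u = sum u' S" "\<forall>i\<in>S. u' i \<in> exp_vec ` {fst ab i, snd ab i}"
      and v': "v = sum v' S" "\<forall>i\<in>S. v' i \<in> exp_vec ` {fst ab i, snd ab i}"
      using uv unfolding Q_def by blast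
    have "(x - y) \<bullet> (u' i - v' i) = 0" if i: "i \<in> S" for i
    proof -
      have "x \<in> A ab" "y \<in> A ab" using xy ab by auto
      hence "(exp_vec (fst ab i) - exp_vec (snd ab i)) \<bullet> x = (exp_vec (fst ab i) - exp_vec (snd ab i)) \<bullet> y"
        unfolding A_eq using i by auto
      hence 0: "(x - y) \<bullet> exp_vec (fst ab i) = (x - y) \<bullet> exp_vec (snd ab i)"
        by (simp add: inner_diff_left inner_diff_right inner_commute)
      have "(x - y) \<bullet> u' i = (x - y) \<bullet> exp_vec (snd ab i)" "(x - y) \<bullet> v' i = (x - y) \<bullet> exp_vec (snd ab i)"
        using u'(2) v'(2) i 0 by auto
      thus ?thesis by (simp add: inner_diff_right)
    qed
    hence "(\<Sum>i\<in>S. (x - y) \<bullet> (u' i - v' i)) = 0" by simp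
    thus "(x - y) \<bullet> (u - v) = 0"
      by (simp add: u'(1) v'(1) inner_sum_right inner_diff_right sum_subtractf)
  qed
  thus ?thesis using Q n_eq by simp
qed

lemma transversal_g: "transversal val (n - 1) g"
  unfolding transversal_def
proof (intro allI impI conjI ballI)
  fix S assume S: "S \<subseteq> I \<and> 2 \<le> card S"
  hence SI: "S \<subseteq> I" and Sne: "S \<noteq> {}" by auto
  have finS: "finite S" using SI finite_subset by auto
  have "card S \<le> card I" using SI by (intro card_mono) auto
  hence cS: "card S \<le> n" by simp
  have ej: "inj_on e S" using bij_e SI I_lt by (meson bij_betw_imp_inj_on inj_on_subset lessThan_iff subsetI subsetD)
  let ?X = "\<Inter>i\<in>S. trop_hyp val (g i)"
  show "has_dim ?X (int CARD('n) - int (card S))"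
    unfolding has_dim_def
  proof (intro conjI allI impI)
    define r where "r j = \<nu> * (n * real (M j) * (real (K j) - 1))" for j
    define p :: "real^'n" where "p = (\<chi> k. if k = e 0 then s_big else r (inv_into {..<n} e k))"
    have pj: "p $ e j = r j" if "j \<in> S" for j
    proof -
      have "j \<in> I" using that SI by blast
      hence "inv_into {..<n} e (e j) = j" using bij_e I_lt by (intro inv_into_f_f) (auto simp: bij_betw_def)
      thus ?thesis using e0_ne[OF \<open>j \<in> I\<close>] by (simp add: p_def)
    qed
    let ?N = "- e ` S"
    let ?P = "convex hull (insert p ((\<lambda>k. p + axis k 1) ` ?N))"
    have "?P \<subseteq> {w. s_big \<le> w $ e 0} \<inter> (\<Inter>j\<in>S. {w. w $ e j = r j})"
    proof (rule hull_minimal)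
      have "convex {w::real^'n. s_big \<le> w $ e 0}"
        using convex_halfspace_ge[of s_big "axis (e 0) (1::real)"] by (simp add: inner_axis')
      moreover have "convex {w::real^'n. w $ e j = r j}" for j
        using convex_hyperplane[of "axis (e j) (1::real)" "r j"] by (simp add: inner_axis')
      ultimately show "convex ({w. s_big \<le> w $ e 0} \<inter> (\<Inter>j\<in>S. {w. w $ e j = r j}))"
        by (intro convex_Int convex_INT)
      show "insert p ((\<lambda>k. p + axis k 1) ` ?N) \<subseteq> {w. s_big \<le> w $ e 0} \<inter> (\<Inter>j\<in>S. {w. w $ e j = r j})"
        using pj by (auto simp: axis_def p_def)
    qed
    hence "?P \<subseteq> ?X" using stable_sheet SI unfolding r_def by blast
    moreover have "int (card ?N) = int CARD('n) - int (card S)"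
      using cS n_eq by (simp add: Compl_eq_Diff_UNIV card_Diff_subset finS card_image[OF ej] of_nat_diff)
    ultimately show "\<exists>P. polytope P \<and> P \<subseteq> ?X \<and> aff_dim P = int CARD('n) - int (card S)"
      using aff_dim_coordinate_simplex[of p ?N] by metis
  next
    fix P assume P: "polytope P \<and> P \<subseteq> ?X"
    show "aff_dim P \<le> int CARD('n) - int (card S)"
    proof (cases "P = {}")
      case True
      thus ?thesis using cS n_eq by simp
    next
      case False
      thus ?thesis using aff_dim_upper[OF SI Sne _ False] P n_eq by (simp add: polytope_imp_convex)
    qed
  qed
  fix w assume w: "w \<in> ?X"
  show "aff_dim {\<Sum>i\<in>S. a i | a. \<forall>i\<in>S. a i \<in> exp_vec ` init_exps val (g i) w}
      = (\<Sum>i\<in>S. aff_dim (exp_vec ` init_exps val (g i) w))"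
  proof (rule aff_dim_dual_cell[OF SI Sne, where s = "w $ e 0"])
    fix i assume i: "i \<in> S"
    have "2 \<le> card (init_exps val (g i) w)" using w i g_nz[of i] by (auto simp: trop_hyp_def)
    hence "init_exps val (g i) w \<noteq> {}" by force
    thus "init_exps val (g i) w \<noteq> {} \<and> init_exps val (g i) w \<subseteq> E i" unfolding init_g by blast
    assume ns: "\<not> special i (w $ e 0)"
    have "i \<in> I" "w \<in> trop_hyp val (g i)" using i w SI by auto
    from init_if_not_special[OF this(1) ns this(2)]
    show "\<exists>\<alpha> \<beta>. init_exps val (g i) w = {\<alpha>, \<beta>} \<and> Poly_Mapping.lookup \<alpha> (e i) \<noteq> Poly_Mapping.lookup \<beta> (e i)"
      by metis
  qed
qed

end

section \<open>Projections and crossings\<close>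

lemma sum_pred_eq_choose_two: "(\<Sum>j=1..m. j - 1) = m choose 2"
  by (induction m) (simp_all add: numeral_2_eq_2)

lemma sum_eq_choose_two: "(\<Sum>i=1..m-1. i) = m choose 2"
proof (induction m)
  case (Suc m)
  have "(\<Sum>i=1..m. i) = (\<Sum>i=1..m-1. i) + m" by (cases m) simp_all
  thus ?case using Suc by (simp add: numeral_2_eq_2)
qed simp

lemma eventually_poly_nonzero_at_right:
  fixes p :: "real poly"
  assumes "p \<noteq> 0"
  shows "eventually (\<lambda>T. poly p T \<noteq> 0) (at_right a)"
proof -
  have "finite {T. poly p T = 0}" using assms by (rule poly_roots_finite)
  hence "open (- ({T. poly p T = 0} - {a}))" by (intro open_Compl finite_imp_closed) auto
  hence "eventually (\<lambda>T. T \<in> - ({T. poly p T = 0} - {a})) (nhds a)" by (rule eventually_nhds_in_open) simp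
  thus ?thesis unfolding eventually_at_filter by eventually_elim auto
qed

context caterpillar
begin

text \<open>As \<open>T\<close> tends to 0, the images of the legs become almost vertical, and the images of any two
  legs of different directions cross far above the rest of the curve.\<close>
definition proj :: "real \<Rightarrow> real^'n^2" where
  "proj T = (\<chi> r k. if r = 1 then T ^ inv_into {..<n} e k else if k = e 0 then 0 else 1)"

text \<open>The intercept on the first axis of the line through the image of \<open>w\<close> in
  direction \<open>(T ^ i, 1)\<close>. It is constant along the \<open>i\<close>-th leg and
  identifies the line carrying the image.\<close>

definition offset :: "real \<Rightarrow> nat \<Rightarrow> real^'n \<Rightarrow> real" where
  "offset T i w = (proj T *v w) $ 1 - T ^ i * (proj T *v w) $ 2"

lemma inv_e: "m < n \<Longrightarrow> inv_into {..<n} e (e m) = m"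
  using bij_e by (intro inv_into_f_f) (auto simp: bij_betw_def)

lemma sum_UNIV_e: "(\<Sum>k\<in>UNIV. f k) = f (e 0) + (\<Sum>m\<in>I. f (e m))"
proof -
  have "(\<Sum>k\<in>UNIV. f k) = (\<Sum>m<n. f (e m))"
    using sum.reindex_bij_betw[OF bij_e, of f] by simp
  also have "{..<n} = insert 0 I" using n3 by auto
  finally show ?thesis by simp
qed

lemma proj_1: "(proj T *v w) $ 1 = w $ e 0 + (\<Sum>m\<in>I. T ^ m * w $ e m)"
proof -
  have "(\<Sum>m\<in>I. T ^ inv_into {..<n} e (e m) * w $ e m) = (\<Sum>m\<in>I. T ^ m * w $ e m)"
    by (intro sum.cong refl) (use I_lt inv_e in simp)
  thus ?thesis using n3 by (simp add: matrix_vector_mult_def proj_def sum_UNIV_e inv_e)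
qed

lemma proj_2: "(proj T *v w) $ 2 = (\<Sum>m\<in>I. w $ e m)"
proof -
  have "(\<Sum>m\<in>I. (if e m = e 0 then 0 else 1) * w $ e m) = (\<Sum>m\<in>I. w $ e m)"
    by (intro sum.cong refl) (use e0_ne in simp)
  thus ?thesis by (simp add: matrix_vector_mult_def proj_def sum_UNIV_e)
qed

lemma proj_axis:
  assumes "i \<in> I"
  shows "(proj T *v axis (e i) 1) $ 1 = T ^ i" "(proj T *v axis (e i) 1) $ 2 = 1"
proof -
  have *: "e i = e m \<longleftrightarrow> m = i" if "m \<in> I" for m using that assms e_ne[of i m] by auto
  have ax: "axis (e i) (1::real) $ e m = (if m = i then 1 else 0)" if "m \<in> I" for m
    using *[OF that] by (auto simp: axis_def)
  have "(\<Sum>m\<in>I. T ^ m * axis (e i) 1 $ e m) = (\<Sum>m\<in>I. if m = i then T ^ i else 0)"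
    by (rule sum.cong[OF refl]) (simp add: ax)
  thus "(proj T *v axis (e i) 1) $ 1 = T ^ i"
    using assms e0_ne[OF assms] by (simp add: proj_1 axis_def)
  have "(\<Sum>m\<in>I. axis (e i) 1 $ e m) = (\<Sum>m\<in>I. if m = i then 1 else (0::real))"
    by (rule sum.cong[OF refl]) (simp add: ax)
  thus "(proj T *v axis (e i) 1) $ 2 = 1" using assms by (simp add: proj_2)
qed

lemma proj_leg:
  assumes "i \<in> I"
  shows "(proj T *v (p + t *\<^sub>R axis (e i) 1)) $ 1 = (proj T *v p) $ 1 + t * T ^ i"
    "(proj T *v (p + t *\<^sub>R axis (e i) 1)) $ 2 = (proj T *v p) $ 2 + t"
  using assms by (simp_all add: matrix_vector_right_distrib matrix_vector_mult_scaleR proj_axis)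

lemma rational_projection_proj:
  assumes "T \<in> \<rat>"
  shows "rational_projection (proj T)"
proof -
  have "surj ((*v) (proj T))"
  proof (rule surjI)
    fix y :: "real^2"
    have 1: "1 \<in> I" using n3 by auto
    have "(proj T *v axis (e 0) 1) $ 1 = 1" "(proj T *v axis (e 0) 1) $ 2 = 0"
      using e0_ne by (simp_all add: proj_1 proj_2 axis_def)
    thus "proj T *v ((\<lambda>y. (y $ 1 - T * y $ 2) *\<^sub>R axis (e 0) 1 + y $ 2 *\<^sub>R axis (e 1) 1) y) = y"
      using proj_axis[OF 1, of T] unfolding vec_eq_iff forall_2
      by (simp add: matrix_vector_right_distrib matrix_vector_mult_scaleR)
  qed
  hence "rank (proj T) = 2" using full_rank_surjective[of "proj T"] by simp
  thus ?thesis using assms by (simp add: rational_projection_def proj_def)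
qed

section \<open>Position of the image lines for small positive parameters\<close>

lemma offset_eq: "offset T i w = w $ e 0 + (\<Sum>m\<in>I. (T ^ m - T ^ i) * w $ e m)"
  by (simp add: offset_def proj_1 proj_2 sum_distrib_left left_diff_distrib sum_subtractf)

lemma offset_tendsto:
  assumes "i \<in> I"
  shows "((\<lambda>T. offset T i w) \<longlongrightarrow> w $ e 0) (at_right 0)"
proof -
  have "((\<lambda>T. w $ e 0 + (\<Sum>m\<in>I. (T ^ m - T ^ i) * w $ e m)) \<longlongrightarrow>
      w $ e 0 + (\<Sum>m\<in>I. (0 ^ m - 0 ^ i) * w $ e m)) (at_right 0)"
    by (intro tendsto_intros)
  moreover have "(\<Sum>m\<in>I. (0 ^ m - 0 ^ i) * w $ e m) = 0"
    by (rule sum.neutral) (use assms in \<open>auto simp: zero_power\<close>)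
  ultimately show ?thesis by (simp add: offset_eq)
qed

text \<open>The difference of the offsets is a polynomial in \<open>T\<close>. Its coefficient at
  \<open>T ^ m\<close>, for \<open>m \<noteq> i\<close>, is the difference of the coordinates at
  \<open>e m\<close>; one of these is nonzero because the two points agree at \<open>e i\<close>. A
  nonzero polynomial has finitely many roots.\<close>

lemma eventually_offset_ne:
  assumes i: "i \<in> I" and "p \<noteq> q" "p $ e i = q $ e i"
  shows "eventually (\<lambda>T. offset T i p \<noteq> offset T i q) (at_right 0)"
proof -
  define w where "w = p - q"
  define P where "P = [:w $ e 0:] + (\<Sum>m\<in>I. monom (w $ e m) m - monom (w $ e m) i)"
  have "w \<noteq> 0" using assms by (simp add: w_def)
  then obtain k where "w $ k \<noteq> 0" by (auto simp: vec_eq_iff)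
  then obtain m where m: "m < n" "w $ e m \<noteq> 0" using e_surj by metis
  have mi: "m \<noteq> i" using m assms(3) by (auto simp: w_def)
  have "coeff P m = w $ e m"
  proof (cases "m = 0")
    case True
    have "(\<Sum>l\<in>I. coeff (monom (w $ e l) l - monom (w $ e l) i) 0) = 0"
      by (rule sum.neutral) (use i in auto)
    thus ?thesis using True by (simp add: P_def coeff_sum)
  next
    case False
    hence "m \<in> I" using m by auto
    moreover have "(\<Sum>l\<in>I. coeff (monom (w $ e l) l - monom (w $ e l) i) m) = (\<Sum>l\<in>I. if l = m then w $ e m else 0)"
      by (intro sum.cong) (use mi in auto)
    ultimately show ?thesis using False by (simp add: P_def coeff_sum coeff_pCons split: nat.splits)
  qed
  hence "P \<noteq> 0" using m by auto
  moreover have "poly P T = offset T i p - offset T i q" for T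
    by (simp add: P_def offset_eq w_def poly_sum poly_monom algebra_simps sum_subtractf sum.distrib sum_distrib_left)
  ultimately show ?thesis using eventually_poly_nonzero_at_right[of P 0] by simp
qed

lemma eventually_not_concurrent:
  assumes ijl: "i \<in> I" "j \<in> I" "l \<in> I" "i < j" "j < l" and less: "q $ e 0 < r $ e 0"
  shows "eventually (\<lambda>T. \<not> (\<exists>x y. x = offset T i p + T ^ i * y \<and> x = offset T j q + T ^ j * y \<and> x = offset T l r + T ^ l * y))
    (at_right 0)"
proof -
  \<comment> \<open>The 3 by 3 determinant whose vanishing is necessary for the three lines to be
    concurrent, divided by \<open>T ^ i\<close>. Without this division it would tend to 0 and decide
    nothing.\<close>
  define G where "G T = offset T i p * (T ^ (j - i) - T ^ (l - i)) + offset T j q * (T ^ (l - i) - 1) + offset T l r * (1 - T ^ (j - i))" for T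
  have "(G \<longlongrightarrow> p $ e 0 * (0 ^ (j - i) - 0 ^ (l - i)) + q $ e 0 * (0 ^ (l - i) - 1) + r $ e 0 * (1 - 0 ^ (j - i))) (at_right 0)"
    unfolding G_def by (intro tendsto_intros offset_tendsto ijl)
  hence "(G \<longlongrightarrow> r $ e 0 - q $ e 0) (at_right 0)" using ijl by (simp add: zero_power)
  hence "eventually (\<lambda>T. G T > 0) (at_right 0)" using less by (auto intro: order_tendstoD)
  thus ?thesis
  proof eventually_elim
    case (elim T)
    show ?case
    proof
      assume "\<exists>x y. x = offset T i p + T ^ i * y \<and> x = offset T j q + T ^ j * y \<and> x = offset T l r + T ^ l * y"
      then obtain x y where o: "offset T i p = x - T ^ i * y" "offset T j q = x - T ^ j * y" "offset T l r = x - T ^ l * y"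
        by (metis add_diff_cancel_right')
      have pw: "T ^ j = T ^ i * T ^ (j - i)" "T ^ l = T ^ i * T ^ (l - i)"
        using ijl by (simp_all flip: power_add)
      have "G T = 0" unfolding G_def o unfolding pw by (simp add: algebra_simps)
      thus False using elim by simp
    qed
  qed
qed

lemma eventually_power_diff_pos:
  assumes "i < j"
  shows "eventually (\<lambda>T. T ^ i - T ^ j > (0::real)) (at_right 0)"
proof -
  have "eventually (\<lambda>T. T < (1::real)) (at_right 0)" by (rule eventually_mono[OF eventually_at_right_real[of 0 1]]) auto 
  moreover have "eventually (\<lambda>T. T > (0::real)) (at_right 0)" by (rule eventually_at_right_less)
  ultimately show ?thesis
  proof eventually_elim
    case (elim T)
    thus ?case using power_strict_decreasing[OF assms, of T] by simp
  qed
qed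

definition crossing_height :: "real \<Rightarrow> nat \<Rightarrow> nat \<Rightarrow> real^'n \<Rightarrow> real^'n \<Rightarrow> real" where
  "crossing_height T i j p q = (offset T j q - offset T i p) / (T ^ i - T ^ j)"

definition crossing :: "real \<Rightarrow> nat \<Rightarrow> nat \<Rightarrow> real^'n \<Rightarrow> real^'n \<Rightarrow> real^2" where
  "crossing T i j p q =
     (\<chi> r. if r = 1 then offset T i p + T ^ i * crossing_height T i j p q else crossing_height T i j p q)"

lemma crossing_on_lines:
  assumes "T ^ i \<noteq> T ^ j"
  shows "crossing T i j p q $ 1 = offset T i p + T ^ i * crossing T i j p q $ 2"
    "crossing T i j p q $ 1 = offset T j q + T ^ j * crossing T i j p q $ 2"
proof -
  show "crossing T i j p q $ 1 = offset T i p + T ^ i * crossing T i j p q $ 2"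
    by (simp add: crossing_def)
  have "crossing_height T i j p q * (T ^ i - T ^ j) = offset T j q - offset T i p"
    using assms by (simp add: crossing_height_def)
  thus "crossing T i j p q $ 1 = offset T j q + T ^ j * crossing T i j p q $ 2"
    by (simp add: crossing_def algebra_simps)
qed

lemma proj_leg_eq_iff:
  assumes "i \<in> I"
  shows "proj T *v (p + t *\<^sub>R axis (e i) 1) = a \<longleftrightarrow>
    t = a $ 2 - (proj T *v p) $ 2 \<and> a $ 1 = offset T i p + T ^ i * a $ 2"
proof -
  have "x + t * u = a1 \<and> y + t = a2 \<longleftrightarrow> t = a2 - y \<and> a1 = x - u * y + u * a2" for x y a1 a2 u t :: real
    by (auto simp: algebra_simps)
  thus ?thesis unfolding vec_eq_iff forall_2 proj_leg[OF assms] offset_def .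
qed

text \<open>The numerator tends to the positive distance of the two walls, while the denominator
  tends to 0 from above.\<close>

lemma eventually_crossing_high:
  assumes ij: "i \<in> I" "j \<in> I" "i < j" and less: "p $ e 0 < q $ e 0"
  shows "eventually (\<lambda>T. crossing_height T i j p q > R) (at_right 0)"
proof -
  have "filterlim (\<lambda>T. inverse (T ^ i - T ^ j)) at_top (at_right (0::real))"
  proof (rule filterlim_inverse_at_top[OF _ eventually_power_diff_pos[OF ij(3)]])
    have "((\<lambda>T. T ^ i - T ^ j) \<longlongrightarrow> 0 ^ i - 0 ^ j) (at_right (0::real))" by (intro tendsto_intros)
    thus "((\<lambda>T. T ^ i - T ^ j) \<longlongrightarrow> 0) (at_right (0::real))" using ij by (simp add: zero_power)
  qed
  moreover have "((\<lambda>T. offset T j q - offset T i p) \<longlongrightarrow> q $ e 0 - p $ e 0) (at_right 0)"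
    by (intro tendsto_intros offset_tendsto ij)
  ultimately have "filterlim (\<lambda>T. (offset T j q - offset T i p) * inverse (T ^ i - T ^ j)) at_top (at_right 0)"
    using less by (intro filterlim_tendsto_pos_mult_at_top) auto
  thus ?thesis by (simp add: filterlim_at_top_dense crossing_height_def divide_inverse)
qed

text \<open>The larger index comes first, so that the fibre over \<open>j\<close> has
  \<open>j - 1\<close> elements and the cardinality is a triangular number.\<close>

definition leg_pairs :: "(nat \<times> nat) set" where "leg_pairs = (SIGMA j:I. {1..<j})"

lemma card_leg_pairs: "card leg_pairs = (n - 1) choose 2"
  unfolding leg_pairs_def using sum_pred_eq_choose_two[of "n - 1"] by simp

lemma finite_leg_pairs: "finite leg_pairs"
  by (simp add: leg_pairs_def)

lemma leg_pairsD: "(j, i) \<in> leg_pairs \<Longrightarrow> i \<in> I \<and> j \<in> I \<and> i < j"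
  by (auto simp: leg_pairs_def)

text \<open>For injectivity: a crossing lies on no leg line of a third direction, so it determines
  both directions, and within one direction distinct legs have distinct offsets. The threshold
  \<open>R\<close> ensures that the line crossings lie on the actual legs.\<close>

lemma eventually_crossings:
  fixes p :: "nat \<Rightarrow> 'c \<Rightarrow> real^'n"
  assumes fin: "finite L"
    and inj: "\<And>i. i \<in> I \<Longrightarrow> inj_on (p i) L"
    and zero: "\<And>i c. i \<in> I \<Longrightarrow> c \<in> L \<Longrightarrow> p i c $ e i = 0"
    and less: "\<And>i j c c'. i \<in> I \<Longrightarrow> j \<in> I \<Longrightarrow> i < j \<Longrightarrow> c \<in> L \<Longrightarrow> c' \<in> L \<Longrightarrow> p i c $ e 0 < p j c' $ e 0"
  shows "eventually (\<lambda>T. T > 0 \<and> T < 1 \<and>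
     (\<forall>(j, i)\<in>leg_pairs. \<forall>c\<in>L. \<forall>c'\<in>L. \<exists>t>R. \<exists>t'>R.
        proj T *v (p i c + t *\<^sub>R axis (e i) 1) = crossing T i j (p i c) (p j c') \<and>
        proj T *v (p j c' + t' *\<^sub>R axis (e j) 1) = crossing T i j (p i c) (p j c')) \<and>
     inj_on (\<lambda>((j, i), c, c'). crossing T i j (p i c) (p j c')) (leg_pairs \<times> L \<times> L)) (at_right 0)"
proof -
  \<comment> \<open>The second coordinate of the image of a base point. It does not depend on
    \<open>T\<close>, so the heights that the crossings must exceed are fixed while \<open>T\<close>
    shrinks.\<close>
  define ht where "ht i c = (\<Sum>m\<in>I. p i c $ e m)" for i c
  have "eventually (\<lambda>T. \<forall>x\<in>leg_pairs \<times> L \<times> L. case x of ((j, i), c, c') \<Rightarrow>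
      crossing_height T i j (p i c) (p j c') > R + \<bar>ht i c\<bar> + \<bar>ht j c'\<bar>) (at_right 0)"
    by (intro eventually_ball_finite)
      (auto simp: fin finite_leg_pairs dest!: leg_pairsD intro!: eventually_crossing_high less)
  moreover have "eventually (\<lambda>T. \<forall>x\<in>{(i, c, c'). i \<in> I \<and> c \<in> L \<and> c' \<in> L \<and> c \<noteq> c'}. case x of (i, c, c') \<Rightarrow>
      offset T i (p i c) \<noteq> offset T i (p i c')) (at_right 0)"
  proof (intro eventually_ball_finite ballI)
    show "finite {(i, c, c'). i \<in> I \<and> c \<in> L \<and> c' \<in> L \<and> c \<noteq> c'}"
      by (rule finite_subset[of _ "I \<times> L \<times> L"]) (auto simp: fin)
    fix x assume "x \<in> {(i, c, c'). i \<in> I \<and> c \<in> L \<and> c' \<in> L \<and> c \<noteq> c'}"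
    then obtain i c c' where x: "x = (i, c, c')" "i \<in> I" "c \<in> L" "c' \<in> L" "c \<noteq> c'" by blast
    have "p i c \<noteq> p i c'" using inj[OF x(2)] x by (auto dest: inj_onD)
    thus "eventually (\<lambda>T. case x of (i, c, c') \<Rightarrow> offset T i (p i c) \<noteq> offset T i (p i c')) (at_right 0)"
      using eventually_offset_ne[OF x(2)] zero x by simp
  qed
  moreover have "eventually (\<lambda>T. \<forall>x\<in>{(i, j, l, c, c', c''). i \<in> I \<and> j \<in> I \<and> l \<in> I \<and> i < j \<and> j < l \<and> c \<in> L \<and> c' \<in> L \<and> c'' \<in> L}.
      case x of (i, j, l, c, c', c'') \<Rightarrow> \<not> (\<exists>x y. x = offset T i (p i c) + T ^ i * y \<and>
        x = offset T j (p j c') + T ^ j * y \<and> x = offset T l (p l c'') + T ^ l * y)) (at_right 0)"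
  proof (intro eventually_ball_finite ballI)
    show "finite {(i, j, l, c, c', c''). i \<in> I \<and> j \<in> I \<and> l \<in> I \<and> i < j \<and> j < l \<and> c \<in> L \<and> c' \<in> L \<and> c'' \<in> L}"
      by (rule finite_subset[of _ "I \<times> I \<times> I \<times> L \<times> L \<times> L"]) (auto simp: fin)
    fix x assume "x \<in> {(i, j, l, c, c', c''). i \<in> I \<and> j \<in> I \<and> l \<in> I \<and> i < j \<and> j < l \<and> c \<in> L \<and> c' \<in> L \<and> c'' \<in> L}"
    then obtain i j l c c' c'' where x: "x = (i, j, l, c, c', c'')" "i \<in> I" "j \<in> I" "l \<in> I" "i < j" "j < l"
      "c \<in> L" "c' \<in> L" "c'' \<in> L" by blast
    show "eventually (\<lambda>T. case x of (i, j, l, c, c', c'') \<Rightarrow> \<not> (\<exists>x y. x = offset T i (p i c) + T ^ i * y \<and>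
        x = offset T j (p j c') + T ^ j * y \<and> x = offset T l (p l c'') + T ^ l * y)) (at_right 0)"
      unfolding x(1) prod.case by (intro eventually_not_concurrent x less)
  qed
  moreover have "eventually (\<lambda>T. T < (1::real)) (at_right 0)" by (rule eventually_mono[OF eventually_at_right_real[of 0 1]]) auto
  moreover have "eventually (\<lambda>T. T > (0::real)) (at_right 0)" by (rule eventually_at_right_less)
  ultimately show ?thesis
  proof eventually_elim
    case (elim T)
    note high = elim(1)[rule_format] and ne = elim(2)[rule_format] and conc = elim(3)[rule_format]
    have pw: "T ^ i \<noteq> T ^ j" if "i < j" for i j :: nat
      using power_strict_decreasing[OF that elim(5,4)] by (rule less_imp_neq[THEN not_sym])
    have conc3: False if "i \<in> I" "j \<in> I" "l \<in> I" "i < j" "j < l" "c \<in> L" "c' \<in> L" "c'' \<in> L"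
      "x = offset T i (p i c) + T ^ i * y" "x = offset T j (p j c') + T ^ j * y" "x = offset T l (p l c'') + T ^ l * y"
      for i j l c c' c'' x y
    proof -
      have "(i, j, l, c, c', c'') \<in> {(i, j, l, c, c', c''). i \<in> I \<and> j \<in> I \<and> l \<in> I \<and> i < j \<and> j < l \<and> c \<in> L \<and> c' \<in> L \<and> c'' \<in> L}"
        using that(1-8) by simp
      from conc[OF this, unfolded prod.case] show False using that(9-11) by blast
    qed
    have conc': False if asm: "i \<in> I" "j \<in> I" "l \<in> I" "i < j" "l \<noteq> i" "l \<noteq> j" "c \<in> L" "c' \<in> L" "c'' \<in> L"
      "x = offset T i (p i c) + T ^ i * y" "x = offset T j (p j c') + T ^ j * y" "x = offset T l (p l c'') + T ^ l * y"
      for i j l c c' c'' x y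
    proof -
      consider "l < i" | "i < l" "l < j" | "j < l" using asm by linarith
      thus False
      proof cases
        case 1 thus False using conc3[of l i j c'' c c' x y] asm by blast
      next
        case 2 thus False using conc3[of i l j c c'' c' x y] asm by blast
      next
        case 3 thus False using conc3[of i j l c c' c'' x y] asm by blast
      qed
    qed
    have cross: "\<exists>t>R. \<exists>t'>R.
        proj T *v (p i c + t *\<^sub>R axis (e i) 1) = crossing T i j (p i c) (p j c') \<and>
        proj T *v (p j c' + t' *\<^sub>R axis (e j) 1) = crossing T i j (p i c) (p j c')"
      if "(j, i) \<in> leg_pairs" "c \<in> L" "c' \<in> L" for i j c c'
    proof -
      let ?a = "crossing T i j (p i c) (p j c')"
      have ij: "i \<in> I" "j \<in> I" "i < j" using leg_pairsD that by auto
      have a2: "?a $ 2 = crossing_height T i j (p i c) (p j c')" by (simp add: crossing_def)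
      have "?a $ 2 > R + \<bar>ht i c\<bar> + \<bar>ht j c'\<bar>" using high[of "((j, i), c, c')"] that unfolding a2 by auto
      hence "?a $ 2 - (proj T *v p i c) $ 2 > R" "?a $ 2 - (proj T *v p j c') $ 2 > R"
        by (simp_all add: proj_2 ht_def)
      thus ?thesis using crossing_on_lines[OF pw[OF ij(3)]] unfolding proj_leg_eq_iff[OF ij(1)] proj_leg_eq_iff[OF ij(2)]
        by blast
    qed
    have "inj_on (\<lambda>((j, i), c, c'). crossing T i j (p i c) (p j c')) (leg_pairs \<times> L \<times> L)"
    proof (rule inj_onI, clarsimp)
      fix j i c c' j2 i2 c2 c2'
      assume "(j, i) \<in> leg_pairs" "(j2, i2) \<in> leg_pairs" and c: "c \<in> L" "c' \<in> L" "c2 \<in> L" "c2' \<in> L"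
        and eq: "crossing T i j (p i c) (p j c') = crossing T i2 j2 (p i2 c2) (p j2 c2')"
      hence ij: "i \<in> I" "j \<in> I" "i < j" and ij2: "i2 \<in> I" "j2 \<in> I" "i2 < j2" by (auto dest: leg_pairsD)
      let ?a = "crossing T i j (p i c) (p j c')"
      note l = crossing_on_lines[OF pw[OF ij(3)], of "p i c" "p j c'"]
      note l2 = crossing_on_lines[OF pw[OF ij2(3)], of "p i2 c2" "p j2 c2'", folded eq]
      have "i2 \<in> {i, j}" using conc'[OF ij(1,2) ij2(1) ij(3) _ _ c(1,2,3) l l2(1)] by blast
      moreover have "j2 \<in> {i, j}" using conc'[OF ij(1,2) ij2(2) ij(3) _ _ c(1,2,4) l l2(2)] by blast
      ultimately have s: "i2 = i" "j2 = j" using ij ij2 by auto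
      have "offset T i (p i c) = offset T i (p i c2)" "offset T j (p j c') = offset T j (p j c2')"
        using l l2 s by auto
      hence "c = c2" "c' = c2'" using ne[of "(i, c, c2)"] ne[of "(j, c', c2')"] ij c by auto
      thus "j = j2 \<and> i = i2 \<and> c = c2 \<and> c' = c2'" using s by simp
    qed
    thus ?case using elim(4,5) cross by auto
  qed
qed

section \<open>Legs of the curve and their crossings\<close>

lemma legs:
  obtains L :: "(nat \<Rightarrow> nat) set" and p :: "nat \<Rightarrow> (nat \<Rightarrow> nat) \<Rightarrow> real^'n" and R :: real
  where "finite L" "card L = (\<Prod>i\<in>I. d i)"
    "\<And>i. i \<in> I \<Longrightarrow> inj_on (p i) L"
    "\<And>i c. i \<in> I \<Longrightarrow> c \<in> L \<Longrightarrow> p i c $ e i = 0"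
    "\<And>i c. i \<in> I \<Longrightarrow> c \<in> L \<Longrightarrow> \<exists>k\<in>{1..d i}. p i c $ e 0 = \<sigma> i k"
    "\<And>i c t. i \<in> I \<Longrightarrow> c \<in> L \<Longrightarrow> t > R \<Longrightarrow> p i c + t *\<^sub>R axis (e i) 1 \<in> curve"
    "\<And>i c t. i \<in> I \<Longrightarrow> c \<in> L \<Longrightarrow> t > R \<Longrightarrow> \<exists>\<epsilon>>0.
      curve \<inter> ball (p i c + t *\<^sub>R axis (e i) 1) \<epsilon> =
      {p i c + t *\<^sub>R axis (e i) 1 + s *\<^sub>R axis (e i) 1 | s. True} \<inter> ball (p i c + t *\<^sub>R axis (e i) 1) \<epsilon>"
proof -
  have "\<forall>j s. \<exists>\<tau>. j \<in> I \<and> s \<ge> 0 \<longrightarrow> inj_on \<tau> {1..d j} \<and>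
    (\<forall>k\<in>{1..d j}. \<forall>w. w $ e 0 = s \<longrightarrow> w $ e j = \<tau> k \<longrightarrow> w \<in> trop_hyp val (g j))"
    using sheets by blast
  then obtain \<tau> where "\<forall>j s. j \<in> I \<and> s \<ge> 0 \<longrightarrow> inj_on (\<tau> j s) {1..d j} \<and>
    (\<forall>k\<in>{1..d j}. \<forall>w. w $ e 0 = s \<longrightarrow> w $ e j = \<tau> j s k \<longrightarrow> w \<in> trop_hyp val (g j))"
    by metis
  hence \<tau>: "\<And>j s. j \<in> I \<Longrightarrow> s \<ge> 0 \<Longrightarrow> inj_on (\<tau> j s) {1..d j}"
    "\<And>j s k w. j \<in> I \<Longrightarrow> s \<ge> 0 \<Longrightarrow> k \<in> {1..d j} \<Longrightarrow> w $ e 0 = s \<Longrightarrow> w $ e j = \<tau> j s k \<Longrightarrow> w \<in> trop_hyp val (g j)"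
    by blast+
  have "\<forall>i k. \<exists>R\<ge>0. i \<in> I \<and> k \<in> {1..d i} \<longrightarrow> (\<forall>w. w $ e 0 = \<sigma> i k \<longrightarrow> w $ e i > R \<longrightarrow>
    init_exps val (g i) w = {Poly_Mapping.single (e 0) k, Poly_Mapping.single (e 0) (k - 1)})"
    using wall by (metis order_refl)
  then obtain R0 where "\<forall>i k. R0 i k \<ge> 0 \<and> (i \<in> I \<and> k \<in> {1..d i} \<longrightarrow> (\<forall>w. w $ e 0 = \<sigma> i k \<longrightarrow> w $ e i > R0 i k \<longrightarrow>
    init_exps val (g i) w = {Poly_Mapping.single (e 0) k, Poly_Mapping.single (e 0) (k - 1)}))"
    by metis
  hence R0: "\<And>i k. (R0 i k :: real) \<ge> 0" "\<And>i k w. i \<in> I \<Longrightarrow> k \<in> {1..d i} \<Longrightarrow> w $ e 0 = \<sigma> i k \<Longrightarrow> w $ e i > R0 i k \<Longrightarrow>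
    init_exps val (g i) w = {Poly_Mapping.single (e 0) k, Poly_Mapping.single (e 0) (k - 1)}"
    by blast+
  \<comment> \<open>A single threshold for all walls; a sum of nonnegative terms bounds each of
    them.\<close>
  define R where "R = (\<Sum>i\<in>I. \<Sum>k\<in>{1..d i}. R0 i k)"
  have R: "R0 i k \<le> R" if "i \<in> I" "k \<in> {1..d i}" for i k
  proof -
    have "R0 i k \<le> (\<Sum>k\<in>{1..d i}. R0 i k)" using that R0(1) by (intro member_le_sum) auto
    also have "\<dots> \<le> R" unfolding R_def using that R0(1) by (intro member_le_sum sum_nonneg) auto
    finally show ?thesis .
  qed
  \<comment> \<open>For legs of direction \<open>i\<close>, the entry \<open>c i\<close> selects the
    wall of \<open>g i\<close> and every other \<open>c m\<close> a sheet of \<open>g m\<close> over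
    that wall. One index set therefore serves all directions. The coordinate along the leg is
    normalized to 0 in \<open>p\<close>.\<close>
  define L where "L = Pi\<^sub>E I (\<lambda>i. {1..d i})"
  define p :: "nat \<Rightarrow> (nat \<Rightarrow> nat) \<Rightarrow> real^'n" where
    "p i c = (\<chi> k. let m = inv_into {..<n} e k in
      if m = 0 then \<sigma> i (c i) else if m = i then 0 else \<tau> m (\<sigma> i (c i)) (c m))" for i c
  have p0: "p i c $ e 0 = \<sigma> i (c i)" for i c using n3 by (simp add: p_def inv_e)
  have pi: "p i c $ e i = 0" if "i \<in> I" for i c using that I_lt[OF that] by (simp add: p_def inv_e)
  have pj: "p i c $ e j = \<tau> j (\<sigma> i (c i)) (c j)" if "j \<in> I" "j \<noteq> i" for i j c
    using that I_lt[OF that(1)] by (simp add: p_def inv_e)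
  have cL: "c i \<in> {1..d i}" if "c \<in> L" "i \<in> I" for c i using that unfolding L_def by (auto dest: PiE_mem)
  have \<sigma>0: "\<sigma> i (c i) \<ge> 0" if "c \<in> L" "i \<in> I" for c i using sigma_pos[OF that(2) cL[OF that]] by simp
  have germ: "p i c + t *\<^sub>R axis (e i) 1 \<in> curve \<and> (\<exists>\<epsilon>>0.
      curve \<inter> ball (p i c + t *\<^sub>R axis (e i) 1) \<epsilon> =
      {p i c + t *\<^sub>R axis (e i) 1 + s *\<^sub>R axis (e i) 1 | s. True} \<inter> ball (p i c + t *\<^sub>R axis (e i) 1) \<epsilon>)"
    if i: "i \<in> I" and c: "c \<in> L" and t: "t > R" for i c t
  proof -
    let ?w = "p i c + t *\<^sub>R axis (e i) 1"
    have w0: "?w $ e 0 = \<sigma> i (c i)" using e0_ne[OF i] by (simp add: p0 axis_def)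
    have "?w $ e i > R0 i (c i)" using t R[OF i cL[OF c i]] by (simp add: pi[OF i])
    from R0(2)[OF i cL[OF c i] w0 this]
    have init: "init_exps val (g i) ?w = {Poly_Mapping.single (e 0) (c i), Poly_Mapping.single (e 0) (c i - 1)}" .
    have wj: "?w \<in> trop_hyp val (g j)" if j: "j \<in> I - {i}" for j
    proof (rule \<tau>(2)[of j "\<sigma> i (c i)" "c j"])
      have "e j \<noteq> e i" using j i e_ne by auto
      thus "?w $ e j = \<tau> j (\<sigma> i (c i)) (c j)" using j pj[of j i c] by (simp add: axis_def)
    qed (use j cL c i \<sigma>0 w0 in auto)
    show ?thesis using leg_germ[OF i cL[OF c i] w0 init wj] by blast
  qed
  show thesis
  proof (rule that[of L p R])
    show "finite L" unfolding L_def by (intro finite_PiE) auto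
    show "card L = (\<Prod>i\<in>I. d i)" unfolding L_def by (simp add: card_PiE)
  next
    fix i assume i: "i \<in> I"
    show "inj_on (p i) L"
    proof (rule inj_onI)
      fix c c' assume c: "c \<in> L" "c' \<in> L" and eq: "p i c = p i c'"
      have "\<sigma> i (c i) = \<sigma> i (c' i)" using p0 eq by metis
      hence ci: "c i = c' i" using val_pi n3 by (simp add: \<sigma>_def)
      have "c m = c' m" if m: "m \<in> I" for m
      proof (cases "m = i")
        case False
        have "\<tau> m (\<sigma> i (c i)) (c m) = \<tau> m (\<sigma> i (c i)) (c' m)" using pj[OF m False] eq ci by metis
        thus ?thesis using \<tau>(1)[OF m \<sigma>0[OF c(1) i]] cL c m by (meson inj_onD)
      qed (use ci in simp)
      thus "c = c'" using c unfolding L_def by (intro PiE_ext)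
    qed
  next
    fix i c assume "i \<in> I" "c \<in> L"
    thus "p i c $ e i = 0" "\<exists>k\<in>{1..d i}. p i c $ e 0 = \<sigma> i k" using pi p0 cL by auto
  next
    fix i c t assume "i \<in> I" "c \<in> L" "t > R"
    thus "p i c + t *\<^sub>R axis (e i) 1 \<in> curve" "\<exists>\<epsilon>>0.
      curve \<inter> ball (p i c + t *\<^sub>R axis (e i) 1) \<epsilon> =
      {p i c + t *\<^sub>R axis (e i) 1 + s *\<^sub>R axis (e i) 1 | s. True} \<inter> ball (p i c + t *\<^sub>R axis (e i) 1) \<epsilon>"
      using germ by blast+
  qed
qed

lemma self_intersections:
  obtains L :: "(nat \<Rightarrow> nat) set" and p :: "nat \<Rightarrow> (nat \<Rightarrow> nat) \<Rightarrow> real^'n" and R :: real and b :: real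
  where "finite L" "card L = (\<Prod>i\<in>I. d i)" "b > 0" "b \<le> 1"
    "\<And>i c t. i \<in> I \<Longrightarrow> c \<in> L \<Longrightarrow> t > R \<Longrightarrow> p i c + t *\<^sub>R axis (e i) 1 \<in> curve"
    "\<And>i c. i \<in> I \<Longrightarrow> c \<in> L \<Longrightarrow> \<exists>k\<in>{1..d i}. p i c $ e 0 = \<sigma> i k"
    "\<And>i c. i \<in> I \<Longrightarrow> c \<in> L \<Longrightarrow> p i c $ e i = 0"
    "\<And>T. 0 < T \<Longrightarrow> T < b \<Longrightarrow>
      inj_on (\<lambda>((j, i), c, c'). crossing T i j (p i c) (p j c')) (leg_pairs \<times> L \<times> L)"
    "\<And>T. 0 < T \<Longrightarrow> T < b \<Longrightarrow> (\<lambda>((j, i), c, c'). crossing T i j (p i c) (p j c')) ` (leg_pairs \<times> L \<times> L)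
      \<subseteq> self_intersection_pts (proj T) curve"
proof -
  obtain L and p :: "nat \<Rightarrow> (nat \<Rightarrow> nat) \<Rightarrow> real^'n" and R where
    L: "finite L" "card L = (\<Prod>i\<in>I. d i)"
    and inj: "\<And>i. i \<in> I \<Longrightarrow> inj_on (p i) L"
    and zero: "\<And>i c. i \<in> I \<Longrightarrow> c \<in> L \<Longrightarrow> p i c $ e i = 0"
    and \<sigma>: "\<And>i c. i \<in> I \<Longrightarrow> c \<in> L \<Longrightarrow> \<exists>k\<in>{1..d i}. p i c $ e 0 = \<sigma> i k"
    and mem: "\<And>i c t. i \<in> I \<Longrightarrow> c \<in> L \<Longrightarrow> t > R \<Longrightarrow> p i c + t *\<^sub>R axis (e i) 1 \<in> curve"
    and germ: "\<And>i c t. i \<in> I \<Longrightarrow> c \<in> L \<Longrightarrow> t > R \<Longrightarrow> \<exists>\<epsilon>>0.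
      curve \<inter> ball (p i c + t *\<^sub>R axis (e i) 1) \<epsilon> =
      {p i c + t *\<^sub>R axis (e i) 1 + s *\<^sub>R axis (e i) 1 | s. True} \<inter> ball (p i c + t *\<^sub>R axis (e i) 1) \<epsilon>"
    by (rule legs) blast
  have less: "p i c $ e 0 < p j c' $ e 0" if ij: "i \<in> I" "j \<in> I" "i < j" and c: "c \<in> L" "c' \<in> L" for i j c c'
    using \<sigma>[OF ij(1) c(1)] \<sigma>[OF ij(2) c(2)] sigma_less[OF ij(3,2)] by metis
  from eventually_crossings[OF L(1) inj zero less, of R]
  obtain b0 where b0: "b0 > 0" "\<And>T. T > 0 \<Longrightarrow> T < b0 \<Longrightarrow> T > 0 \<and> T < 1 \<and>
     (\<forall>(j, i)\<in>leg_pairs. \<forall>c\<in>L. \<forall>c'\<in>L. \<exists>t>R. \<exists>t'>R.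
        proj T *v (p i c + t *\<^sub>R axis (e i) 1) = crossing T i j (p i c) (p j c') \<and>
        proj T *v (p j c' + t' *\<^sub>R axis (e j) 1) = crossing T i j (p i c) (p j c')) \<and>
     inj_on (\<lambda>((j, i), c, c'). crossing T i j (p i c) (p j c')) (leg_pairs \<times> L \<times> L)"
    unfolding eventually_at_right_field by blast
  have sub: "(\<lambda>((j, i), c, c'). crossing T i j (p i c) (p j c')) ` (leg_pairs \<times> L \<times> L)
      \<subseteq> self_intersection_pts (proj T) curve" if T: "0 < T" "T < b0" for T
  proof clarify
    fix j i c c' assume ji: "(j, i) \<in> leg_pairs" and c: "c \<in> L" "c' \<in> L"
    have ij: "i \<in> I" "j \<in> I" "i < j" using leg_pairsD ji by auto
    let ?a = "crossing T i j (p i c) (p j c')"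
    obtain t t' where t: "t > R" "t' > R" "proj T *v (p i c + t *\<^sub>R axis (e i) 1) = ?a"
        "proj T *v (p j c' + t' *\<^sub>R axis (e j) 1) = ?a"
      using b0(2)[OF T] ji c by blast
    obtain \<epsilon> \<delta> where germs: "\<epsilon> > 0" "\<delta> > 0"
      "curve \<inter> ball (p i c + t *\<^sub>R axis (e i) 1) \<epsilon> =
        {p i c + t *\<^sub>R axis (e i) 1 + s *\<^sub>R axis (e i) 1 | s. True} \<inter> ball (p i c + t *\<^sub>R axis (e i) 1) \<epsilon>"
      "curve \<inter> ball (p j c' + t' *\<^sub>R axis (e j) 1) \<delta> =
        {p j c' + t' *\<^sub>R axis (e j) 1 + s *\<^sub>R axis (e j) 1 | s. True} \<inter> ball (p j c' + t' *\<^sub>R axis (e j) 1) \<delta>"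
      using germ[OF ij(1) c(1) t(1)] germ[OF ij(2) c(2) t(2)] by blast
    show "?a \<in> self_intersection_pts (proj T) curve"
    proof (rule self_intersection_ptsI[OF mem[OF ij(1) c(1) t(1)] _ germs(1,3) mem[OF ij(2) c(2) t(2)] _ germs(2,4) t(3,4)])
      show "axis (e i) (1::real) \<noteq> 0" "axis (e j) (1::real) \<noteq> 0" by (simp_all add: axis_eq_0_iff)
      have "(p i c + t *\<^sub>R axis (e i) 1) $ e 0 < (p j c' + t' *\<^sub>R axis (e j) 1) $ e 0"
        using less[OF ij c] e0_ne[OF ij(1)] e0_ne[OF ij(2)] by (simp add: axis_def)
      thus "p i c + t *\<^sub>R axis (e i) 1 \<noteq> p j c' + t' *\<^sub>R axis (e j) 1" by (metis less_irrefl)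
      fix s s' assume "s *\<^sub>R (proj T *v axis (e i) 1) = s' *\<^sub>R (proj T *v axis (e j) 1)"
      hence "s = s'" "s * T ^ i = s' * T ^ j"
        unfolding vec_eq_iff forall_2 vector_scaleR_component proj_axis[OF ij(1)] proj_axis[OF ij(2)] by auto
      moreover have "T ^ j < T ^ i" using power_strict_decreasing[OF ij(3)] b0(2)[OF T] by blast
      ultimately show "s = 0 \<and> s' = 0" by auto
    qed
  qed
  \<comment> \<open>The cap at 1 makes the powers of \<open>T\<close> strictly decreasing for every
    admissible \<open>T\<close>.\<close>
  show thesis
    by (rule that[of L "min b0 1" R p]) (use L b0 mem \<sigma> zero sub in auto)
qed

lemma mon_deg_single: "mon_deg (Poly_Mapping.single k a) = a"
proof -
  have "(\<Sum>i\<in>UNIV. Poly_Mapping.lookup (Poly_Mapping.single k a) i) = (\<Sum>i\<in>UNIV. if i = k then a else 0)"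
    by (intro sum.cong) (auto simp: lookup_single when_def)
  thus ?thesis by (simp add: mon_deg_def)
qed

lemma total_deg_g: "total_deg (g j) = d j"
proof -
  have "Max (insert 0 (mon_deg ` E j)) = d j"
  proof (rule Max_eqI)
    show "finite (insert 0 (mon_deg ` E j))" using finite_E by simp
    show "y \<le> d j" if "y \<in> insert 0 (mon_deg ` E j)" for y
      using that by (auto simp: E_def mon_deg_single)
    have "Poly_Mapping.single (e 0) (d j) \<in> E j" by (simp add: E_def)
    thus "d j \<in> insert 0 (mon_deg ` E j)" by (metis image_eqI insertCI mon_deg_single)
  qed
  thus ?thesis by (simp add: total_deg_def keys_g)
qed

lemma transversal_curve_many_crossings:
  "\<exists>(A :: real^'n^2) S. rational_projection A \<and> S \<subseteq> self_intersection_pts A curve \<and> finite S \<and>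
     card S = (\<Prod>i\<in>I. d i)\<^sup>2 * ((n - 1) choose 2)"
proof -
  obtain L and p :: "nat \<Rightarrow> (nat \<Rightarrow> nat) \<Rightarrow> real^'n" and R and b :: real
    where *: "finite L" "card L = (\<Prod>i\<in>I. d i)" "b > 0"
    "\<And>T. 0 < T \<Longrightarrow> T < b \<Longrightarrow>
      inj_on (\<lambda>((j, i), c, c'). crossing T i j (p i c) (p j c')) (leg_pairs \<times> L \<times> L)"
    "\<And>T. 0 < T \<Longrightarrow> T < b \<Longrightarrow> (\<lambda>((j, i), c, c'). crossing T i j (p i c) (p j c')) ` (leg_pairs \<times> L \<times> L)
      \<subseteq> self_intersection_pts (proj T) curve"
    by (rule self_intersections) blast
  obtain T where T: "T \<in> \<rat>" "0 < T" "T < b" using Rats_dense_in_real[OF *(3)] by blast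
  let ?S = "(\<lambda>((j, i), c, c'). crossing T i j (p i c) (p j c')) ` (leg_pairs \<times> L \<times> L)"
  have "card ?S = card leg_pairs * (card L * card L)"
    by (subst card_image[OF *(4)[OF T(2,3)]]) (simp only: card_cartesian_product)
  moreover have "finite ?S" using *(1) finite_leg_pairs by simp
  ultimately show ?thesis
    using rational_projection_proj[OF T(1)] *(5)[OF T(2,3)] *(2)
    by (intro exI[of _ "proj T"] exI[of _ ?S]) (simp add: card_leg_pairs power2_eq_square)
qed

end

section \<open>The tropical line\<close>

text \<open>Edges are closures of components, so the curve has to be closed for its cells to be
  subsets of it.\<close>

lemma closed_trop_hyp:
  fixes f :: "('n::finite, 'k::field) mpoly"
  shows "closed (trop_hyp val f)"
proof (cases "f = 0")
  case False
  let ?K = "Poly_Mapping.keys f"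
  define h where "h a w = val (Poly_Mapping.lookup f a) + exp_vec a \<bullet> w" for a w
  have init: "init_exps val f w = {a\<in>?K. \<forall>c\<in>?K. h a w \<le> h c w}" for w
    by (simp add: init_exps_def h_def)
  have "2 \<le> card (init_exps val f w) \<longleftrightarrow> (\<exists>a\<in>?K. \<exists>b\<in>?K - {a}. \<forall>c\<in>?K. h a w \<le> h c w \<and> h b w \<le> h c w)" for w
  proof
    assume "2 \<le> card (init_exps val f w)"
    then obtain S where "S \<subseteq> init_exps val f w" "card S = 2" by (meson obtain_subset_with_card_n)
    then obtain a b where "a \<in> init_exps val f w" "b \<in> init_exps val f w" "a \<noteq> b" by (auto simp: card_2_iff)
    thus "\<exists>a\<in>?K. \<exists>b\<in>?K - {a}. \<forall>c\<in>?K. h a w \<le> h c w \<and> h b w \<le> h c w"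
      unfolding init by (intro bexI[of _ a] bexI[of _ b]) auto
  next
    assume "\<exists>a\<in>?K. \<exists>b\<in>?K - {a}. \<forall>c\<in>?K. h a w \<le> h c w \<and> h b w \<le> h c w"
    then obtain a b where ab: "a \<noteq> b" "{a, b} \<subseteq> init_exps val f w" unfolding init by blast
    have "finite (init_exps val f w)" unfolding init by simp
    from card_mono[OF this ab(2)] ab(1) show "2 \<le> card (init_exps val f w)" by simp
  qed
  hence "trop_hyp val f = (\<Union>a\<in>?K. \<Union>b\<in>?K - {a}. \<Inter>c\<in>?K. {w. h a w \<le> h c w} \<inter> {w. h b w \<le> h c w})"
    unfolding trop_hyp_def using False by (simp add: set_eq_iff)
  moreover have "closed {w. h a w \<le> h c w}" for a c
    unfolding h_def by (intro closed_Collect_le continuous_intros)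
  ultimately show ?thesis by (simp add: closed_UN closed_INT closed_Int)
qed (simp add: trop_hyp_def)

text \<open>Forgets the cells: for an upper bound on the number of self-intersection points it is
  enough to bound the double points of the projection.\<close>

lemma self_intersection_pts_double:
  assumes "closed C" "a \<in> self_intersection_pts A C"
  obtains x y where "x \<in> C" "y \<in> C" "x \<noteq> y" "A *v x = a" "A *v y = a"
proof -
  obtain F G where FG: "F \<in> curve_cells C" "G \<in> curve_cells C" "F \<inter> G = {}"
      "(\<lambda>x. A *v x) ` F \<inter> (\<lambda>x. A *v x) ` G = {a}"
    using assms(2) unfolding self_intersection_pts_def by blast
  have sub: "F \<subseteq> C" if F: "F \<in> curve_cells C" for F
  proof -
    consider v where "v \<in> curve_vertices C" "F = {v}"
      | E where "E \<in> components (C - curve_vertices C)" "F = closure E"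
      using F unfolding curve_cells_def by blast
    thus ?thesis
    proof cases
      case 1 thus ?thesis by (simp add: curve_vertices_def)
    next
      case 2
      hence "E \<subseteq> C" using in_components_subset by blast
      thus ?thesis using 2 assms(1) by (simp add: closure_minimal)
    qed
  qed
  have "a \<in> (\<lambda>x. A *v x) ` F" "a \<in> (\<lambda>x. A *v x) ` G" using FG(4) by auto
  then obtain x y where "x \<in> F" "y \<in> G" "A *v x = a" "A *v y = a" by (auto elim!: imageE)
  thus thesis using that[of x y] sub FG(1-3) by blast
qed

lemma prod_power_single:
  fixes X :: "'n::finite \<Rightarrow> 'r::comm_monoid_mult"
  shows "(\<Prod>i\<in>UNIV. X i ^ Poly_Mapping.lookup (Poly_Mapping.single k a) i) = X k ^ a"
proof -
  have "(\<Prod>i\<in>UNIV. X i ^ Poly_Mapping.lookup (Poly_Mapping.single k a) i) = (\<Prod>i\<in>UNIV. if i = k then X k ^ a else 1)"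
    by (intro prod.cong) (auto simp: lookup_single when_def)
  thus ?thesis by simp
qed

locale tropical_line = caterpillar val \<pi> e d n
  for val :: "'k::field \<Rightarrow> real" and \<pi> :: 'k and e :: "nat \<Rightarrow> 'n::finite" and d n +
  assumes d_one: "d i = 1"
begin

text \<open>The exponents of \<open>\<pi>\<close> in the affine-linear \<open>g j\<close> at
  \<open>x\<^sub>0\<close> and \<open>x\<^sub>j\<close>. Below, \<open>(s j, c j)\<close> is the
  vertex of the corresponding plane tropical line.\<close>

definition h1 :: "nat \<Rightarrow> int" where "h1 j = 2 * int n - (2 * int n * int B + 1) * int j"
definition h2 :: "nat \<Rightarrow> int" where "h2 j = int n * int (M j) * (1 - int (K j))"
definition s :: "nat \<Rightarrow> real" where "s j = \<sigma> j 1"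
definition c :: "nat \<Rightarrow> real" where "c j = - \<nu> * h2 j"

lemma nu_h1: "\<nu> * h1 j = - s j"
  by (simp add: h1_def s_def \<sigma>_def algebra_simps)

lemma s_less: "i < j \<Longrightarrow> j \<in> I \<Longrightarrow> s i < s j"
  unfolding s_def by (rule sigma_less) (auto simp: d_one)

lemma s_inj: "i \<in> I \<Longrightarrow> j \<in> I \<Longrightarrow> s i = s j \<longleftrightarrow> i = j"
  using s_less[of i j] s_less[of j i] by (metis less_irrefl linorder_neqE_nat)

lemma E_line: "E j = {0, Poly_Mapping.single (e 0) 1, Poly_Mapping.single (e j) 1}"
  by (simp add: E_def d_one atMost_Suc insert_commute)

lemma monomials_distinct:
  "j \<in> I \<Longrightarrow> Poly_Mapping.single (e 0) (1::nat) \<noteq> Poly_Mapping.single (e j) 1"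
  "Poly_Mapping.single k (1::nat) \<noteq> 0"
  using e0_ne by (metis lookup_single_eq lookup_single_not_eq lookup_zero zero_neq_one)+

lemma g_line:
  assumes "j \<in> I"
  shows "g j = Poly_Mapping.single 0 1 + (Poly_Mapping.single (Poly_Mapping.single (e 0) 1) (\<pi> powi h1 j)
    + Poly_Mapping.single (Poly_Mapping.single (e j) 1) (\<pi> powi h2 j))"
proof -
  have l: "Poly_Mapping.lookup (Poly_Mapping.single (e 0) 1) (e j) = (0::nat)"
      "Poly_Mapping.lookup (Poly_Mapping.single (e j) 1) (e 0) = (0::nat)"
    using e0_ne[OF assms] by (simp_all add: lookup_single when_def)
  have "ht j 0 = 0" "ht j (Poly_Mapping.single (e 0) 1) = h1 j" "ht j (Poly_Mapping.single (e j) 1) = h2 j"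
    using l by (simp_all add: ht_def h1_def h2_def)
  moreover have "0 \<notin> {Poly_Mapping.single (e 0) 1, Poly_Mapping.single (e j) (1::nat)}"
    using monomials_distinct(2)[of "e 0"] monomials_distinct(2)[of "e j"] by auto
  ultimately show ?thesis unfolding g_def E_line using monomials_distinct(1)[OF assms] by (simp add: single_one)
qed

lemma eval_g:
  fixes \<phi> :: "'k \<Rightarrow> 'r::comm_ring_1"
  assumes "j \<in> I" "\<And>x y. \<phi> (x + y) = \<phi> x + \<phi> y" "\<And>x y. \<phi> (x * y) = \<phi> x * \<phi> y"
  shows "eval_hom \<phi> (g j) X = \<phi> 1 + \<phi> (\<pi> powi h1 j) * X (e 0) + \<phi> (\<pi> powi h2 j) * X (e j)"
  unfolding g_line[OF assms(1)]
  by (simp add: eval_hom_add[OF assms(2,3)] eval_hom_single[OF assms(2,3)] prod_power_single del: single_one)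

lemma trop_g_iff:
  assumes j: "j \<in> I"
  shows "w \<in> trop_hyp val (g j) \<longleftrightarrow>
    (w $ e 0 \<noteq> s j \<longrightarrow> w $ e j = c j + min 0 (w $ e 0 - s j)) \<and> (w $ e 0 = s j \<longrightarrow> w $ e j \<ge> c j)"
proof -
  let ?x = "Poly_Mapping.single (e 0) (1::nat)" and ?y = "Poly_Mapping.single (e j) (1::nat)"
  have tv: "tv j w 0 = 0" "tv j w ?x = w $ e 0 - s j" "tv j w ?y = w $ e j - c j"
  proof -
    show "tv j w 0 = 0" using tv_P[OF j, of 0 w] by (simp add: tp_def)
    have "tp j (w $ e 0) 1 = \<nu> * h1 j + w $ e 0" by (simp add: tp_def h1_def algebra_simps)
    thus "tv j w ?x = w $ e 0 - s j" using tv_P[OF j, of 1 w] nu_h1[of j] by (simp add: d_one)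
    show "tv j w ?y = w $ e j - c j" using tv_Q[OF j, of 1 w] by (simp add: d_one tq_def c_def h2_def algebra_simps)
  qed
  have ne: "?x \<noteq> ?y" "?x \<noteq> 0" "?y \<noteq> 0"
    using monomials_distinct(1)[OF j] monomials_distinct(2) by simp_all
  note tv = tv[unfolded One_nat_def]
  have le: "(\<forall>\<gamma>\<in>E j. t \<le> tv j w \<gamma>) \<longleftrightarrow> t \<le> 0 \<and> t \<le> w $ e 0 - s j \<and> t \<le> w $ e j - c j" for t
    unfolding E_line by (simp add: tv)
  have mem: "w \<in> trop_hyp val (g j)" if "\<alpha> \<in> E j" "\<beta> \<in> E j" "\<alpha> \<noteq> \<beta>" "tv j w \<alpha> = tv j w \<beta>"
     "tv j w \<alpha> \<le> 0 \<and> tv j w \<alpha> \<le> w $ e 0 - s j \<and> tv j w \<alpha> \<le> w $ e j - c j" for \<alpha> \<beta>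
    by (rule mem_trop_g_if_min_twice[OF that(1-4)]) (use le[of "tv j w \<alpha>"] that(5) in blast)
  show ?thesis
  proof
    assume "w \<in> trop_hyp val (g j)"
    hence "2 \<le> card (init_exps val (g j) w)" using g_nz by (simp add: trop_hyp_def)
    then obtain S where "S \<subseteq> init_exps val (g j) w" "card S = 2" by (meson obtain_subset_with_card_n)
    then obtain \<alpha> \<beta> where "\<alpha> \<in> init_exps val (g j) w" "\<beta> \<in> init_exps val (g j) w" "\<alpha> \<noteq> \<beta>" by (auto simp: card_2_iff)
    hence ab: "\<alpha> \<in> E j" "\<beta> \<in> E j" "tv j w \<alpha> = tv j w \<beta>" "\<alpha> \<noteq> \<beta>"
      and "\<forall>\<gamma>\<in>E j. tv j w \<alpha> \<le> tv j w \<gamma>"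
      unfolding init_g by (auto intro: antisym)
    hence "tv j w \<alpha> \<le> 0 \<and> tv j w \<alpha> \<le> w $ e 0 - s j \<and> tv j w \<alpha> \<le> w $ e j - c j" using le by blast
    thus "(w $ e 0 \<noteq> s j \<longrightarrow> w $ e j = c j + min 0 (w $ e 0 - s j)) \<and> (w $ e 0 = s j \<longrightarrow> w $ e j \<ge> c j)"
      using ab unfolding E_line by (auto simp: tv min_def)
  next
    assume R: "(w $ e 0 \<noteq> s j \<longrightarrow> w $ e j = c j + min 0 (w $ e 0 - s j)) \<and> (w $ e 0 = s j \<longrightarrow> w $ e j \<ge> c j)"
    have E: "0 \<in> E j" "?x \<in> E j" "?y \<in> E j" by (auto simp: E_line)
    consider "w $ e 0 = s j" | "w $ e 0 < s j" | "w $ e 0 > s j" by linarith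
    thus "w \<in> trop_hyp val (g j)"
    proof cases
      case 1 thus ?thesis using R ne by (intro mem[OF E(2,1)]) (auto simp: tv)
    next
      case 2 thus ?thesis using R ne by (intro mem[OF E(2,3)]) (auto simp: tv)
    next
      case 3 thus ?thesis using R ne by (intro mem[OF E(3,1)]) (auto simp: tv)
    qed
  qed
qed

text \<open>The first implication describes a spine, a graph over the \<open>w\<^sub>0\<close>-axis;
  the second attaches the leg in direction \<open>e j\<close> over \<open>s j\<close>.\<close>

lemma curve_iff:
  "w \<in> curve \<longleftrightarrow> (\<forall>j\<in>I. (w $ e 0 \<noteq> s j \<longrightarrow> w $ e j = c j + min 0 (w $ e 0 - s j)) \<and> (w $ e 0 = s j \<longrightarrow> w $ e j \<ge> c j))"
  using trop_g_iff by (simp add: curve_def)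

section \<open>The curve as the tropical variety of a linear ideal\<close>

declare pi_nz [simp]

lemma val_h: "val (\<pi> powi h1 j) = - s j" "val (\<pi> powi h2 j) = - c j"
  using pi_nz nu_h1[of j] by (simp_all add: val_power_int c_def mult.commute)

lemma val_one_minus:
  assumes "u \<noteq> 0" "val u \<noteq> 0"
  shows "1 - u \<noteq> 0 \<and> val (1 - u) = min 0 (val u)"
proof (cases "val u > 0")
  case True
  thus ?thesis using val_add_eq[of 1 "- u"] by simp
next
  case False
  thus ?thesis using val_add_eq[of "- u" 1] assms by simp
qed

lemma inv_cases:
  assumes "P (e 0)" "\<And>j. j \<in> I \<Longrightarrow> P (e j)"
  shows "P k"
proof -
  obtain m where "m < n" "k = e m" by (rule e_surj)
  thus ?thesis using assms by (cases "m = 0") auto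
qed

text \<open>A zero of the generators over K[t] is a zero of the whole ideal, so it suffices to find
  one whose Gauss valuations are the coordinates of \<open>w\<close>. The free valuation
  \<open>r\<close> of t carries the position of \<open>w\<close> on the spine or on a leg.\<close>

lemma curve_subset_trop_var:
  assumes w: "w \<in> curve" and f: "f \<in> gen_ideal (g ` I)"
  shows "w \<in> trop_hyp val f"
proof -
  have hom: "[:x + y:] = [:x:] + [:y:]" "[:x * y:] = [:x:] * [:y:]" for x y :: 'k by simp_all
  have suff: "w \<in> trop_hyp val f" if X: "\<And>j. j \<in> I \<Longrightarrow> 1 + [:\<pi> powi h1 j:] * X (e 0) + [:\<pi> powi h2 j:] * X (e j) = 0"
     "gauss_val r (X (e 0)) (w $ e 0)" "\<And>j. j \<in> I \<Longrightarrow> gauss_val r (X (e j)) (w $ e j)" for X r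
  proof (rule trop_hyp_if_gauss_val_zero)
    show "eval_hom (\<lambda>c. [:c:]) f X = 0"
    proof (rule eval_hom_gen_ideal[OF hom f])
      fix h assume "h \<in> g ` I"
      then obtain j where j: "j \<in> I" "h = g j" by blast
      show "eval_hom (\<lambda>c. [:c:]) h X = 0"
        using X(1)[OF j(1)] unfolding j(2) eval_g[OF j(1) hom] by (simp add: one_pCons)
    qed
    show "gauss_val r (X k) (w $ k)" for k
      by (rule inv_cases[where P = "\<lambda>k. gauss_val r (X k) (w $ k)"]) (use X in auto)
  qed
  let ?m = "inv_into {..<n} e"
  show ?thesis
  proof (cases "\<exists>i\<in>I. w $ e 0 = s i")
    case False
    hence wj: "w $ e j = c j + min 0 (w $ e 0 - s j)" if "j \<in> I" for j using w that by (auto simp: curve_iff)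
    \<comment> \<open>On the spine, t is \<open>x\<^sub>0\<close> itself and each \<open>g j\<close>
      is solved for \<open>x\<^sub>j\<close>.\<close>
    define X where "X k = (if k = e 0 then [:0, 1:] else
      [:- inverse (\<pi> powi h2 (?m k)), - inverse (\<pi> powi h2 (?m k)) * \<pi> powi h1 (?m k):])" for k
    have X0: "X (e 0) = [:0, 1:]" by (simp add: X_def)
    have Xj: "X (e j) = [:- inverse (\<pi> powi h2 j), - inverse (\<pi> powi h2 j) * \<pi> powi h1 j:]" if "j \<in> I" for j
      using e0_ne[OF that] inv_e[OF I_lt[OF that]] by (simp add: X_def)
    show ?thesis
    proof (rule suff[of X "w $ e 0"])
      show "gauss_val (w $ e 0) (X (e 0)) (w $ e 0)"
        using gauss_val_linear[of 1 "w $ e 0" 0] by (simp add: X_def)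
      fix j assume j: "j \<in> I"
      show "1 + [:\<pi> powi h1 j:] * X (e 0) + [:\<pi> powi h2 j:] * X (e j) = 0"
        unfolding X0 Xj[OF j] using pi_nz by (simp add: one_pCons mult.assoc[symmetric])
      have "val (- inverse (\<pi> powi h2 j)) = c j" "val (- inverse (\<pi> powi h2 j) * \<pi> powi h1 j) = c j - s j"
        using val_h by (simp_all add: val_mult val_inverse)
      moreover have "w $ e j = min (c j) (c j - s j + w $ e 0)" using wj[OF j] by (simp add: min_def)
      ultimately show "gauss_val (w $ e 0) (X (e j)) (w $ e j)"
        using gauss_val_linear[of "- inverse (\<pi> powi h2 j) * \<pi> powi h1 j" "w $ e 0" "- inverse (\<pi> powi h2 j)"] pi_nz
        unfolding Xj[OF j] by simp
    qed
  next
    case True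
    then obtain i where i: "i \<in> I" "w $ e 0 = s i" by blast
    define r where "r = w $ e i - c i"
    have r: "r \<ge> 0" using w i by (auto simp: curve_iff r_def)
    have wj: "w $ e j = c j + min 0 (s i - s j)" if "j \<in> I" "j \<noteq> i" for j
      using w that i s_inj[OF that(1) i(1)] by (auto simp: curve_iff)
    \<comment> \<open>On the \<open>i\<close>-th leg, t is a multiple of \<open>x\<^sub>i\<close>,
      and \<open>g i\<close> forces \<open>x\<^sub>0\<close> to be \<open>t - 1\<close> up to the
      factor \<open>\<pi> powi h1 i\<close>. Substitution into \<open>g j\<close> gives
      \<open>(1 - u j) + u j * t\<close>; since \<open>s i \<noteq> s j\<close>, the valuation of
      \<open>u j\<close> is nonzero and that of \<open>1 - u j\<close> is known.\<close>
    define u where "u j = \<pi> powi h1 j * inverse (\<pi> powi h1 i)" for j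
    define X where "X k = (if k = e 0 then [:- inverse (\<pi> powi h1 i), inverse (\<pi> powi h1 i):]
      else if k = e i then [:0, - inverse (\<pi> powi h2 i):]
      else [:- inverse (\<pi> powi h2 (?m k)) * (1 - u (?m k)), - inverse (\<pi> powi h2 (?m k)) * u (?m k):])" for k
    have X0: "X (e 0) = [:- inverse (\<pi> powi h1 i), inverse (\<pi> powi h1 i):]" by (simp add: X_def)
    have Xi: "X (e i) = [:0, - inverse (\<pi> powi h2 i):]" using e0_ne[OF i(1)] by (simp add: X_def)
    have Xj: "X (e j) = [:- inverse (\<pi> powi h2 j) * (1 - u j), - inverse (\<pi> powi h2 j) * u j:]"
      if "j \<in> I" "j \<noteq> i" for j
      using e0_ne[OF that(1)] e_ne[OF that(1) i(1) that(2)] inv_e[OF I_lt[OF that(1)]] by (simp add: X_def)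
    show ?thesis
    proof (rule suff[of X r])
      show "gauss_val r (X (e 0)) (w $ e 0)"
        using gauss_val_linear[of "inverse (\<pi> powi h1 i)" r "- inverse (\<pi> powi h1 i)"] val_h r i(2)
        by (simp add: X_def val_inverse)
      fix j assume j: "j \<in> I"
      show "1 + [:\<pi> powi h1 j:] * X (e 0) + [:\<pi> powi h2 j:] * X (e j) = 0"
      proof (cases "j = i")
        case True
        thus ?thesis using pi_nz unfolding True X0 Xi by (simp add: one_pCons)
      next
        case False
        show ?thesis using pi_nz unfolding X0 Xj[OF j False]
          by (simp add: u_def one_pCons field_simps)
      qed
      show "gauss_val r (X (e j)) (w $ e j)"
      proof (cases "j = i")
        case True
        thus ?thesis using gauss_val_linear[of "- inverse (\<pi> powi h2 i)" r 0] val_h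
          unfolding True Xi by (simp add: val_inverse r_def)
      next
        case False
        have u: "u j \<noteq> 0" "val (u j) = s i - s j" using val_h by (simp_all add: u_def val_mult val_inverse)
        hence v: "1 - u j \<noteq> 0" "val (1 - u j) = min 0 (s i - s j)"
          using val_one_minus[of "u j"] s_inj[OF i(1) j] False by auto
        have "- inverse (\<pi> powi h2 j) * (1 - u j) \<noteq> 0" "- inverse (\<pi> powi h2 j) * u j \<noteq> 0"
          using u v pi_nz by simp_all
        moreover have "val (- inverse (\<pi> powi h2 j) * (1 - u j)) = c j + min 0 (s i - s j)"
          "val (- inverse (\<pi> powi h2 j) * u j) = c j + (s i - s j)"
          using u v val_h by (simp_all add: val_mult val_inverse)
        moreover have "w $ e j = min (c j + min 0 (s i - s j)) (c j + (s i - s j) + r)"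
          using wj[OF j False] r by (simp add: min_def)
        ultimately show ?thesis
          using gauss_val_linear[of "- inverse (\<pi> powi h2 j) * u j" r "- inverse (\<pi> powi h2 j) * (1 - u j)"]
          unfolding Xj[OF j False] by simp
      qed
    qed
  qed
qed

lemma is_tropical_line_curve: "is_tropical_line val curve"
  unfolding is_tropical_line_def
proof (intro exI[of _ "g ` I"] conjI)
  show "finite (g ` I)" by simp
  show "\<forall>f\<in>g ` I. total_deg f \<le> 1" by (auto simp: total_deg_g d_one)
  have sub: "g j \<in> gen_ideal (g ` I)" if "j \<in> I" for j using that by (intro gen_ideal_superset) auto
  show "curve = trop_var val (gen_ideal (g ` I))"
    using curve_subset_trop_var sub by (auto simp: curve_def trop_var_def)
  let ?m = "inv_into {..<n} e"
  \<comment> \<open>The line is parametrized by \<open>x\<^sub>0\<close>, with each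
    \<open>g j\<close> solved for \<open>x\<^sub>j\<close>.\<close>
  define p where "p k = (if k = e 0 then 0 else - inverse (\<pi> powi h2 (?m k)))" for k
  define v where "v k = (if k = e 0 then 1 else - inverse (\<pi> powi h2 (?m k)) * \<pi> powi h1 (?m k))" for k
  have p: "p (e 0) = 0" "\<And>j. j \<in> I \<Longrightarrow> p (e j) = - inverse (\<pi> powi h2 j)"
    using e0_ne inv_e I_lt by (simp_all add: p_def)
  have v: "v (e 0) = 1" "\<And>j. j \<in> I \<Longrightarrow> v (e j) = - inverse (\<pi> powi h2 j) * \<pi> powi h1 j"
    using e0_ne inv_e I_lt by (simp_all add: v_def)
  have "x \<in> zero_set (gen_ideal (g ` I)) \<longleftrightarrow> (\<forall>j\<in>I. eval_hom (\<lambda>c. c) (g j) x = 0)" for x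
    using sub eval_hom_gen_ideal[where \<phi> = "\<lambda>c. c" and G = "g ` I" and X = x]
    by (auto simp: zero_set_def mpoly_eval_eq_eval_hom)
  also have "(\<forall>j\<in>I. eval_hom (\<lambda>c. c) (g j) x = 0) \<longleftrightarrow> (\<exists>t. x = (\<lambda>k. p k + t * v k))" for x
  proof
    assume R: "\<forall>j\<in>I. eval_hom (\<lambda>c. c) (g j) x = 0"
    have "x k = p k + x (e 0) * v k" for k
    proof (rule inv_cases[where P = "\<lambda>k. x k = p k + x (e 0) * v k"])
      fix j assume j: "j \<in> I"
      hence "1 + \<pi> powi h1 j * x (e 0) + \<pi> powi h2 j * x (e j) = 0" using R by (simp add: eval_g)
      hence "\<pi> powi h2 j * x (e j) = - (1 + \<pi> powi h1 j * x (e 0))"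
        by (subst eq_neg_iff_add_eq_0) (simp only: add.commute)
      hence "inverse (\<pi> powi h2 j) * (\<pi> powi h2 j * x (e j)) = inverse (\<pi> powi h2 j) * - (1 + \<pi> powi h1 j * x (e 0))"
        by simp
      hence "x (e j) = inverse (\<pi> powi h2 j) * - (1 + \<pi> powi h1 j * x (e 0))"
        by (simp only: mult.assoc[symmetric]) simp
      thus "x (e j) = p (e j) + x (e 0) * v (e j)" by (simp add: p(2)[OF j] v(2)[OF j] algebra_simps)
    qed (simp add: p v)
    thus "\<exists>t. x = (\<lambda>k. p k + t * v k)" by blast
  next
    assume "\<exists>t. x = (\<lambda>k. p k + t * v k)"
    then obtain t where x: "x = (\<lambda>k. p k + t * v k)" by blast
    show "\<forall>j\<in>I. eval_hom (\<lambda>c. c) (g j) x = 0"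
    proof
      fix j assume j: "j \<in> I"
      show "eval_hom (\<lambda>c. c) (g j) x = 0"
        unfolding x eval_g[OF j, of "\<lambda>c. c", simplified] p(1) v(1) p(2)[OF j] v(2)[OF j]
        using pi_nz by (simp add: field_simps)
    qed
  qed
  finally have "zero_set (gen_ideal (g ` I)) = {(\<lambda>k. p k + t * v k) | t. True}" by blast
  moreover have "v \<noteq> (\<lambda>_. 0)" using v(1) by (metis zero_neq_one)
  ultimately show "is_line (zero_set (gen_ideal (g ` I)))" unfolding is_line_def by blast
qed

text \<open>The image of the spine is a graph over the first axis of slope at most \<open>n\<close>, and the image of the \<open>i\<close>-th leg
  has slope \<open>1 / T ^ i > n\<close>. So the two images meet only where the leg starts.\<close>
lemma double_pt_on_legs:
  assumes w: "w \<in> curve" "w' \<in> curve" "w \<noteq> w'" "proj T *v w = proj T *v w'" and T: "0 < T" "T * n < 1"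
    and le: "w $ e 0 \<le> w' $ e 0"
  shows "\<exists>i\<in>I. \<exists>j\<in>I. i < j \<and> w $ e 0 = s i \<and> w' $ e 0 = s j"
proof -
  define \<mu> where "\<mu> m t = c m + min 0 (t - s m)" for m t
  let ?s = "w $ e 0" and ?s' = "w' $ e 0"
  \<comment> \<open>The excess over the spine. It is nonzero for at most one \<open>m\<close>,
    namely the leg containing the point.\<close>
  define r where "r m = w $ e m - \<mu> m ?s" for m
  define r' where "r' m = w' $ e m - \<mu> m ?s'" for m
  have r: "r m \<ge> 0" "r m \<noteq> 0 \<Longrightarrow> ?s = s m" and r': "r' m \<ge> 0" "r' m \<noteq> 0 \<Longrightarrow> ?s' = s m" if "m \<in> I" for m
    using w(1,2) that unfolding curve_iff r_def r'_def \<mu>_def by force+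
  have one: "(\<Sum>m\<in>I. f m * r m) = f i * r i" if "i \<in> I" "?s = s i" for f :: "nat \<Rightarrow> real" and i
  proof -
    have "f m * r m = (if m = i then f i * r i else 0)" if "m \<in> I" for m
      using r(2)[OF that] s_inj[OF that \<open>i \<in> I\<close>] \<open>?s = s i\<close> by auto
    hence "(\<Sum>m\<in>I. f m * r m) = (\<Sum>m\<in>I. if m = i then f i * r i else 0)" by (intro sum.cong) auto
    thus ?thesis using that by simp
  qed
  have x: "?s + (\<Sum>m\<in>I. T ^ m * \<mu> m ?s) + (\<Sum>m\<in>I. T ^ m * r m) = ?s' + (\<Sum>m\<in>I. T ^ m * \<mu> m ?s') + (\<Sum>m\<in>I. T ^ m * r' m)"
    using arg_cong[OF w(4), of "\<lambda>a. a $ 1"]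
    by (simp add: proj_1 r_def r'_def right_diff_distrib sum_subtractf)
  have y: "(\<Sum>m\<in>I. \<mu> m ?s) + (\<Sum>m\<in>I. r m) = (\<Sum>m\<in>I. \<mu> m ?s') + (\<Sum>m\<in>I. r' m)"
    using arg_cong[OF w(4), of "\<lambda>a. a $ 2"]
    by (simp add: proj_2 r_def r'_def sum_subtractf)
  have ne: "?s \<noteq> ?s'"
  proof
    assume eq: "?s = ?s'"
    have "w $ e m = w' $ e m" if m: "m \<in> I" for m
    proof (cases "?s = s m")
      case True
      have "(\<Sum>k\<in>I. w $ e k) = (\<Sum>k\<in>I. w' $ e k)" using arg_cong[OF w(4), of "\<lambda>a. a $ 2"] by (simp add: proj_2)
      moreover have "(\<Sum>k\<in>I - {m}. w $ e k) = (\<Sum>k\<in>I - {m}. w' $ e k)"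
      proof (rule sum.cong[OF refl])
        fix k assume k: "k \<in> I - {m}"
        hence "s k \<noteq> ?s" using True s_inj m by auto
        hence "r k = 0" "r' k = 0" using r(2)[of k] r'(2)[of k] k eq by auto
        thus "w $ e k = w' $ e k" using eq by (simp add: r_def r'_def)
      qed
      ultimately show ?thesis
        using sum.remove[OF finite_atLeastAtMost m, of "\<lambda>k. w $ e k"]
          sum.remove[OF finite_atLeastAtMost m, of "\<lambda>k. w' $ e k"] by linarith
    next
      case False
      hence "r m = 0" "r' m = 0" using r(2)[OF m] r'(2)[OF m] eq by auto
      thus ?thesis using eq by (simp add: r_def r'_def)
    qed
    with eq have "w $ k = w' $ k" for k
      using inv_cases[where P = "\<lambda>k. w $ k = w' $ k"] by blast
    thus False using w(3) by (simp add: vec_eq_iff)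
  qed
  hence lt: "?s < ?s'" using le by simp
  have \<mu>: "\<mu> m ?s \<le> \<mu> m ?s'" "\<mu> m ?s' - \<mu> m ?s \<le> ?s' - ?s" for m using lt by (auto simp: \<mu>_def)
  have \<mu>T: "(\<Sum>m\<in>I. T ^ m * \<mu> m ?s) \<le> (\<Sum>m\<in>I. T ^ m * \<mu> m ?s')"
    using T by (intro sum_mono mult_left_mono \<mu>) auto
  have r'T: "0 \<le> (\<Sum>m\<in>I. T ^ m * r' m)" using T r' by (intro sum_nonneg mult_nonneg_nonneg) auto
  \<comment> \<open>Without excess at the left point, the first coordinate of its image would be
    strictly smaller than that of the right point.\<close>
  have "\<exists>i\<in>I. r i \<noteq> 0"
  proof (rule ccontr)
    assume "\<not> ?thesis"
    hence "(\<Sum>m\<in>I. T ^ m * r m) = 0" by (intro sum.neutral) auto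
    thus False using x \<mu>T r'T lt by linarith
  qed
  then obtain i where i: "i \<in> I" "?s = s i" using r by blast
  have xi: "T ^ i * r i \<ge> ?s' - ?s" using x \<mu>T r'T one[OF i, of "\<lambda>m. T ^ m"] by linarith
  \<comment> \<open>If the right point were on the spine, the second coordinate would bound
    \<open>r i\<close> by \<open>n\<close> times the distance of the abscissae, whereas by
    \<open>xi\<close> the first one requires \<open>T ^ i * r i\<close> to be at least that
    distance. This contradicts \<open>T * n < 1\<close>.\<close>
  have "\<exists>j\<in>I. r' j \<noteq> 0"
  proof (rule ccontr)
    assume "\<not> ?thesis"
    hence "(\<Sum>m\<in>I. r' m) = 0" by (intro sum.neutral) auto
    hence "r i = (\<Sum>m\<in>I. \<mu> m ?s' - \<mu> m ?s)" using y one[OF i, of "\<lambda>_. 1"] by (simp add: sum_subtractf)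
    also have "\<dots> \<le> (\<Sum>m\<in>I. ?s' - ?s)" by (intro sum_mono \<mu>)
    also have "\<dots> \<le> n * (?s' - ?s)" using lt by simp
    finally have ri: "r i \<le> n * (?s' - ?s)" .
    have "T * 1 \<le> T * n" using T n3 by (intro mult_left_mono) auto
    hence "T \<le> 1" using T by linarith
    hence "T ^ i \<le> T ^ 1" using T i by (intro power_decreasing) auto
    hence "T ^ i * r i \<le> T * r i" using r(1)[OF i(1)] by (simp add: mult_right_mono)
    also have "\<dots> \<le> T * (n * (?s' - ?s))" using ri T by (intro mult_left_mono) auto
    also have "\<dots> = (T * n) * (?s' - ?s)" by simp
    also have "\<dots> < 1 * (?s' - ?s)" using lt T by (intro mult_strict_right_mono) auto
    finally show False using xi by simp
  qed
  then obtain j where j: "j \<in> I" "?s' = s j" using r' by blast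
  have "i < j"
  proof (rule ccontr)
    assume "\<not> i < j"
    hence "s j \<le> s i" using s_less[of j i] i by (cases "i = j") auto
    thus False using lt i j by simp
  qed
  thus ?thesis using i j by blast
qed

lemma line_self_intersections:
  "\<exists>A :: real^'n^2. rational_projection A \<and> finite (self_intersection_pts A curve) \<and>
     card (self_intersection_pts A curve) = (n - 1) choose 2"
proof -
  obtain L and p :: "nat \<Rightarrow> (nat \<Rightarrow> nat) \<Rightarrow> real^'n" and R and b :: real
    where L: "card L = (\<Prod>i\<in>I. d i)" and b: "b > 0" "b \<le> 1"
    and mem: "\<And>i c t. i \<in> I \<Longrightarrow> c \<in> L \<Longrightarrow> t > R \<Longrightarrow> p i c + t *\<^sub>R axis (e i) 1 \<in> curve"
    and \<sigma>: "\<And>i c. i \<in> I \<Longrightarrow> c \<in> L \<Longrightarrow> \<exists>k\<in>{1..d i}. p i c $ e 0 = \<sigma> i k"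
    and zero: "\<And>i c. i \<in> I \<Longrightarrow> c \<in> L \<Longrightarrow> p i c $ e i = 0"
    and inj: "\<And>T. 0 < T \<Longrightarrow> T < b \<Longrightarrow>
      inj_on (\<lambda>((j, i), c, c'). crossing T i j (p i c) (p j c')) (leg_pairs \<times> L \<times> L)"
    and sub: "\<And>T. 0 < T \<Longrightarrow> T < b \<Longrightarrow> (\<lambda>((j, i), c, c'). crossing T i j (p i c) (p j c')) ` (leg_pairs \<times> L \<times> L)
      \<subseteq> self_intersection_pts (proj T) curve"
    by (rule self_intersections) blast
  obtain \<kappa> where \<kappa>: "L = {\<kappa>}" using L by (auto simp: d_one card_1_singleton_iff)
  have "min b (1 / n) > 0" using b n3 by simp
  then obtain T where T: "T \<in> \<rat>" "0 < T" "T < min b (1 / n)" using Rats_dense_in_real by blast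
  have Tn: "T * n < 1" and Tb: "T < b" using T n3 by (auto simp: field_simps)
  let ?cr = "\<lambda>((j, i), c, c'). crossing T i j (p i c) (p j c')"
  let ?S = "?cr ` (leg_pairs \<times> L \<times> L)"
  \<comment> \<open>The offset gives coordinate \<open>i\<close> the weight 0, and the other
    coordinates of a point of the curve over \<open>s i\<close> are determined. So all these points
    have the same offset as the chosen leg, and the image of a double point must be the crossing of
    two leg lines.\<close>
  have off: "offset T i w = offset T i (p i \<kappa>)" if w: "w \<in> curve" and i: "i \<in> I" "w $ e 0 = s i" for w i
  proof -
    have p0: "p i \<kappa> $ e 0 = s i" using \<sigma>[OF i(1), of \<kappa>] by (simp add: \<kappa> s_def d_one)
    let ?q = "p i \<kappa> + (R + 1) *\<^sub>R axis (e i) 1"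
    have q: "?q \<in> curve" using mem[OF i(1), of \<kappa> "R + 1"] by (simp add: \<kappa>)
    have q0: "?q $ e 0 = s i" using p0 e0_ne[OF i(1)] by (simp add: axis_def)
    have "(T ^ m - T ^ i) * w $ e m = (T ^ m - T ^ i) * p i \<kappa> $ e m" if m: "m \<in> I" for m
    proof (cases "m = i")
      case False
      hence "s i \<noteq> s m" using s_inj m i by auto
      hence "w $ e m = c m + min 0 (s i - s m)" "?q $ e m = c m + min 0 (s i - s m)"
        using w q q0 i(2) m unfolding curve_iff by metis+
      moreover have "?q $ e m = p i \<kappa> $ e m" using e_ne[OF m i(1) False] by (simp add: axis_def)
      ultimately show ?thesis by simp
    qed simp
    hence "(\<Sum>m\<in>I. (T ^ m - T ^ i) * w $ e m) = (\<Sum>m\<in>I. (T ^ m - T ^ i) * p i \<kappa> $ e m)"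
      by (intro sum.cong refl)
    thus ?thesis by (simp add: offset_eq i(2) p0)
  qed
  have cross: "a \<in> ?S" if w: "w \<in> curve" "w' \<in> curve" "w \<noteq> w'" "proj T *v w = a" "proj T *v w' = a" "w $ e 0 \<le> w' $ e 0"
    for a w w'
  proof -
    obtain i j where ij: "i \<in> I" "j \<in> I" "i < j" "w $ e 0 = s i" "w' $ e 0 = s j"
      using double_pt_on_legs[OF w(1-3) _ T(2) Tn w(6)] w(4,5) by auto
    have l: "a $ 1 = offset T i (p i \<kappa>) + T ^ i * a $ 2" "a $ 1 = offset T j (p j \<kappa>) + T ^ j * a $ 2"
      using off[OF w(1) ij(1,4)] off[OF w(2) ij(2,5)] w(4,5) by (auto simp: offset_def)
    have pw: "T ^ j < T ^ i" using T(2) Tb b(2) by (intro power_strict_decreasing ij) linarith+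
    let ?z = "crossing T i j (p i \<kappa>) (p j \<kappa>)"
    have l': "?z $ 1 = offset T i (p i \<kappa>) + T ^ i * ?z $ 2" "?z $ 1 = offset T j (p j \<kappa>) + T ^ j * ?z $ 2"
      using crossing_on_lines[of T i j] pw by auto
    have "(T ^ i - T ^ j) * (a $ 2 - ?z $ 2) = 0" using l l' by (simp add: algebra_simps)
    hence "a $ 2 = ?z $ 2" using pw by simp
    hence "a = ?z" using l l' by (simp add: vec_eq_iff forall_2)
    moreover have "(j, i) \<in> leg_pairs" using ij by (auto simp: leg_pairs_def)
    ultimately show ?thesis unfolding \<kappa> by (intro image_eqI[of _ _ "((j, i), \<kappa>, \<kappa>)"]) auto
  qed
  have "closed curve" unfolding curve_def by (intro closed_INT ballI closed_trop_hyp)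
  have "self_intersection_pts (proj T) curve \<subseteq> ?S"
  proof
    fix a assume "a \<in> self_intersection_pts (proj T) curve"
    then obtain x y where "x \<in> curve" "y \<in> curve" "x \<noteq> y" "proj T *v x = a" "proj T *v y = a"
      by (rule self_intersection_pts_double[OF \<open>closed curve\<close>])
    thus "a \<in> ?S" using cross[of x y a] cross[of y x a] by (cases "x $ e 0 \<le> y $ e 0") auto
  qed
  hence eq: "self_intersection_pts (proj T) curve = ?S" using sub[OF T(2) Tb] by blast
  have "card ?S = card leg_pairs * (card L * card L)"
    by (subst card_image[OF inj[OF T(2) Tb]]) (simp only: card_cartesian_product)
  moreover have "finite ?S" using \<kappa> finite_leg_pairs by simp
  ultimately show ?thesis
    using rational_projection_proj[OF T(1)] unfolding eq[symmetric]
    by (intro exI[of _ "proj T"]) (simp add: card_leg_pairs \<kappa>)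
qed

end

lemma exists_positive_valuation:
  assumes "is_valuation val"
  obtains x where "x \<noteq> 0" "val x > (0::real)"
proof -
  interpret valued_field val using assms by unfold_locales
  obtain x where x: "x \<noteq> 0" "val x \<noteq> 0" using assms unfolding is_valuation_def by blast
  show thesis
  proof (cases "val x > 0")
    case False
    thus thesis using that[of "inverse x"] x by (simp add: val_inverse)
  qed (use that x in blast)
qed

theorem theorem5p3:
  fixes val :: "'k::field \<Rightarrow> real"
  assumes "is_valuation val"
    and "CARD('n::finite) \<ge> 3"
  shows "(\<exists>(L :: (real^'n) set) (A :: real^'n^2).
            is_tropical_line val L \<and> rational_projection A \<and>
            finite (self_intersection_pts A L) \<and>
            card (self_intersection_pts A L) = (\<Sum>i=1..CARD('n)-2. i)) \<and>
         (\<forall>d :: nat \<Rightarrow> nat. (\<forall>i\<in>{1..CARD('n)-1}. d i > 0) \<longrightarrow>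
            (\<exists>(g :: nat \<Rightarrow> ('n, 'k) mpoly) (A :: real^'n^2) (S :: (real^2) set).
               (\<forall>i\<in>{1..CARD('n)-1}. total_deg (g i) = d i) \<and>
               transversal val (CARD('n)-1) g \<and>
               rational_projection A \<and>
               S \<subseteq> self_intersection_pts A (\<Inter>i\<in>{1..CARD('n)-1}. trop_hyp val (g i)) \<and>
               finite S \<and>
               card S \<ge> (\<Prod>i=1..CARD('n)-1. d i)^2 * ((CARD('n)-1) choose 2)))"
proof -
  obtain \<pi> where pi: "\<pi> \<noteq> 0" "val \<pi> > 0" using exists_positive_valuation[OF assms(1)] .
  obtain e :: "nat \<Rightarrow> 'n" where e: "bij_betw e {..<CARD('n)} UNIV"
    using ex_bij_betw_nat_finite[of "UNIV :: 'n set"] by (auto simp: atLeast0LessThan)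
  have cat: "caterpillar val \<pi> e d CARD('n)" if "\<forall>i\<in>{1..CARD('n)-1}. d i > 0" for d
    using assms pi e that by unfold_locales auto
  show ?thesis
  proof (intro conjI allI impI)
    interpret caterpillar val \<pi> e "\<lambda>_. 1" "CARD('n)" by (rule cat) simp
    interpret tropical_line val \<pi> e "\<lambda>_. 1" "CARD('n)" by unfold_locales simp
    have "(CARD('n) - 1) choose 2 = (\<Sum>i=1..CARD('n)-2. i)"
      using sum_eq_choose_two[of "CARD('n) - 1"] by (simp add: numeral_2_eq_2)
    thus "\<exists>(L :: (real^'n) set) (A :: real^'n^2). is_tropical_line val L \<and> rational_projection A \<and>
        finite (self_intersection_pts A L) \<and> card (self_intersection_pts A L) = (\<Sum>i=1..CARD('n)-2. i)"
      using is_tropical_line_curve line_self_intersections by metis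
  next
    fix d :: "nat \<Rightarrow> nat" assume "\<forall>i\<in>{1..CARD('n)-1}. d i > 0"
    then interpret caterpillar val \<pi> e d "CARD('n)" by (rule cat)
    obtain A :: "real^'n^2" and S where "rational_projection A" "S \<subseteq> self_intersection_pts A curve" "finite S"
        "card S = (\<Prod>i=1..CARD('n)-1. d i)\<^sup>2 * ((CARD('n)-1) choose 2)"
      using transversal_curve_many_crossings by blast
    thus "\<exists>(g :: nat \<Rightarrow> ('n, 'k) mpoly) (A :: real^'n^2) (S :: (real^2) set).
         (\<forall>i\<in>{1..CARD('n)-1}. total_deg (g i) = d i) \<and> transversal val (CARD('n)-1) g \<and>
         rational_projection A \<and>
         S \<subseteq> self_intersection_pts A (\<Inter>i\<in>{1..CARD('n)-1}. trop_hyp val (g i)) \<and> finite S \<and>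
         card S \<ge> (\<Prod>i=1..CARD('n)-1. d i)^2 * ((CARD('n)-1) choose 2)"
      using transversal_g total_deg_g unfolding curve_def
      by (intro exI[of _ g] exI[of _ A] exI[of _ S]) simp
  qed
qed

end
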